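(* (Green's Theorem with specular derivatives.) Let $\Omega$ be an open, bounded subset of $\mathbb{R}^2$ whose boundary $\partial\Omega$ consists of finitely many simple, closed, piecewise $C^1$ curves. Assume $\overline{\Omega}$ is an elementary region of type III. Let $F(x,y)=P(x,y)e_1+Q(x,y)e_2$ be a vector field of class $S^1$ throughout $\overline{\Omega}$. Then $$\iint_{\overline{\Omega}}\left(\frac{\partial P}{\partial^Sx}-\frac{\partial Q}{\partial^Sy}\right)dx\,dy=\oint_{\partial\Omega}P\,dy+Q\,dx,$$ where the boundary $\partial\Omega$ is traversed in the counterclockwise direction.
   Context: Elementary regions: $E\subset\mathbb{R}^2$ is of type I if $E=\{(x,y):\omega_1(x)\le y\le\omega_2(x),\ a\le x\le b\}$ with $\omega_1,\omega_2$ continuous on $[a,b]$; of type II if $E=\{(x,y):\omega_3(y)\le x\le\omega_4(y),\ c\le y\le d\}$ with $\omega_3,\omega_4$ continuous on $[c,d]$; of type III if it is of both type I and type II. $e_1,e_2$ are the standard basis vectors of $\mathbb{R}^2$. $\frac{\partial P}{\partial^Sx}=\partial^S_xP$ and $\frac{\partial Q}{\partial^Sy}=\partial^S_yQ$ are specular partial derivatives. For $u:U\to\mathbb{R}$ with $U\subset\mathbb{R}^2$ open (variables $x_1=x$, $x_2=y$): $u[p)_{(i)}=\lim_{h\searrow0}u(p+he_i)$, $u(p]_{(i)}=\lim_{h\nearrow0}u(p+he_i)$, $\partial^R_{x_i}u(p)=\lim_{h\searrow0}\frac{u(p+he_i)-u[p)_{(i)}}{h}$, $\partial^L_{x_i}u(p)=\lim_{h\nearrow0}\frac{u(p+he_i)-u(p]_{(i)}}{h}$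 (real numbers). $\partial^S_{x_i}u(p)$ exists if both exist and $u[p)_{(i)}=u(p]_{(i)}$; with $\alpha=\partial^R_{x_i}u(p)$, $\beta=\partial^L_{x_i}u(p)$ it equals $A(\alpha,\beta)=\frac{\alpha\beta-1+\sqrt{(\alpha^2+1)(\beta^2+1)}}{\alpha+\beta}$ if $\alpha+\beta\ne0$ and $0$ otherwise. A line $\hbar$ in a set $X\subset\mathbb{R}^2$ is given by an equation $c\cdot x=b$, $x\in X$ ($c\in\mathbb{R}^2\setminus\{0\}$, $b\in\mathbb{R}$), with graph $\mathcal{G}(\hbar)=\{x\in X:c\cdot x=b\}$. If $\hbar$ is such a line in a connected subset of $U$ and for some variable $x_i$ one has $u(x]_{(i)}\ne u[x)_{(i)}$ for all $x\in\mathcal{G}(\hbar)$, then $\hbar$ is a singular hyperplane (singular line) of $u$. $u$ is piecewise continuous if there are $m\ge0$ singular lines $\hbar_1,\dots,\hbar_m$ of $u$ in $U$ such that $u$ is continuous in $U\setminus\bigcup_\ell\mathcal{G}(\hbar_\ell)$ and, for each $\ell$, the restriction of $u$ to $\mathcal{G}(\hbar_\ell)$ is continuous on $\mathcal{G}(\hbar_\ell)\setminus\bigcup_{j\ne\ell}\mathcal{G}(\hbar_j)$. $S^0(U)$: all piecewise continuous $u:U\to\mathbb{R}$ such that for every $p\in U$ and $i=1,2$, $u(p)=A(u(p]_{(i)},u[p)_{(i)})$ if $u(p]_{(i)}+u[p)_{(i)}\ne0$ and $u(p)=0$ if $u(p]_{(i)}+u[p)_{(i)}=0$. $S^1(U)$: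 all continuous $u:U\to\mathbb{R}$ such that $u\in S^0(U)$ and $\partial^S_{x}u,\partial^S_{y}u$ exist and are in $S^0(U)$. A vector field $Pe_1+Qe_2$ is of class $S^1$ if $P$ and $Q$ are; "throughout $\overline{\Omega}$" is understood as: on an open set containing $\overline{\Omega}$.
   Formalization: Added: the integrand of the double integral is absolutely integrable (class S^1 alone allows it to be non-integrable), and each point of Ω is encircled by exactly one boundary curve (otherwise, e.g. a disc minus a concentric circle, the formula with counterclockwise curves fails). *)

theory Defs
  imports "HOL-Complex_Analysis.Complex_Analysis"
begin

text \<open>The plane is \<^typ>\<open>real \<times> real\<close>. Its two standard basis vectors \<open>e\<^sub>1 = (1, 0)\<close> and
  \<open>e\<^sub>2 = (0, 1)\<close> are the elements of \<open>Basis :: (real \<times> real) set\<close>, so a statement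
  ``for \<open>i = 1, 2\<close>'' is a quantification over \<open>e \<in> Basis\<close>.

  A function \<open>u : U \<rightarrow> \<real>\<close> with \<open>U\<close> open is a total function of which only the values on \<open>U\<close> matter:
  at a point of \<open>U\<close> all the limits below depend on \<open>u\<close> near that point only.\<close>


subsection \<open>Specular partial derivatives\<close>

definition right_limit :: "(real \<times> real \<Rightarrow> real) \<Rightarrow> real \<times> real \<Rightarrow> real \<times> real \<Rightarrow> real \<Rightarrow> bool" where
  "right_limit u e p l \<longleftrightarrow> ((\<lambda>h. u (p + h *\<^sub>R e)) \<longlongrightarrow> l) (at_right 0)"

definition left_limit :: "(real \<times> real \<Rightarrow> real) \<Rightarrow> real \<times> real \<Rightarrow> real \<times> real \<Rightarrow> real \<Rightarrow> bool" where
  "left_limit u e p l \<longleftrightarrow> ((\<lambda>h. u (p + h *\<^sub>R e)) \<longlongrightarrow> l) (at_left 0)"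

text \<open>The difference quotients use the one-sided limit of \<open>u\<close> at \<open>p\<close>, not the value \<open>u p\<close>.\<close>

definition right_derivative :: "(real \<times> real \<Rightarrow> real) \<Rightarrow> real \<times> real \<Rightarrow> real \<times> real \<Rightarrow> real \<Rightarrow> bool" where
  "right_derivative u e p \<alpha> \<longleftrightarrow>
     (\<exists>l. right_limit u e p l \<and> ((\<lambda>h. (u (p + h *\<^sub>R e) - l) / h) \<longlongrightarrow> \<alpha>) (at_right 0))"

definition left_derivative :: "(real \<times> real \<Rightarrow> real) \<Rightarrow> real \<times> real \<Rightarrow> real \<times> real \<Rightarrow> real \<Rightarrow> bool" where
  "left_derivative u e p \<beta> \<longleftrightarrow>
     (\<exists>l. left_limit u e p l \<and> ((\<lambda>h. (u (p + h *\<^sub>R e) - l) / h) \<longlongrightarrow> \<beta>) (at_left 0))"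

definition spec_mean :: "real \<Rightarrow> real \<Rightarrow> real" where
  "spec_mean \<alpha> \<beta> =
     (if \<alpha> + \<beta> = 0 then 0
      else (\<alpha> * \<beta> - 1 + sqrt ((\<alpha>\<^sup>2 + 1) * (\<beta>\<^sup>2 + 1))) / (\<alpha> + \<beta>))"

definition has_specular_partial :: "(real \<times> real \<Rightarrow> real) \<Rightarrow> real \<times> real \<Rightarrow> real \<times> real \<Rightarrow> real \<Rightarrow> bool" where
  "has_specular_partial u e p s \<longleftrightarrow>
     (\<exists>\<alpha> \<beta>. right_derivative u e p \<alpha> \<and> left_derivative u e p \<beta> \<and>
       (\<exists>l. right_limit u e p l \<and> left_limit u e p l) \<and> s = spec_mean \<alpha> \<beta>)"

text \<open>The value is unique where it exists, since limits are.\<close>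

definition specular_partial :: "(real \<times> real \<Rightarrow> real) \<Rightarrow> real \<times> real \<Rightarrow> real \<times> real \<Rightarrow> real" where
  "specular_partial u e p = (THE s. has_specular_partial u e p s)"


subsection \<open>Piecewise continuity and the classes \<open>S\<^sup>0\<close> and \<open>S\<^sup>1\<close>\<close>

text \<open>\<open>G\<close> is the graph of a singular line \<open>c \<bullet> x = b\<close> (\<open>x \<in> X\<close>) of \<open>u\<close>; the line itself is represented
  by its graph.\<close>

definition singular_line :: "(real \<times> real) set \<Rightarrow> (real \<times> real \<Rightarrow> real) \<Rightarrow> (real \<times> real) set \<Rightarrow> bool" where
  "singular_line U u G \<longleftrightarrow>
     (\<exists>c b X. c \<noteq> 0 \<and> X \<subseteq> U \<and> connected X \<and> G = {x \<in> X. c \<bullet> x = b}) \<and>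
     (\<exists>e\<in>Basis. \<forall>x\<in>G. \<exists>l r. left_limit u e x l \<and> right_limit u e x r \<and> l \<noteq> r)"

definition piecewise_continuous :: "(real \<times> real) set \<Rightarrow> (real \<times> real \<Rightarrow> real) \<Rightarrow> bool" where
  "piecewise_continuous U u \<longleftrightarrow>
     (\<exists>H. finite H \<and> (\<forall>G\<in>H. singular_line U u G) \<and>
       continuous_on (U - \<Union>H) u \<and>
       (\<forall>G\<in>H. continuous_on (G - \<Union>(H - {G})) u))"

definition class_S0 :: "(real \<times> real) set \<Rightarrow> (real \<times> real \<Rightarrow> real) \<Rightarrow> bool" where
  "class_S0 U u \<longleftrightarrow>
     piecewise_continuous U u \<and>
     (\<forall>p\<in>U. \<forall>e\<in>Basis. \<exists>l r. left_limit u e p l \<and> right_limit u e p r \<and> u p = spec_mean l r)"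

definition class_S1 :: "(real \<times> real) set \<Rightarrow> (real \<times> real \<Rightarrow> real) \<Rightarrow> bool" where
  "class_S1 U u \<longleftrightarrow>
     continuous_on U u \<and> class_S0 U u \<and>
     (\<forall>e\<in>Basis. (\<forall>p\<in>U. \<exists>s. has_specular_partial u e p s) \<and> class_S0 U (specular_partial u e))"


subsection \<open>Elementary regions\<close>

definition type_I_region :: "(real \<times> real) set \<Rightarrow> bool" where
  "type_I_region E \<longleftrightarrow>
     (\<exists>a b \<omega>\<^sub>1 \<omega>\<^sub>2. a \<le> b \<and> continuous_on {a..b} \<omega>\<^sub>1 \<and> continuous_on {a..b} \<omega>\<^sub>2 \<and>
       E = {(x, y). \<omega>\<^sub>1 x \<le> y \<and> y \<le> \<omega>\<^sub>2 x \<and> a \<le> x \<and> x \<le> b})"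

definition type_II_region :: "(real \<times> real) set \<Rightarrow> bool" where
  "type_II_region E \<longleftrightarrow>
     (\<exists>c d \<omega>\<^sub>3 \<omega>\<^sub>4. c \<le> d \<and> continuous_on {c..d} \<omega>\<^sub>3 \<and> continuous_on {c..d} \<omega>\<^sub>4 \<and>
       E = {(x, y). \<omega>\<^sub>3 y \<le> x \<and> x \<le> \<omega>\<^sub>4 y \<and> c \<le> y \<and> y \<le> d})"

definition type_III_region :: "(real \<times> real) set \<Rightarrow> bool" where
  "type_III_region E \<longleftrightarrow> type_I_region E \<and> type_II_region E"


subsection \<open>Boundary curves and line integrals\<close>

text \<open>Piecewise \<open>C\<^sup>1\<close> in the usual sense: \<open>C\<^sup>1\<close> on each closed interval of a subdivision, with
  one-sided derivatives at its ends. The library predicate \<^const>\<open>valid_path\<close> is weaker: it puts no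
  condition on the derivative near the break points, where it may be unbounded.\<close>

definition piecewise_C1_path :: "(real \<Rightarrow> real \<times> real) \<Rightarrow> bool" where
  "piecewise_C1_path g \<longleftrightarrow>
     (\<exists>(m::nat) s. s 0 = 0 \<and> s m = 1 \<and>
       (\<forall>k<m. s k < s (Suc k) \<and>
         (\<exists>g'. continuous_on {s k..s (Suc k)} g' \<and>
           (\<forall>t\<in>{s k..s (Suc k)}. (g has_vector_derivative g' t) (at t within {s k..s (Suc k)})))))"

definition simple_closed_piecewise_C1 :: "(real \<Rightarrow> real \<times> real) \<Rightarrow> bool" where
  "simple_closed_piecewise_C1 g \<longleftrightarrow>
     simple_path g \<and> pathfinish g = pathstart g \<and> piecewise_C1_path g"

definition plane_to_complex :: "real \<times> real \<Rightarrow> complex" where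
  "plane_to_complex p = Complex (fst p) (snd p)"

text \<open>For simple closed curves. The identification of \<open>(x, y)\<close> with \<open>x + \<i> y\<close> gives access to the
  library's winding number; for a clockwise curve the value inside is \<open>-1\<close>.\<close>

definition counterclockwise :: "(real \<Rightarrow> real \<times> real) \<Rightarrow> bool" where
  "counterclockwise g \<longleftrightarrow>
     (\<forall>p\<in>inside (path_image g). winding_number (plane_to_complex \<circ> g) (plane_to_complex p) = 1)"

text \<open>The curves \<open>\<gamma> 0, \<dots>, \<gamma> (n - 1)\<close> together traverse the boundary of \<open>\<Omega>\<close> once, counterclockwise.
  The last condition says that \<open>\<Omega>\<close> is encircled exactly once. It excludes repeated curves, and also a
  curve of the frontier nested inside another one and having \<open>\<Omega>\<close> on both sides (such as the inner
  circle of the frontier of a disc from which a concentric circle is removed), for which a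
  counterclockwise direction of the boundary of \<open>\<Omega>\<close> makes no sense.\<close>

definition counterclockwise_boundary ::
    "(real \<times> real) set \<Rightarrow> nat \<Rightarrow> (nat \<Rightarrow> real \<Rightarrow> real \<times> real) \<Rightarrow> bool" where
  "counterclockwise_boundary \<Omega> n \<gamma> \<longleftrightarrow>
     (\<forall>i<n. simple_closed_piecewise_C1 (\<gamma> i) \<and> counterclockwise (\<gamma> i)) \<and>
     frontier \<Omega> = (\<Union>i<n. path_image (\<gamma> i)) \<and>
     (\<forall>p\<in>\<Omega>. \<exists>!i. i < n \<and> p \<in> inside (path_image (\<gamma> i)))"

text \<open>\<open>\<integral> P dy + Q dx\<close> along \<open>g\<close>: note that \<open>P\<close> goes with \<open>dy\<close> and \<open>Q\<close> with \<open>dx\<close>.\<close>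

definition line_integral_dy_dx ::
    "(real \<times> real \<Rightarrow> real) \<Rightarrow> (real \<times> real \<Rightarrow> real) \<Rightarrow> (real \<Rightarrow> real \<times> real) \<Rightarrow> real" where
  "line_integral_dy_dx P Q g =
     integral {0..1} (\<lambda>t. P (g t) * snd (vector_derivative g (at t)) +
                          Q (g t) * fst (vector_derivative g (at t)))"

end

theory Submission
  imports Defs
begin

text \<open>
  Write \<open>E\<close> for the closure of \<open>\<Omega>\<close>; its horizontal and vertical slices are compact intervals. Both
  sides of the identity are compared with the iterated boundary terms: the integral over \<open>y\<close> of the
  increment of \<open>P\<close> along the horizontal slice at height \<open>y\<close>, minus the integral over \<open>x\<close> of the
  increment of \<open>Q\<close> along the vertical slice.

  \<^emph>\<open>Area side.\<close> Off finitely many lines the specular partial derivatives are continuous, hence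
  integrate to the increments of the field on slices. Only their difference is assumed integrable, so
  Fubini's theorem is not available for each of them on \<open>E\<close>. Cut \<open>E\<close> along the lines, and exhaust each
  piece by compact sets disjoint from the lines: there both derivatives are bounded, and since \<open>P\<close> and
  \<open>Q\<close> are continuous the boundary terms pass to the limit and the contributions of the cuts cancel.

  \<^emph>\<open>Curve side.\<close> By the Stone-Weierstrass theorem it suffices to treat polynomials in \<open>x\<close> and \<open>y\<close>,
  which are sums of products \<open>\<Phi> x * f (x + \<i> y)\<close> with \<open>f\<close> entire. The Cauchy transform over a rectangle
  of \<open>\<phi> = \<Phi>'\<close>, as a function of the real part only, is \<open>2 \<pi> \<Phi>\<close> plus a holomorphic function. Integrating
  it against \<open>f\<close> along a closed curve and exchanging the integrals turns the contour integral into
  \<open>\<i>\<close> times the area integral of \<open>\<phi> f\<close> weighted by the winding number. The winding numbers of the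
  boundary curves add up to the indicator function of \<open>E\<close> almost everywhere.
\<close>

text \<open>The limits in \<open>class_S0\<close> are taken along the axes at each point separately,
  which gives no evident uniform bound on the derivatives near a singular line; hence the
  exhaustion, in which only the boundary terms have to converge. The cuts may disconnect a type III
  region, so the induction runs over compact sets with convex slices. The boundary curves are tied
  to the region by the union of their images and by winding numbers, and no parametrization is
  related to the graphs of the type I or type II form. The line integral is therefore not computed
  arc by arc: Cauchy's integral formula turns winding numbers into integrals, which is why a real
  statement passes through the complex plane. Since dz = dx + i dy, the integrals of P dy and Q dx
  are the imaginary part and the real part of contour integrals. The factor 2 pi has a classical
  origin: 1 / (pi z) is the fundamental solution of the Cauchy-Riemann operator (d/dx + i d/dy) / 2,
  and this operator maps \<open>\<Phi> (Re z)\<close> to half of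
  \<open>\<phi> (Re z)\<close>.\<close>

section \<open>Integrating a continuous function with one-sided derivatives\<close>

text \<open>\<open>spec_mean a b\<close> is the tangent of the mean of the angles arctan a and
  arctan b, so it lies between a and b. The proof is algebraic: with p and q the secants of the two
  angles, the differences are p (p - q) / (a + b) and - q (p - q) / (a + b).\<close>

lemma spec_mean_between: "(a - spec_mean a b) * (b - spec_mean a b) \<le> 0"
proof (cases "a + b = 0")
  case True
  then have "b = - a" by simp
  then show ?thesis by (simp add: spec_mean_def)
next
  case False
  define p where "p = sqrt (a\<^sup>2 + 1)"
  define q where "q = sqrt (b\<^sup>2 + 1)"
  have p2: "p * p = a\<^sup>2 + 1" and q2: "q * q = b\<^sup>2 + 1" and pq: "0 \<le> p" "0 \<le> q"
    unfolding p_def q_def by (auto simp: add_nonneg_nonneg)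
  have s: "spec_mean a b = (a * b - 1 + p * q) / (a + b)"
    using False by (simp add: spec_mean_def p_def q_def real_sqrt_mult)
  have "a - spec_mean a b = (a * (a + b) - (a * b - 1 + p * q)) / (a + b)"
    using False unfolding s by (simp add: field_simps)
  also have "a * (a + b) - (a * b - 1 + p * q) = p * (p - q)"
    using p2 by (simp add: algebra_simps power2_eq_square)
  finally have 1: "a - spec_mean a b = p * (p - q) / (a + b)" .
  have "b - spec_mean a b = (b * (a + b) - (a * b - 1 + p * q)) / (a + b)"
    using False unfolding s by (simp add: field_simps)
  also have "b * (a + b) - (a * b - 1 + p * q) = - q * (p - q)"
    using q2 by (simp add: algebra_simps power2_eq_square)
  finally have 2: "b - spec_mean a b = - q * (p - q) / (a + b)" .
  have "(a - spec_mean a b) * (b - spec_mean a b) = - (p * q * ((p - q) / (a + b))\<^sup>2)"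
    unfolding 1 2 by (simp add: power2_eq_square mult_ac)
  also have "\<dots> \<le> 0" using pq by simp
  finally show ?thesis .
qed

text \<open>A strict local minimum is the only strict minimizer on some interval with rational ends,
  and there are countably many such intervals.\<close>

lemma countable_strict_local_minima:
  fixes f :: "real \<Rightarrow> real"
  shows "countable {x. \<exists>e>0. \<forall>y. y \<noteq> x \<longrightarrow> \<bar>y - x\<bar> < e \<longrightarrow> f x < f y}" (is "countable ?M")
proof -
  define A where "A p q = {x. p < x \<and> x < q \<and> (\<forall>y. p < y \<and> y < q \<and> y \<noteq> x \<longrightarrow> f x < f y)}" for p q
  have sub: "?M \<subseteq> (\<Union>p\<in>\<rat>. \<Union>q\<in>\<rat>. A p q)"
  proof
    fix x assume "x \<in> ?M"
    then obtain e where e: "e > 0" "\<And>y. y \<noteq> x \<Longrightarrow> \<bar>y - x\<bar> < e \<Longrightarrow> f x < f y" by auto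
    obtain p where p: "p \<in> \<rat>" "x - e < p" "p < x"
      using Rats_dense_in_real[of "x - e" x] e(1) by auto
    obtain q where q: "q \<in> \<rat>" "x < q" "q < x + e"
      using Rats_dense_in_real[of x "x + e"] e(1) by auto
    have "x \<in> A p q"
      using p q e(2) unfolding A_def by (auto simp: abs_less_iff)
    then show "x \<in> (\<Union>p\<in>\<rat>. \<Union>q\<in>\<rat>. A p q)" using p q by blast
  qed
  have "countable (A p q)" for p q
  proof -
    have "x = y" if "x \<in> A p q" "y \<in> A p q" for x y
    proof (rule ccontr)
      assume "x \<noteq> y"
      then have "f x < f y" "f y < f x" using that unfolding A_def by auto
      then show False by simp
    qed
    then have "A p q = {} \<or> (\<exists>x. A p q = {x})" by blast
    then show ?thesis by auto
  qed
  then show ?thesis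
    by (intro countable_subset[OF sub] countable_UN countable_rat) auto
qed

text \<open>Which of the two one-sided derivatives is negative may change from point to point. A
  last-point argument refutes a negative right derivative only; the points left over are strict
  local minima, too few to take every value of a nondegenerate interval.\<close>

lemma decreasing_if_one_sided_derivative_negative:
  fixes f :: "real \<Rightarrow> real"
  assumes ab: "a \<le> b" and cont: "continuous_on {a..b} f"
    and der: "\<And>x. a < x \<Longrightarrow> x < b \<Longrightarrow> \<exists>\<alpha> \<beta>. ((\<lambda>h. (f (x + h) - f x) / h) \<longlongrightarrow> \<alpha>) (at_right 0) \<and>
       ((\<lambda>h. (f (x + h) - f x) / h) \<longlongrightarrow> \<beta>) (at_left 0) \<and> (\<alpha> < 0 \<or> \<beta> < 0)"
  shows "f b \<le> f a"
proof (rule ccontr)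
  assume "\<not> f b \<le> f a"
  then have lt: "f a < f b" by simp
  define M where "M = {x. \<exists>e>0. \<forall>y. y \<noteq> x \<longrightarrow> \<bar>y - x\<bar> < e \<longrightarrow> f x < f y}"
  \<comment> \<open>For each level between \<open>f a\<close> and \<open>f b\<close>, the last point where \<open>f\<close> is below the level is a strict
    local minimum, since the right derivative there is nonnegative.\<close>
  have "{f a<..<f b} \<subseteq> f ` M"
  proof
    fix c assume c: "c \<in> {f a<..<f b}"
    define S where "S = {x\<in>{a..b}. f x \<le> c}"
    have "closed S" unfolding S_def
      by (rule continuous_on_closed_Collect_le[OF cont continuous_on_const closed_atLeastAtMost])
    have "bounded S"
      by (rule bounded_subset[OF bounded_closed_interval[of a b]]) (auto simp: S_def)
    with \<open>closed S\<close> have "compact S" by (simp add: compact_eq_bounded_closed)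
    have "a \<in> S" using c ab unfolding S_def by auto
    define x where "x = Sup S"
    have xS: "x \<in> S"
      unfolding x_def using \<open>compact S\<close> \<open>a \<in> S\<close>
      by (intro closed_contains_Sup \<open>closed S\<close>) (auto intro: bounded_imp_bdd_above compact_imp_bounded)
    have up: "y \<le> x" if "y \<in> S" for y
      unfolding x_def using \<open>compact S\<close> that
      by (intro cSup_upper) (auto intro: bounded_imp_bdd_above compact_imp_bounded)
    have gt: "c < f y" if "x < y" "y \<le> b" for y
      using up[of y] that xS unfolding S_def by force
    have "x \<noteq> b" using xS c unfolding S_def by auto
    then have xb: "x < b" using xS unfolding S_def by auto
    have fx: "f x = c"
    proof (rule ccontr)
      assume "f x \<noteq> c"
      then have "f x < c" using xS unfolding S_def by auto
      moreover have "continuous_on {x..b} f"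
        using cont xS unfolding S_def by (auto intro: continuous_on_subset)
      ultimately obtain z where "x \<le> z" "z \<le> b" "f z = c"
        using IVT'[of f x c b] c xb by auto
      then show False using gt[of z] \<open>f x < c\<close> by (cases "z = x") auto
    qed
    have "x \<noteq> a" using fx c by auto
    then have ax: "a < x" using xS unfolding S_def by auto
    obtain \<alpha> \<beta> where d: "((\<lambda>h. (f (x + h) - f x) / h) \<longlongrightarrow> \<alpha>) (at_right 0)"
       "((\<lambda>h. (f (x + h) - f x) / h) \<longlongrightarrow> \<beta>) (at_left 0)" "\<alpha> < 0 \<or> \<beta> < 0"
      using der[OF ax xb] by blast
    have "0 \<le> \<alpha>"
    proof (rule tendsto_lowerbound[OF d(1)])
      show "\<forall>\<^sub>F h in at_right 0. 0 \<le> (f (x + h) - f x) / h"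
        unfolding eventually_at_right_field
        by (rule exI[of _ "b - x"]) (use xb gt fx in \<open>auto intro!: divide_nonneg_pos less_imp_le\<close>)
    qed simp
    then have "\<beta> < 0" using d(3) by simp
    then have "\<forall>\<^sub>F h in at_left 0. (f (x + h) - f x) / h < 0"
      using order_tendstoD(2)[OF d(2)] by blast
    then obtain e where e: "e < 0" "\<And>h. e < h \<Longrightarrow> h < 0 \<Longrightarrow> (f (x + h) - f x) / h < 0"
      unfolding eventually_at_left_field by auto
    have "f x < f y" if "y \<noteq> x" "\<bar>y - x\<bar> < min (- e) (b - x)" for y
    proof (cases "x < y")
      case True
      then show ?thesis using gt[of y] fx that by auto
    next
      case False
      then have "(f (x + (y - x)) - f x) / (y - x) < 0" using e(2)[of "y - x"] that by auto
      then show ?thesis using False that by (auto simp: divide_less_0_iff)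
    qed
    then have "x \<in> M" unfolding M_def using e(1) xb by (auto intro!: exI[of _ "min (- e) (b - x)"])
    then show "c \<in> f ` M" using fx by auto
  qed
  moreover have "countable (f ` M)"
    unfolding M_def using countable_strict_local_minima by (intro countable_image)
  ultimately have "countable {f a<..<f b}" by (rule countable_subset)
  then show False using lt uncountable_open_interval by blast
qed

text \<open>Let \<open>T\<close> be the integral of \<open>s\<close>. The one-sided derivatives of
  \<open>f - T\<close> have opposite signs or vanish, so for either sign \<sigma> and every e > 0
  the function \<open>\<sigma> * (f x - T x) - e * x\<close> has a negative one-sided derivative
  everywhere inside. Both signs together, with e tending to 0, make \<open>f - T\<close> take equal
  values at a and b.\<close>

lemma has_integral_one_sided_derivatives:
  fixes f s :: "real \<Rightarrow> real"
  assumes ab: "a \<le> b" and cont: "continuous_on {a..b} f" and cs: "continuous_on {a..b} s"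
    and der: "\<And>x. a < x \<Longrightarrow> x < b \<Longrightarrow> \<exists>\<alpha> \<beta>. ((\<lambda>h. (f (x + h) - f x) / h) \<longlongrightarrow> \<alpha>) (at_right 0) \<and>
       ((\<lambda>h. (f (x + h) - f x) / h) \<longlongrightarrow> \<beta>) (at_left 0) \<and> (\<alpha> - s x) * (\<beta> - s x) \<le> 0"
  shows "(s has_integral f b - f a) {a..b}"
proof -
  define T where "T x = integral {a..x} s" for x
  have Tder: "(T has_real_derivative s x) (at x)" if "a < x" "x < b" for x
  proof -
    have "(T has_real_derivative s x) (at x within {a..b})"
      unfolding T_def using integral_has_real_derivative[OF cs] that by auto
    then show ?thesis using that by (simp add: at_within_Icc_at)
  qed
  have Tlim: "((\<lambda>h. (T (x + h) - T x) / h) \<longlongrightarrow> s x) (at_right 0)"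
    "((\<lambda>h. (T (x + h) - T x) / h) \<longlongrightarrow> s x) (at_left 0)" if "a < x" "x < b" for x
    using Tder[OF that] unfolding DERIV_def by (simp_all add: filterlim_at_split)
  have Tcont: "continuous_on {a..b} T" unfolding T_def
    by (intro indefinite_integral_continuous_1 integrable_continuous_real cs)
  have key: "\<sigma> * (f b - T b) - e * b \<le> \<sigma> * (f a - T a) - e * a" if "e > 0" "\<sigma> = 1 \<or> \<sigma> = -1" for e \<sigma>
  proof (rule decreasing_if_one_sided_derivative_negative[OF ab, of "\<lambda>x. \<sigma> * (f x - T x) - e * x"])
    show "continuous_on {a..b} (\<lambda>x. \<sigma> * (f x - T x) - e * x)"
      by (intro continuous_intros cont Tcont)
    fix x assume x: "a < x" "x < b"
    obtain \<alpha> \<beta> where d: "((\<lambda>h. (f (x + h) - f x) / h) \<longlongrightarrow> \<alpha>) (at_right 0)"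
       "((\<lambda>h. (f (x + h) - f x) / h) \<longlongrightarrow> \<beta>) (at_left 0)" "(\<alpha> - s x) * (\<beta> - s x) \<le> 0"
      using der[OF x] by blast
    have eq: "((\<sigma> * (f (x + h) - T (x + h)) - e * (x + h)) - (\<sigma> * (f x - T x) - e * x)) / h
        = \<sigma> * ((f (x + h) - f x) / h - (T (x + h) - T x) / h) - e" if "h \<noteq> 0" for h
      using that by (simp add: field_simps)
    have 1: "((\<lambda>h. ((\<sigma> * (f (x + h) - T (x + h)) - e * (x + h)) - (\<sigma> * (f x - T x) - e * x)) / h)
        \<longlongrightarrow> \<sigma> * (\<alpha> - s x) - e) (at_right 0)"
    proof (rule Lim_transform_eventually)
      show "((\<lambda>h. \<sigma> * ((f (x + h) - f x) / h - (T (x + h) - T x) / h) - e) \<longlongrightarrow> \<sigma> * (\<alpha> - s x) - e) (at_right 0)"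
        by (intro tendsto_intros d Tlim x)
    qed (auto simp: eq eventually_at_filter)
    have 2: "((\<lambda>h. ((\<sigma> * (f (x + h) - T (x + h)) - e * (x + h)) - (\<sigma> * (f x - T x) - e * x)) / h)
        \<longlongrightarrow> \<sigma> * (\<beta> - s x) - e) (at_left 0)"
    proof (rule Lim_transform_eventually)
      show "((\<lambda>h. \<sigma> * ((f (x + h) - f x) / h - (T (x + h) - T x) / h) - e) \<longlongrightarrow> \<sigma> * (\<beta> - s x) - e) (at_left 0)"
        by (intro tendsto_intros d Tlim x)
    qed (auto simp: eq eventually_at_filter)
    have "\<sigma> * (\<alpha> - s x) - e < 0 \<or> \<sigma> * (\<beta> - s x) - e < 0"
    proof -
      have "\<alpha> - s x \<le> 0 \<and> 0 \<le> \<beta> - s x \<or> 0 \<le> \<alpha> - s x \<and> \<beta> - s x \<le> 0"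
        using d(3) by (auto simp: mult_le_0_iff)
      then show ?thesis using that by auto
    qed
    with 1 2 show "\<exists>\<alpha> \<beta>. ((\<lambda>h. ((\<sigma> * (f (x + h) - T (x + h)) - e * (x + h)) - (\<sigma> * (f x - T x) - e * x)) / h)
         \<longlongrightarrow> \<alpha>) (at_right 0) \<and>
        ((\<lambda>h. ((\<sigma> * (f (x + h) - T (x + h)) - e * (x + h)) - (\<sigma> * (f x - T x) - e * x)) / h) \<longlongrightarrow> \<beta>) (at_left 0) \<and>
        (\<alpha> < 0 \<or> \<beta> < 0)" by blast
  qed
  have le: "\<sigma> * (f b - T b) \<le> \<sigma> * (f a - T a)" if "\<sigma> = 1 \<or> \<sigma> = -1" for \<sigma>
  proof (rule field_le_epsilon)
    fix e :: real assume "e > 0"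
    \<comment> \<open>The summand 1 keeps the quotient defined when a = b.\<close>
    define k where "k = e / (b - a + 1)"
    have k: "k > 0" "k * (b - a) \<le> e"
      unfolding k_def using \<open>e > 0\<close> ab by (simp_all add: field_simps)
    from key[OF k(1) that] have "\<sigma> * (f b - T b) \<le> \<sigma> * (f a - T a) + k * (b - a)"
      by (simp add: algebra_simps)
    also have "k * (b - a) \<le> e" by (rule k(2))
    finally show "\<sigma> * (f b - T b) \<le> \<sigma> * (f a - T a) + e" by simp
  qed
  from le[of 1] le[of "-1"] have "f b - T b = f a - T a" by simp
  moreover have "T a = 0" by (simp add: T_def)
  ultimately have "T b = f b - f a" by simp
  moreover have "(s has_integral T b) {a..b}" unfolding T_def
    by (intro integrable_integral integrable_continuous_real cs)
  ultimately show ?thesis by simp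
qed

section \<open>Green's formula on regions with convex slices\<close>

text \<open>When \<open>E\<close> is compact with convex slices, the integral of \<open>xdiff P E\<close> stands for \<open>\<integral> P dy\<close> along the
  counterclockwise boundary of \<open>E\<close>, and that of \<open>ydiff Q E\<close> for \<open>- \<integral> Q dx\<close>.\<close>

definition xdiff :: "(real \<times> real \<Rightarrow> real) \<Rightarrow> (real \<times> real) set \<Rightarrow> real \<Rightarrow> real" where
  "xdiff P E y = (if {x. (x, y) \<in> E} = {} then 0
     else P (Sup {x. (x, y) \<in> E}, y) - P (Inf {x. (x, y) \<in> E}, y))"

definition ydiff :: "(real \<times> real \<Rightarrow> real) \<Rightarrow> (real \<times> real) set \<Rightarrow> real \<Rightarrow> real" where
  "ydiff Q E = xdiff (Q \<circ> prod.swap) (prod.swap ` E)"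

text \<open>This form is stable under intersection with half-planes, whereas a cut of a type III
  region may fall apart into pieces with disjoint projections. Vertical slices are handled by
  applying it to the set with exchanged coordinates.\<close>

definition xconvex :: "(real \<times> real) set \<Rightarrow> bool" where
  "xconvex E \<longleftrightarrow> (\<forall>y. convex {x. (x, y) \<in> E})"

lemma compact_slice:
  assumes "compact (E :: (real \<times> real) set)"
  shows "compact {x. (x, y) \<in> E}"
proof -
  have "{x. (x, y) \<in> E} = fst ` (E \<inter> UNIV \<times> {y})" by force
  moreover have "compact (E \<inter> UNIV \<times> {y})"
    by (intro compact_Int_closed assms closed_Times) auto
  ultimately show ?thesis
    by (auto intro!: compact_continuous_image continuous_on_fst continuous_on_id)
qed

lemma slice_cases:
  assumes "compact E" "xconvex E"
  obtains "{x. (x, y) \<in> E} = {}" | l r where "l \<le> r" "{x. (x, y) \<in> E} = {l..r}"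
proof -
  have "connected {x. (x, y) \<in> E}"
    using assms(2) convex_connected unfolding xconvex_def by blast
  then obtain l r where "{x. (x, y) \<in> E} = {l..r}"
    using compact_slice[OF assms(1)] connected_compact_interval_1 by metis
  then show ?thesis using that by (cases "l \<le> r") auto
qed

lemma xdiff_empty: "{x. (x, y) \<in> E} = {} \<Longrightarrow> xdiff P E y = 0"
  by (simp add: xdiff_def)

lemma xdiff_interval:
  assumes "{x. (x, y) \<in> E} = {l..r}" "l \<le> r"
  shows "xdiff P E y = P (r, y) - P (l, y)"
  unfolding xdiff_def assms(1) using assms(2) by simp

lemma compact_swap: "compact (E :: (real \<times> real) set) \<Longrightarrow> compact (prod.swap ` E)"
  by (intro compact_continuous_image continuous_on_swap)

lemma has_integral_indicator_scaleR:
  assumes "integrable lborel (\<lambda>z::'a::euclidean_space. indicator E z *\<^sub>R (f z :: real))"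
  shows "(f has_integral (\<integral>z. indicator E z *\<^sub>R f z \<partial>lborel)) E"
proof -
  have "((\<lambda>z. indicator E z *\<^sub>R f z) has_integral (\<integral>z. indicator E z *\<^sub>R f z \<partial>lborel)) UNIV"
    by (rule has_integral_integral_lborel[OF assms])
  moreover have "(\<lambda>z. indicator E z *\<^sub>R f z) = (\<lambda>z. if z \<in> E then f z else 0)"
    by (auto simp: indicator_def)
  ultimately show ?thesis by (simp add: has_integral_restrict_UNIV)
qed

text \<open>Fubini's theorem, with the inner integral evaluated on a slice, which is empty or a
  compact interval. Integrability in the plane comes from continuity on a compact set, so this
  applies only to sets that avoid the singular lines.\<close>

lemma has_integral_xdiff:
  assumes E: "compact E" "xconvex E" and cont: "continuous_on E p"
    and ftc: "\<And>y l r. l \<le> r \<Longrightarrow> (\<And>x. l \<le> x \<Longrightarrow> x \<le> r \<Longrightarrow> (x, y) \<in> E) \<Longrightarrow>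
       ((\<lambda>x. p (x, y)) has_integral P (r, y) - P (l, y)) {l..r}"
  shows "(xdiff P E has_integral (\<integral>z. indicator E z *\<^sub>R p z \<partial>lborel)) UNIV"
proof -
  define F where "F = (\<lambda>z. indicator E z *\<^sub>R p z)"
  have int: "integrable lborel F"
    unfolding F_def by (rule borel_integrable_compact[OF E(1) cont])
  then have int2: "integrable (lborel \<Otimes>\<^sub>M lborel) (case_prod (\<lambda>x y. F (x, y)))"
    by (simp add: lborel_prod)
  have inner: "(\<integral>x. F (x, y) \<partial>lborel) = xdiff P E y" for y
  proof (cases rule: slice_cases[OF E, of y])
    case 1
    then have "F (x, y) = 0" for x unfolding F_def by auto
    then show ?thesis using xdiff_empty[OF 1] by simp
  next
    case (2 l r)
    have mem: "(x, y) \<in> E \<longleftrightarrow> x \<in> {l..r}" for x using 2 by blast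
    then have eq: "F (x, y) = indicator {l..r} x *\<^sub>R p (x, y)" for x
      unfolding F_def by (simp add: indicator_def)
    have "continuous_on {l..r} (\<lambda>x. p (x, y))"
      by (rule continuous_on_compose2[OF cont]) (auto intro!: continuous_intros simp: mem)
    then have "integrable lborel (\<lambda>x. indicator {l..r} x *\<^sub>R p (x, y))"
      by (intro borel_integrable_compact) auto
    from has_integral_indicator_scaleR[OF this]
    have "((\<lambda>x. p (x, y)) has_integral (\<integral>x. F (x, y) \<partial>lborel)) {l..r}" by (simp add: eq)
    moreover have "((\<lambda>x. p (x, y)) has_integral P (r, y) - P (l, y)) {l..r}"
      by (rule ftc) (use 2 mem in auto)
    ultimately have "(\<integral>x. F (x, y) \<partial>lborel) = P (r, y) - P (l, y)"
      by (rule has_integral_unique)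
    then show ?thesis using xdiff_interval[OF 2(2,1)] by simp
  qed
  have "integrable lborel (\<lambda>y. xdiff P E y)"
    using lborel_pair.integrable_snd[OF int2] by (simp add: inner)
  from has_integral_integral_lborel[OF this]
  have "(xdiff P E has_integral (\<integral>y. xdiff P E y \<partial>lborel)) UNIV" by simp
  also have "(\<integral>y. xdiff P E y \<partial>lborel) = integral\<^sup>L lborel F"
    using lborel_pair.integral_snd[OF int2] by (simp add: inner lborel_prod)
  finally show ?thesis unfolding F_def .
qed

lemma has_integral_ydiff:
  assumes E: "compact E" "xconvex (prod.swap ` E)" and cont: "continuous_on E q"
    and ftc: "\<And>x l r. l \<le> r \<Longrightarrow> (\<And>y. l \<le> y \<Longrightarrow> y \<le> r \<Longrightarrow> (x, y) \<in> E) \<Longrightarrow>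
       ((\<lambda>y. q (x, y)) has_integral Q (x, r) - Q (x, l)) {l..r}"
  shows "(ydiff Q E has_integral (\<integral>z. indicator E z *\<^sub>R q z \<partial>lborel)) UNIV"
proof -
  have mem: "(a, b) \<in> prod.swap ` E \<longleftrightarrow> (b, a) \<in> E" for a b by force
  have "(xdiff (Q \<circ> prod.swap) (prod.swap ` E) has_integral
     (\<integral>z. indicator (prod.swap ` E) z *\<^sub>R (q \<circ> prod.swap) z \<partial>lborel)) UNIV"
  proof (rule has_integral_xdiff)
    show "continuous_on (prod.swap ` E) (q \<circ> prod.swap)"
      by (intro continuous_on_compose continuous_on_swap) (simp add: image_image cont)
  qed (use E compact_swap ftc mem in auto)
  moreover have "(\<integral>z. indicator (prod.swap ` E) z *\<^sub>R (q \<circ> prod.swap) z \<partial>lborel) =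
      (\<integral>z. indicator E z *\<^sub>R q z \<partial>lborel)"
  proof -
    have "(\<lambda>z. indicator E z *\<^sub>R q z) \<in> borel_measurable (lborel \<Otimes>\<^sub>M lborel)"
      using borel_integrable_compact[OF E(1) cont] by (simp add: lborel_prod)
    from lborel_pair.integral_product_swap[OF this]
    have "(\<integral>(x, y). indicator E (y, x) *\<^sub>R q (y, x) \<partial>lborel) = (\<integral>z. indicator E z *\<^sub>R q z \<partial>lborel)"
      by (simp add: lborel_prod)
    moreover have "(\<lambda>(x, y). indicator E (y, x) *\<^sub>R q (y, x)) =
       (\<lambda>z. indicator (prod.swap ` E) z *\<^sub>R (q \<circ> prod.swap) z)"
      by (auto simp: indicator_def mem)
    ultimately show ?thesis by simp
  qed
  ultimately show ?thesis by (simp add: ydiff_def)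
qed

section \<open>Half-plane cuts and their boundary terms\<close>

text \<open>A pair \<open>(c, b)\<close> represents the half-plane \<open>c \<bullet> z \<le> b\<close>, and its bounding line.\<close>

definition cut :: "((real \<times> real) \<times> real) set \<Rightarrow> real \<Rightarrow> (real \<times> real) set \<Rightarrow> (real \<times> real) set" where
  "cut B d E = {z\<in>E. \<forall>(c, b)\<in>B. c \<bullet> z \<le> b - d}"

lemma compact_cut:
  assumes "compact E" shows "compact (cut B d E)"
proof -
  have "cut B d E = E \<inter> (\<Inter>(c, b)\<in>B. {z. c \<bullet> z \<le> b - d})"
    unfolding cut_def by auto
  also have "compact \<dots>"
    by (intro compact_Int_closed assms closed_INT) (auto intro: closed_halfspace_le)
  finally show ?thesis .
qed

lemma xconvex_cut:
  assumes "xconvex E" shows "xconvex (cut B d E)"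
  unfolding xconvex_def
proof
  fix y
  have eq: "{x. (x, y) \<in> cut B d E} = {x. (x, y) \<in> E} \<inter> (\<Inter>(c, b)\<in>B. {x. fst c * x \<le> b - d - snd c * y})"
    unfolding cut_def by (auto simp: inner_prod_def algebra_simps)
  have "convex {x. a * x \<le> t}" for a t :: real
    using convex_halfspace_le[of a t] by simp
  then show "convex {x. (x, y) \<in> cut B d E}" 
    unfolding eq using assms by (intro convex_Int convex_INT) (auto simp: xconvex_def)
qed

lemma swap_cut: "prod.swap ` cut B d E = cut ((\<lambda>(c, b). (prod.swap c, b)) ` B) d (prod.swap ` E)"
proof -
  have 1: "prod.swap c \<bullet> z = c \<bullet> prod.swap z" for c z :: "real \<times> real"
    by (cases c, cases z) simp
  have "z \<in> prod.swap ` cut B d E \<longleftrightarrow> prod.swap z \<in> cut B d E" for z by force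
  moreover have "z \<in> prod.swap ` E \<longleftrightarrow> prod.swap z \<in> E" for z by force
  ultimately show ?thesis
    by (auto simp: set_eq_iff cut_def split_beta 1)
qed

text \<open>These are the heights at which a whole row lies on one of the lines. There the slices of
  the cuts need not converge to the slice of the region, and splitting along the line counts the row
  twice.\<close>

lemma negligible_finite_rows: "finite B \<Longrightarrow> negligible {y. \<exists>(c, b)\<in>B. fst c = 0 \<and> c \<noteq> 0 \<and> snd c * y = (b::real)}"
  for B :: "((real \<times> real) \<times> real) set"
proof -
  assume "finite B"
  have "{y. \<exists>(c, b)\<in>B. fst c = 0 \<and> c \<noteq> 0 \<and> snd c * y = b} \<subseteq> (\<lambda>(c, b). b / snd c) ` B"
    by (force simp: prod_eq_iff field_simps)
  then show ?thesis using \<open>finite B\<close> finite_surj negligible_finite by blast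
qed

text \<open>The dominating function for the increments along slices: a constant on the compact
  projection of \<open>E\<close> to the second coordinate.\<close>

lemma integrable_bound_compact:
  assumes "compact (E :: (real \<times> real) set)"
  shows "(\<lambda>y. if {x. (x, y) \<in> E} = {} then 0 else M :: real) integrable_on UNIV"
proof -
  have "compact (snd ` E)"
    by (intro compact_continuous_image continuous_on_snd continuous_on_id assms)
  then have "(\<lambda>y. M) integrable_on (snd ` E)"
    by (intro integrable_on_const lmeasurable_compact)
  then have "(\<lambda>y. if y \<in> snd ` E then M else 0) integrable_on UNIV"
    by (simp add: integrable_restrict_UNIV)
  moreover have "(\<lambda>y. if y \<in> snd ` E then M else 0) = (\<lambda>y. if {x. (x, y) \<in> E} = {} then 0 else M)"
    by (force simp: image_iff)
  ultimately show ?thesis by simp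
qed

lemma xdiff_bound:
  assumes "compact E" "xconvex E" "\<And>z. z \<in> E \<Longrightarrow> \<bar>P z\<bar> \<le> M"
  shows "\<bar>xdiff P E y\<bar> \<le> (if {x. (x, y) \<in> E} = {} then 0 else 2 * M)"
proof (cases rule: slice_cases[OF assms(1,2), of y])
  case 1
  then show ?thesis by (simp add: xdiff_empty)
next
  case (2 l r)
  then have "(l, y) \<in> E" "(r, y) \<in> E" by (auto simp: set_eq_iff)
  then have "\<bar>P (l, y)\<bar> \<le> M" "\<bar>P (r, y)\<bar> \<le> M" using assms(3) by auto
  moreover have "{x. (x, y) \<in> E} \<noteq> {}" using 2 by auto
  ultimately show ?thesis using xdiff_interval[OF 2(2,1), of P] by auto
qed

text \<open>An interior point of the slice \<open>{l..r}\<close> lies strictly inside every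
  half-plane of \<open>B\<close>, hence in the cut as soon as the margin is small. So the ends of
  the slices of the cuts tend to l and r, and continuity of \<open>P\<close> does the rest.\<close>

lemma xdiff_cut_tendsto:
  assumes E: "compact E" "xconvex E" and cont: "continuous_on E P"
    and B: "finite B" "\<And>c b. (c, b) \<in> B \<Longrightarrow> c \<noteq> 0" "\<And>c b z. (c, b) \<in> B \<Longrightarrow> z \<in> E \<Longrightarrow> c \<bullet> z \<le> b"
    and y: "\<not> (\<exists>(c, b)\<in>B. fst c = 0 \<and> c \<noteq> 0 \<and> snd c * y = b)"
  shows "(\<lambda>n. xdiff P (cut B (inverse (real (Suc n))) E) y) \<longlonglongrightarrow> xdiff P E y"
proof (cases rule: slice_cases[OF E, of y])
  case 1
  then have "{x. (x, y) \<in> cut B (inverse (real (Suc n))) E} = {}" for n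
    unfolding cut_def by auto
  then show ?thesis using 1 by (simp add: xdiff_empty)
next
  case (2 l r)
  have mem: "(x, y) \<in> E \<longleftrightarrow> l \<le> x \<and> x \<le> r" for x using 2 by (auto simp: set_eq_iff)
  show ?thesis
  proof (cases "l = r")
    case True
    \<comment> \<open>A cut may lose a one-point slice altogether. This does no harm, because the
      value of \<open>xdiff\<close> on an empty slice agrees with the increment over a single
      point.\<close>
    have "xdiff P (cut B d E) y = 0" for d
    proof (cases "(l, y) \<in> cut B d E")
      case T: True
      then have "{x. (x, y) \<in> cut B d E} = {l..l}" using mem True unfolding cut_def by auto
      from xdiff_interval[OF this] show ?thesis by simp
    next
      case False
      then have "{x. (x, y) \<in> cut B d E} = {}" using mem True unfolding cut_def by auto
      then show ?thesis by (rule xdiff_empty)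
    qed
    moreover have "xdiff P E y = 0" using xdiff_interval[OF 2(2,1)] True by simp
    ultimately show ?thesis by simp
  next
    case False
    then have lr: "l < r" using 2 by simp
    \<comment> \<open>On the row, \<open>c \<bullet> (x, y)\<close> is affine in x and at most b at
      both ends. If it is not constant it is below b in between; if it is constant, the hypothesis
      on y excludes the value b.\<close>
    have strict: "c \<bullet> (x, y) < b" if "(c, b) \<in> B" "l < x" "x < r" for c b x
    proof (cases "fst c = 0")
      case True
      have "c \<bullet> (x, y) \<le> b" using B(3)[OF that(1), of "(x, y)"] mem that by auto
      moreover have "snd c * y \<noteq> b" using y that(1) B(2)[OF that(1)] True by auto
      ultimately show ?thesis using True by (simp add: inner_prod_def)
    next
      case False
      have "c \<bullet> (l, y) \<le> b" "c \<bullet> (r, y) \<le> b" using B(3)[OF that(1)] mem lr by auto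
      moreover have "fst c * x < max (fst c * l) (fst c * r)"
        using False that(2,3) by (cases "fst c > 0") (auto simp: less_max_iff_disj)
      ultimately show ?thesis by (auto simp: inner_prod_def)
    qed
    have ev: "\<forall>\<^sub>F n in sequentially. (x, y) \<in> cut B (inverse (real (Suc n))) E" if "l < x" "x < r" for x
    proof -
      have "\<forall>\<^sub>F n in sequentially. inverse (real (Suc n)) < snd p - fst p \<bullet> (x, y)" if "p \<in> B" for p
      proof -
        have "0 < snd p - fst p \<bullet> (x, y)" using strict[of "fst p" "snd p" x] \<open>l < x\<close> \<open>x < r\<close> that by simp
        then show ?thesis using order_tendstoD(2)[OF LIMSEQ_inverse_real_of_nat] by blast
      qed
      then have "\<forall>\<^sub>F n in sequentially. \<forall>p\<in>B. inverse (real (Suc n)) < snd p - fst p \<bullet> (x, y)"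
        using B(1) by (simp add: eventually_ball_finite)
      then show ?thesis
        by eventually_elim (use mem that in \<open>fastforce simp: cut_def\<close>)
    qed
    \<comment> \<open>For small n the slice of the cut may be empty and these values are
      meaningless; every statement about them is made for cuts containing a given point, which holds
      eventually.\<close>
    define L R where "L n = Inf {x. (x, y) \<in> cut B (inverse (real (Suc n))) E}"
      and "R n = Sup {x. (x, y) \<in> cut B (inverse (real (Suc n))) E}" for n
    have LR: "l \<le> L n \<and> L n \<le> x \<and> x \<le> R n \<and> R n \<le> r \<and>
       xdiff P (cut B (inverse (real (Suc n))) E) y = P (R n, y) - P (L n, y)"
      if "(x, y) \<in> cut B (inverse (real (Suc n))) E" for n x
    proof (cases rule: slice_cases[OF compact_cut[OF E(1), of B "inverse (real (Suc n))"] xconvex_cut[OF E(2)], of y])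
      case 1
      then show ?thesis using that by auto
    next
      case (2 u v)
      then have uv: "L n = u" "R n = v" unfolding L_def R_def by auto
      have "(u, y) \<in> E" "(v, y) \<in> E" using 2 unfolding cut_def by (auto simp: set_eq_iff)
      moreover have "u \<le> x" "x \<le> v" using that 2(2) by (auto simp: set_eq_iff)
      ultimately show ?thesis using uv mem xdiff_interval[OF 2(2,1)] by auto
    qed
    define m where "m = (l + r) / 2"
    have m: "l < m" "m < r" using lr unfolding m_def by auto
    have Rlim: "R \<longlonglongrightarrow> r"
    proof (rule order_tendstoI)
      fix a assume "a < r"
      define x where "x = (max a m + r) / 2"
      have "l < x" "x < r" "a < x" using \<open>a < r\<close> m unfolding x_def by auto
      then have "a < R n" if "(x, y) \<in> cut B (inverse (real (Suc n))) E" for n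
        using LR[OF that] \<open>a < x\<close> by linarith
      then show "\<forall>\<^sub>F n in sequentially. a < R n"
        by (rule eventually_mono[OF ev[OF \<open>l < x\<close> \<open>x < r\<close>]])
    next
      fix a assume "r < a"
      then have "R n < a" if "(m, y) \<in> cut B (inverse (real (Suc n))) E" for n
        using LR[OF that] \<open>r < a\<close> by linarith
      then show "\<forall>\<^sub>F n in sequentially. R n < a"
        by (rule eventually_mono[OF ev[OF m]])
    qed
    have Llim: "L \<longlonglongrightarrow> l"
    proof (rule order_tendstoI)
      fix a assume "l < a"
      define x where "x = (min a m + l) / 2"
      have "l < x" "x < r" "x < a" using \<open>l < a\<close> m unfolding x_def by auto
      then have "L n < a" if "(x, y) \<in> cut B (inverse (real (Suc n))) E" for n
        using LR[OF that] \<open>x < a\<close> by linarith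
      then show "\<forall>\<^sub>F n in sequentially. L n < a"
        by (rule eventually_mono[OF ev[OF \<open>l < x\<close> \<open>x < r\<close>]])
    next
      fix a assume "a < l"
      then have "a < L n" if "(m, y) \<in> cut B (inverse (real (Suc n))) E" for n
        using LR[OF that] \<open>a < l\<close> by linarith
      then show "\<forall>\<^sub>F n in sequentially. a < L n"
        by (rule eventually_mono[OF ev[OF m]])
    qed
    have cP: "continuous_on {l..r} (\<lambda>x. P (x, y))"
      by (rule continuous_on_compose2[OF cont]) (auto intro!: continuous_intros simp: mem)
    have in_lr: "\<forall>\<^sub>F n in sequentially. l \<le> L n \<and> L n \<le> r \<and> l \<le> R n \<and> R n \<le> r"
    proof (rule eventually_mono[OF ev[OF m]])
      fix n assume "(m, y) \<in> cut B (inverse (real (Suc n))) E"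
      from LR[OF this] m show "l \<le> L n \<and> L n \<le> r \<and> l \<le> R n \<and> R n \<le> r" by linarith
    qed
    have "(\<lambda>n. P (R n, y)) \<longlonglongrightarrow> P (r, y)"
      by (rule continuous_on_tendsto_compose[OF cP Rlim])
         (use lr in_lr in \<open>auto elim: eventually_mono\<close>)
    moreover have "(\<lambda>n. P (L n, y)) \<longlonglongrightarrow> P (l, y)"
      by (rule continuous_on_tendsto_compose[OF cP Llim])
         (use lr in_lr in \<open>auto elim: eventually_mono\<close>)
    ultimately have "(\<lambda>n. P (R n, y) - P (L n, y)) \<longlonglongrightarrow> xdiff P E y"
      unfolding xdiff_interval[OF 2(2,1)] by (intro tendsto_diff)
    then show ?thesis
      by (rule Lim_transform_eventually) (rule eventually_mono[OF ev[OF m]], drule LR, elim conjE, erule sym)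
  qed
qed

text \<open>Dominated convergence over the heights. The boundary terms involve only
  \<open>P\<close>, which is bounded on \<open>E\<close>, so they have a limit even if the partial
  derivative of \<open>P\<close> is not integrable on \<open>E\<close>.\<close>

lemma xdiff_cut_integral_tendsto:
  assumes E: "compact E" "xconvex E" and cont: "continuous_on E P"
    and B: "finite B" "\<And>c b. (c, b) \<in> B \<Longrightarrow> c \<noteq> 0" "\<And>c b z. (c, b) \<in> B \<Longrightarrow> z \<in> E \<Longrightarrow> c \<bullet> z \<le> b"
    and I: "\<And>n. (xdiff P (cut B (inverse (real (Suc n))) E) has_integral I n) UNIV"
  obtains J where "(xdiff P E has_integral J) UNIV" "I \<longlonglongrightarrow> J"
proof -
  define N where "N = {y. \<exists>(c, b)\<in>B. fst c = 0 \<and> c \<noteq> 0 \<and> snd c * y = b}"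
  have N: "negligible N" unfolding N_def by (rule negligible_finite_rows[OF B(1)])
  \<comment> \<open>Resetting the values to 0 on the exceptional heights makes the convergence hold
    everywhere, as the dominated convergence theorem requires.\<close>
  define F where "F n y = (if y \<in> N then 0 else xdiff P (cut B (inverse (real (Suc n))) E) y)" for n y
  define G where "G y = (if y \<in> N then 0 else xdiff P E y)" for y
  have F: "(F n has_integral I n) UNIV" for n
    by (rule has_integral_spike[OF N _ I[of n]]) (simp add: F_def)
  obtain M where M: "\<And>z. z \<in> E \<Longrightarrow> \<bar>P z\<bar> \<le> M"
    using compact_imp_bounded[OF compact_continuous_image[OF cont E(1)]]
    unfolding bounded_iff by auto
  \<comment> \<open>If \<open>E\<close> is empty, the bound \<open>M\<close> may be
    negative.\<close>
  define M' where "M' = max M 0"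
  have M': "\<And>z. z \<in> E \<Longrightarrow> \<bar>P z\<bar> \<le> M'" "M' \<ge> 0" using M unfolding M'_def by force+
  have bound: "norm (F n y) \<le> (if {x. (x, y) \<in> E} = {} then 0 else 2 * M')" for n y
  proof (cases "y \<in> N")
    case True then show ?thesis using M' by (simp add: F_def)
  next
    case False
    have "\<bar>F n y\<bar> \<le> (if {x. (x, y) \<in> cut B (inverse (real (Suc n))) E} = {} then 0 else 2 * M')"
      using xdiff_bound[OF compact_cut[OF E(1)] xconvex_cut[OF E(2)], of B "inverse (real (Suc n))" P M' y]
        M'(1) False unfolding F_def cut_def by auto
    also have "\<dots> \<le> (if {x. (x, y) \<in> E} = {} then 0 else 2 * M')"
      using M'(2) unfolding cut_def by auto
    finally show ?thesis by simp
  qed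
  have conv: "(\<lambda>n. F n y) \<longlonglongrightarrow> G y" for y
    using xdiff_cut_tendsto[OF E cont B, where y = y] unfolding F_def G_def N_def by auto
  note dc = dominated_convergence[of F UNIV "\<lambda>y. if {x. (x, y) \<in> E} = {} then 0 else 2 * M'" G,
      OF has_integral_integrable[OF F] integrable_bound_compact[OF E(1)] bound conv]
  have "(G has_integral integral UNIV G) UNIV" using dc(1) by blast
  then have "(xdiff P E has_integral integral UNIV G) UNIV"
    by (rule has_integral_spike[OF N, rotated]) (simp add: G_def)
  moreover have "I \<longlonglongrightarrow> integral UNIV G"
    using dc(2) integral_unique[OF F] by simp
  ultimately show ?thesis by (rule that)
qed

text \<open>A row that crosses the line at \<open>t / c1\<close> is divided there, and the two
  increments telescope. A row lying on the line would belong to both halves; such heights form a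
  null set.\<close>

lemma xdiff_split:
  assumes E: "compact E" "xconvex E" and c: "c \<noteq> 0"
    and I: "(xdiff P (cut {(c, b)} 0 E) has_integral I) UNIV" 
    and J: "(xdiff P (cut {(-c, -b)} 0 E) has_integral J) UNIV"
  shows "(xdiff P E has_integral I + J) UNIV"
proof -
  define N where "N = {y. \<exists>(c, b)\<in>{(c, b)}. fst c = 0 \<and> c \<noteq> 0 \<and> snd c * y = b}"
  have N: "negligible N" unfolding N_def by (rule negligible_finite_rows) simp
  have "xdiff P E y = xdiff P (cut {(c, b)} 0 E) y + xdiff P (cut {(-c, -b)} 0 E) y" if "y \<notin> N" for y
  proof -
    define c1 t where "c1 = fst c" and "t = b - snd c * y"
    have s1: "{x. (x, y) \<in> cut {(c, b)} 0 E} = {x. (x, y) \<in> E} \<inter> {x. c1 * x \<le> t}"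
      unfolding cut_def c1_def t_def by (auto simp: inner_prod_def algebra_simps)
    have s2: "{x. (x, y) \<in> cut {(-c, -b)} 0 E} = {x. (x, y) \<in> E} \<inter> {x. t \<le> c1 * x}"
      unfolding cut_def c1_def t_def by (auto simp: inner_prod_def algebra_simps)
    have nz: "c1 \<noteq> 0 \<or> t \<noteq> 0" using that c unfolding N_def c1_def t_def by auto
    show ?thesis
    proof (cases rule: slice_cases[OF E, of y])
      case 1
      then show ?thesis using s1 s2 by (simp add: xdiff_empty)
    next
      case (2 l r)
      note E_eq = xdiff_interval[OF 2(2,1), of P]
      have mid: "c1 * x \<le> c1 * l \<or> c1 * x \<le> c1 * r" "c1 * l \<le> c1 * x \<or> c1 * r \<le> c1 * x"
        if "l \<le> x" "x \<le> r" for x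
        using that by (cases "c1 \<ge> 0"; auto simp: mult_left_mono mult_left_mono_neg)+
      \<comment> \<open>In the first two cases the row lies strictly on one side and one half gets
        all of it. In the last two the crossing point belongs to the closed row, and the sign of
        \<open>c1\<close> decides which half gets the left part. A row touched only at an end falls
        under these, with a one-point part of increment 0.\<close>
      consider (p) "c1 * l \<le> t" "c1 * r \<le> t" "\<not> (t \<le> c1 * l \<or> t \<le> c1 * r)"
        | (n) "t \<le> c1 * l" "t \<le> c1 * r" "\<not> (c1 * l \<le> t \<or> c1 * r \<le> t)"
        | (x) "c1 > 0" "l \<le> t / c1" "t / c1 \<le> r" | (y) "c1 < 0" "l \<le> t / c1" "t / c1 \<le> r"
      proof -
        consider "c1 = 0" "t > 0" | "c1 = 0" "t < 0" | "c1 > 0" | "c1 < 0"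
          using nz by linarith
        then show thesis
        proof cases
          case 3
          then have "c1 * l \<le> c1 * r" "t < c1 * l \<longleftrightarrow> t / c1 < l" "c1 * r < t \<longleftrightarrow> r < t / c1"
            using 2(1) by (auto simp: field_simps)
          then show ?thesis using p n x[OF 3] by linarith
        next
          case 4
          then have "c1 * r \<le> c1 * l" "c1 * l < t \<longleftrightarrow> t / c1 < l" "t < c1 * r \<longleftrightarrow> r < t / c1"
            using 2(1) by (auto simp: field_simps)
          then show ?thesis using p n y[OF 4] by linarith
        qed (use p n in auto)
      qed
      then show ?thesis
      proof cases
        case p
        then have le: "c1 * x < t" if "l \<le> x" "x \<le> r" for x
          using mid[OF that] by auto
        have "{x. (x, y) \<in> cut {(c, b)} 0 E} = {l..r}" "{x. (x, y) \<in> cut {(-c, -b)} 0 E} = {}"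
          unfolding s1 s2 2(2) using le by (force)+
        then show ?thesis using E_eq xdiff_interval[OF _ 2(1), of y _ P] by (simp add: xdiff_empty)
      next
        case n
        then have le: "c1 * x > t" if "l \<le> x" "x \<le> r" for x
          using mid[OF that] by auto
        have "{x. (x, y) \<in> cut {(c, b)} 0 E} = {}" "{x. (x, y) \<in> cut {(-c, -b)} 0 E} = {l..r}"
          unfolding s1 s2 2(2) using le by (force)+
        then show ?thesis using E_eq xdiff_interval[OF _ 2(1), of y _ P] by (simp add: xdiff_empty)
      next
        case x
        have xeq: "c1 * x \<le> t \<longleftrightarrow> x \<le> t / c1" "t \<le> c1 * x \<longleftrightarrow> t / c1 \<le> x" for x
          using x(1) by (auto simp: field_simps)
        have "{x. (x, y) \<in> cut {(c, b)} 0 E} = {l..t / c1}" "{x. (x, y) \<in> cut {(-c, -b)} 0 E} = {t / c1..r}"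
          unfolding s1 s2 2(2) using x(2,3) by (auto simp: xeq)
        then show ?thesis using E_eq x xdiff_interval[of y _ _ _ P] by simp
      next
        case y
        have xeq: "c1 * x \<le> t \<longleftrightarrow> t / c1 \<le> x" "t \<le> c1 * x \<longleftrightarrow> x \<le> t / c1" for x
          using y(1) by (auto simp: field_simps)
        have "{x. (x, y) \<in> cut {(c, b)} 0 E} = {t / c1..r}" "{x. (x, y) \<in> cut {(-c, -b)} 0 E} = {l..t / c1}"
          unfolding s1 s2 2(2) using y(2,3) by (auto simp: xeq)
        then show ?thesis using E_eq y xdiff_interval[of y _ _ _ P] by simp
      qed
    qed
  qed
  then show ?thesis
    by (intro has_integral_spike[OF N _ has_integral_add[OF I J]]) auto
qed

section \<open>Fields of class \<open>S\<^sup>1\<close>\<close>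

text \<open>On the cuts \<open>C n\<close> both p and q are continuous, hence integrable separately,
  and the formula follows from Fubini's theorem. As n grows, the boundary terms converge by
  continuity of \<open>P\<close> and \<open>Q\<close>, and the area integrals converge because the
  norm of \<open>p z - q z\<close> dominates: this is where absolute integrability of the difference
  enters.\<close>

lemma green_closed_cell:
  assumes E: "compact E" "xconvex E" "xconvex (prod.swap ` E)"
    and P: "continuous_on E P" and Q: "continuous_on E Q"
    and B: "finite B" "\<And>c b. (c, b) \<in> B \<Longrightarrow> c \<noteq> 0" "\<And>c b z. (c, b) \<in> B \<Longrightarrow> z \<in> E \<Longrightarrow> c \<bullet> z \<le> b"
    and V: "\<And>z. z \<in> E \<Longrightarrow> (\<And>c b. (c, b) \<in> B \<Longrightarrow> c \<bullet> z \<noteq> b) \<Longrightarrow> z \<in> V"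
    and p: "continuous_on V p" and q: "continuous_on V q"
    and ftcP: "\<And>y l r. l \<le> r \<Longrightarrow> (\<And>x. l \<le> x \<Longrightarrow> x \<le> r \<Longrightarrow> (x, y) \<in> V) \<Longrightarrow>
       ((\<lambda>x. p (x, y)) has_integral P (r, y) - P (l, y)) {l..r}"
    and ftcQ: "\<And>x l r. l \<le> r \<Longrightarrow> (\<And>y. l \<le> y \<Longrightarrow> y \<le> r \<Longrightarrow> (x, y) \<in> V) \<Longrightarrow>
       ((\<lambda>y. q (x, y)) has_integral Q (x, r) - Q (x, l)) {l..r}"
    and f: "(\<lambda>z. p z - q z) absolutely_integrable_on E"
  shows "\<exists>I J. (xdiff P E has_integral I) UNIV \<and> (ydiff Q E has_integral J) UNIV \<and>
    ((\<lambda>z. p z - q z) has_integral I - J) E"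
proof -
  define C where "C n = cut B (inverse (real (Suc n))) E" for n
  have CE: "C n \<subseteq> E" for n unfolding C_def cut_def by auto
  have CV: "C n \<subseteq> V" for n
  proof
    fix z assume z: "z \<in> C n"
    have "c \<bullet> z < b" if "(c, b) \<in> B" for c b
    proof -
      have "c \<bullet> z \<le> b - inverse (real (Suc n))" using z that unfolding C_def cut_def by auto
      moreover have "inverse (real (Suc n)) > 0" by simp
      ultimately show ?thesis by linarith
    qed
    then show "z \<in> V" using V[of z] CE z by force
  qed
  have cC: "compact (C n)" for n unfolding C_def by (rule compact_cut[OF E(1)])
  have xC: "xconvex (C n)" for n unfolding C_def by (rule xconvex_cut[OF E(2)])
  have yC: "xconvex (prod.swap ` C n)" for n
    unfolding C_def swap_cut by (rule xconvex_cut[OF E(3)])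
  have pC: "continuous_on (C n) p" "continuous_on (C n) q" for n
    using p q CV continuous_on_subset by blast+
  define I J where "I n = (\<integral>z. indicator (C n) z *\<^sub>R p z \<partial>lborel)"
    and "J n = (\<integral>z. indicator (C n) z *\<^sub>R q z \<partial>lborel)" for n
  have I: "(xdiff P (C n) has_integral I n) UNIV" for n
    unfolding I_def by (rule has_integral_xdiff[OF cC xC pC(1)]) (use ftcP CV in blast)
  have J: "(ydiff Q (C n) has_integral J n) UNIV" for n
    unfolding J_def by (rule has_integral_ydiff[OF cC yC pC(2)]) (use ftcQ CV in blast)
  have fC: "((\<lambda>z. p z - q z) has_integral I n - J n) (C n)" for n
    unfolding I_def J_def
    by (intro has_integral_diff has_integral_indicator_scaleR borel_integrable_compact cC pC)
  obtain I' where I': "(xdiff P E has_integral I') UNIV" "I \<longlonglongrightarrow> I'"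
    by (rule xdiff_cut_integral_tendsto[of E P B I]) (use E(1,2) P B I[unfolded C_def] in blast)+
  define B' where "B' = (\<lambda>(c, b). (prod.swap c, b)) ` B"
  have sw: "prod.swap c \<bullet> z = c \<bullet> prod.swap z" for c z :: "real \<times> real"
    by (cases c, cases z) simp
  obtain J' where J': "(ydiff Q E has_integral J') UNIV" "J \<longlonglongrightarrow> J'"
  proof (rule xdiff_cut_integral_tendsto[of "prod.swap ` E" "Q \<circ> prod.swap" B' J])
    show "compact (prod.swap ` E)" by (rule compact_swap[OF E(1)])
    show "continuous_on (prod.swap ` E) (Q \<circ> prod.swap)"
      by (intro continuous_on_compose continuous_on_swap) (simp add: image_image Q)
    show "finite B'" using B(1) unfolding B'_def by simp
    show "c \<noteq> 0" if "(c, b) \<in> B'" for c b using that B(2) unfolding B'_def by (force simp: prod_eq_iff)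
    show "c \<bullet> z \<le> b" if "(c, b) \<in> B'" "z \<in> prod.swap ` E" for c b z
      using that B(3) unfolding B'_def by (auto simp: sw simp del: swap_simp)
    show "(xdiff (Q \<circ> prod.swap) (cut B' (inverse (real (Suc n))) (prod.swap ` E)) has_integral J n) UNIV" for n
      using J[of n] unfolding ydiff_def C_def swap_cut B'_def .
  qed (use E that in \<open>auto simp: ydiff_def\<close>)
  \<comment> \<open>The cuts never meet these lines, so the integrands tend to 0 on them. The limit
    function is set to 0 there, which changes it on a null set only.\<close>
  define L where "L = (\<Union>(c, b)\<in>B. {z. c \<bullet> z = b})"
  have L: "negligible L"
    unfolding L_def by (intro negligible_Union) (use B(1,2) in \<open>auto intro!: negligible_hyperplane\<close>)
  define F where "F n z = (if z \<in> C n then p z - q z else 0)" for n z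
  define G where "G z = (if z \<in> L then 0 else p z - q z)" for z
  have F: "(F n has_integral I n - J n) E" for n
    using fC[of n] CE[of n] unfolding F_def by (subst has_integral_restrict) auto
  have conv: "(\<lambda>n. F n z) \<longlonglongrightarrow> G z" if "z \<in> E" for z
  proof (cases "z \<in> L")
    case True
    then have "z \<notin> C n" for n
    proof -
      obtain c b where cb: "(c, b) \<in> B" "c \<bullet> z = b" using True unfolding L_def by auto
      have "inverse (real (Suc n)) > 0" by simp
      then show ?thesis using cb unfolding C_def cut_def by (auto intro!: bexI[of _ "(c, b)"])
    qed
    then show ?thesis using True by (simp add: F_def G_def)
  next
    case False
    have "\<forall>\<^sub>F n in sequentially. inverse (real (Suc n)) < snd p - fst p \<bullet> z" if "p \<in> B" for p
    proof -
      have "fst p \<bullet> z \<noteq> snd p" using False that unfolding L_def by (cases p) auto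
      moreover have "fst p \<bullet> z \<le> snd p" using B(3)[of "fst p" "snd p" z] that \<open>z \<in> E\<close> by simp
      ultimately have "0 < snd p - fst p \<bullet> z" by simp
      then show ?thesis using order_tendstoD(2)[OF LIMSEQ_inverse_real_of_nat] by blast
    qed
    then have "\<forall>\<^sub>F n in sequentially. \<forall>p\<in>B. inverse (real (Suc n)) < snd p - fst p \<bullet> z"
      using B(1) by (simp add: eventually_ball_finite)
    then have "\<forall>\<^sub>F n in sequentially. F n z = G z"
    proof eventually_elim
      case (elim n)
      then have "z \<in> C n" using \<open>z \<in> E\<close> unfolding C_def cut_def by fastforce
      then show ?case using False by (simp add: F_def G_def)
    qed
    then show ?thesis by (rule tendsto_eventually)
  qed
  have "(\<lambda>z. norm (p z - q z)) integrable_on E"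
    using f unfolding absolutely_integrable_on_def by simp
  note dc = dominated_convergence[of F E "\<lambda>z. norm (p z - q z)" G,
      OF has_integral_integrable[OF F] this _ conv]
  have nb: "norm (F n z) \<le> norm (p z - q z)" for n z by (simp add: F_def)
  have "integral E G = I' - J'"
    using dc(2)[OF nb] tendsto_diff[OF I'(2) J'(2)] integral_unique[OF F] LIMSEQ_unique by fastforce
  moreover have "G integrable_on E" using dc(1)[OF nb] by simp
  ultimately have "(G has_integral I' - J') E" by (metis integrable_integral)
  then have "((\<lambda>z. p z - q z) has_integral I' - J') E"
    by (rule has_integral_spike[OF L, rotated]) (simp add: G_def)
  with I'(1) J'(1) show ?thesis by blast
qed

lemma cut_Int: "cut {(c, b)} 0 E = E \<inter> {z. c \<bullet> z \<le> b}"
  by (auto simp: cut_def)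

text \<open>Induction on the set \<open>A\<close> of lines still to be cut; \<open>E\<close> lies on one side of each line of \<open>B\<close>.\<close>

lemma green_off_lines:
  assumes "finite A" "\<And>c b. (c, b) \<in> A \<Longrightarrow> c \<noteq> 0"
    and E: "compact E" "xconvex E" "xconvex (prod.swap ` E)"
    and P: "continuous_on E P" and Q: "continuous_on E Q"
    and B: "finite B" "\<And>c b. (c, b) \<in> B \<Longrightarrow> c \<noteq> 0" "\<And>c b z. (c, b) \<in> B \<Longrightarrow> z \<in> E \<Longrightarrow> c \<bullet> z \<le> b"
    and V: "\<And>z. z \<in> E \<Longrightarrow> (\<And>c b. (c, b) \<in> A \<union> B \<Longrightarrow> c \<bullet> z \<noteq> b) \<Longrightarrow> z \<in> V"
    and p: "continuous_on V p" and q: "continuous_on V q"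
    and ftcP: "\<And>y l r. l \<le> r \<Longrightarrow> (\<And>x. l \<le> x \<Longrightarrow> x \<le> r \<Longrightarrow> (x, y) \<in> V) \<Longrightarrow>
       ((\<lambda>x. p (x, y)) has_integral P (r, y) - P (l, y)) {l..r}"
    and ftcQ: "\<And>x l r. l \<le> r \<Longrightarrow> (\<And>y. l \<le> y \<Longrightarrow> y \<le> r \<Longrightarrow> (x, y) \<in> V) \<Longrightarrow>
       ((\<lambda>y. q (x, y)) has_integral Q (x, r) - Q (x, l)) {l..r}"
    and f: "(\<lambda>z. p z - q z) absolutely_integrable_on E"
  shows "\<exists>I J. (xdiff P E has_integral I) UNIV \<and> (ydiff Q E has_integral J) UNIV \<and>
    ((\<lambda>z. p z - q z) has_integral I - J) E"
  using assms(1,2) E P Q B V f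
proof (induction A arbitrary: B E rule: finite_induct)
  case empty
  show ?case
    by (rule green_closed_cell[where B = B and V = V])
       (use empty p q ftcP ftcQ in simp_all)
next
  case (insert a A)
  obtain c b where a: "a = (c, b)" by (cases a)
  have c: "c \<noteq> 0" using insert.prems(1)[of c b] a by simp
  define E1 E2 where "E1 = cut {(c, b)} 0 E" and "E2 = cut {(-c, -b)} 0 E"
  \<comment> \<open>Both halves are treated at once. The line moves from the lines still to be cut
    to the bounding lines, with the sign of its normal chosen so that the half lies in the
    half-plane \<open>c' \<bullet> z \<le> b'\<close>.\<close>
  have piece: "\<exists>I J. (xdiff P E' has_integral I) UNIV \<and> (ydiff Q E' has_integral J) UNIV \<and>
    ((\<lambda>z. p z - q z) has_integral I - J) E'"
    if E': "E' = cut {(c', b')} 0 E" and cb: "(c', b') = (c, b) \<or> (c', b') = (-c, -b)" for E' c' b'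
  proof (rule insert.IH[where B = "insert (c', b') B"])
    have sub: "E' \<subseteq> E" unfolding E' cut_def by auto
    show "compact E'" "xconvex E'" "xconvex (prod.swap ` E')"
      unfolding E' swap_cut using insert.prems by (intro compact_cut xconvex_cut; simp)+
    show "continuous_on E' P" "continuous_on E' Q"
      using insert.prems sub continuous_on_subset by blast+
    show "z \<in> V" if "z \<in> E'" "\<And>c b. (c, b) \<in> A \<union> insert (c', b') B \<Longrightarrow> c \<bullet> z \<noteq> b" for z
    proof (rule insert.prems(10))
      show "z \<in> E" using that sub by auto
      fix u v assume "(u, v) \<in> insert a A \<union> B"
      moreover have "c \<bullet> z \<noteq> b" using that(2)[of c' b'] cb by auto
      ultimately show "u \<bullet> z \<noteq> v" using that(2)[of u v] unfolding a by auto
    qed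
    have "E' \<in> sets lebesgue"
      using \<open>compact E'\<close> by (simp add: lmeasurable_compact fmeasurableD)
    then show "(\<lambda>z. p z - q z) absolutely_integrable_on E'"
      using insert.prems(11) sub set_integrable_subset by blast
    show "u \<bullet> z \<le> v" if "(u, v) \<in> insert (c', b') B" "z \<in> E'" for u v z
      using that insert.prems(9)[of u v z] sub unfolding E' cut_def by auto
    show "u \<noteq> 0" if "(u, v) \<in> insert (c', b') B" for u v
      using that insert.prems(8)[of u v] c cb by auto
  qed (use insert.prems in auto)
  obtain I1 J1 where 1: "(xdiff P E1 has_integral I1) UNIV" "(ydiff Q E1 has_integral J1) UNIV"
    "((\<lambda>z. p z - q z) has_integral I1 - J1) E1"
    using piece[OF E1_def] by auto
  obtain I2 J2 where 2: "(xdiff P E2 has_integral I2) UNIV" "(ydiff Q E2 has_integral J2) UNIV"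
    "((\<lambda>z. p z - q z) has_integral I2 - J2) E2"
    using piece[OF E2_def] by auto
  have I: "(xdiff P E has_integral I1 + I2) UNIV"
    by (rule xdiff_split[OF insert.prems(2,3) c 1(1)[unfolded E1_def] 2(1)[unfolded E2_def]])
  have "(xdiff (Q \<circ> prod.swap) (prod.swap ` E) has_integral J1 + J2) UNIV"
  proof (rule xdiff_split[OF compact_swap[OF insert.prems(2)] insert.prems(4), of "prod.swap c" _ b])
    show "prod.swap c \<noteq> 0" using c by (cases c) (auto simp: prod_eq_iff)
    have "- prod.swap c = prod.swap (- c)" by (cases c) simp
    then show "(xdiff (Q \<circ> prod.swap) (cut {(prod.swap c, b)} 0 (prod.swap ` E)) has_integral J1) UNIV"
      "(xdiff (Q \<circ> prod.swap) (cut {(- prod.swap c, - b)} 0 (prod.swap ` E)) has_integral J2) UNIV"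
      using 1(2) 2(2) unfolding E1_def E2_def ydiff_def swap_cut by simp_all
  qed
  then have J: "(ydiff Q E has_integral J1 + J2) UNIV" unfolding ydiff_def .
  have "E1 \<union> E2 = E" unfolding E1_def E2_def cut_Int by auto
  moreover have "negligible (E1 \<inter> E2)"
    by (rule negligible_subset[OF negligible_hyperplane[of c b]]) (use c in \<open>auto simp: E1_def E2_def cut_Int\<close>)
  ultimately have "((\<lambda>z. p z - q z) has_integral (I1 - J1) + (I2 - J2)) E"
    using has_integral_Un[OF 1(3) 2(3)] by simp
  moreover have "(I1 - J1) + (I2 - J2) = (I1 + I2) - (J1 + J2)" by simp
  ultimately show ?case using I J by metis
qed

section \<open>One-sided and specular derivatives along a line\<close>

lemma right_derivative_tendsto:
  assumes "right_derivative u e p \<alpha>" "right_limit u e p l"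
  shows "((\<lambda>h. (u (p + h *\<^sub>R e) - l) / h) \<longlongrightarrow> \<alpha>) (at_right 0)"
proof -
  obtain k where k: "right_limit u e p k" "((\<lambda>h. (u (p + h *\<^sub>R e) - k) / h) \<longlongrightarrow> \<alpha>) (at_right 0)"
    using assms(1) unfolding right_derivative_def by blast
  have "k = l"
    using tendsto_unique[OF trivial_limit_at_right_real k(1)[unfolded right_limit_def] assms(2)[unfolded right_limit_def]] .
  with k show ?thesis by simp
qed

lemma left_derivative_tendsto:
  assumes "left_derivative u e p \<alpha>" "left_limit u e p l"
  shows "((\<lambda>h. (u (p + h *\<^sub>R e) - l) / h) \<longlongrightarrow> \<alpha>) (at_left 0)"
proof -
  obtain k where k: "left_limit u e p k" "((\<lambda>h. (u (p + h *\<^sub>R e) - k) / h) \<longlongrightarrow> \<alpha>) (at_left 0)"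
    using assms(1) unfolding left_derivative_def by blast
  have "k = l"
    using tendsto_unique[OF trivial_limit_at_left_real k(1)[unfolded left_limit_def] assms(2)[unfolded left_limit_def]] .
  with k show ?thesis by simp
qed

lemma right_derivative_unique:
  assumes "right_derivative u e p \<alpha>" "right_derivative u e p \<beta>"
  shows "\<alpha> = \<beta>"
proof -
  obtain l where l: "right_limit u e p l" using assms(1) unfolding right_derivative_def by blast
  show ?thesis
    by (rule tendsto_unique[OF trivial_limit_at_right_real right_derivative_tendsto[OF assms(1) l]
          right_derivative_tendsto[OF assms(2) l]])
qed

lemma left_derivative_unique:
  assumes "left_derivative u e p \<alpha>" "left_derivative u e p \<beta>"
  shows "\<alpha> = \<beta>"
proof -
  obtain l where l: "left_limit u e p l" using assms(1) unfolding left_derivative_def by blast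
  show ?thesis
    by (rule tendsto_unique[OF trivial_limit_at_left_real left_derivative_tendsto[OF assms(1) l]
          left_derivative_tendsto[OF assms(2) l]])
qed

lemma specular_partial_eq:
  assumes "has_specular_partial u e p s"
  shows "specular_partial u e p = s"
  unfolding specular_partial_def
proof (rule the_equality)
  show "has_specular_partial u e p s" by (rule assms)
  fix t assume "has_specular_partial u e p t"
  with assms obtain \<alpha> \<beta> \<alpha>' \<beta>' where
    1: "right_derivative u e p \<alpha>" "left_derivative u e p \<beta>" "s = spec_mean \<alpha> \<beta>" and
    2: "right_derivative u e p \<alpha>'" "left_derivative u e p \<beta>'" "t = spec_mean \<alpha>' \<beta>'"
    unfolding has_specular_partial_def by auto
  have "\<alpha>' = \<alpha>" "\<beta>' = \<beta>"
    using 1 2 right_derivative_unique left_derivative_unique by blast+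
  then show "t = s" using 1 2 by simp
qed

text \<open>Continuity of \<open>u\<close> identifies the one-sided limits in the difference
  quotients with the value of \<open>u\<close>, and \<open>spec_mean_between\<close> supplies the
  sign condition of the one-sided fundamental theorem on the segment.\<close>

lemma has_integral_specular_partial:
  fixes u :: "real \<times> real \<Rightarrow> real"
  assumes U: "open U" and u: "continuous_on U u" and ex: "\<And>p. p \<in> U \<Longrightarrow> \<exists>s. has_specular_partial u e p s"
    and V: "V \<subseteq> U" and sp: "continuous_on V (specular_partial u e)"
    and lr: "l \<le> r" and seg: "\<And>h. l \<le> h \<Longrightarrow> h \<le> r \<Longrightarrow> p + h *\<^sub>R e \<in> V"
  shows "((\<lambda>h. specular_partial u e (p + h *\<^sub>R e)) has_integral u (p + r *\<^sub>R e) - u (p + l *\<^sub>R e)) {l..r}"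
proof (rule has_integral_one_sided_derivatives[OF lr, of "\<lambda>h. u (p + h *\<^sub>R e)"])
  show "continuous_on {l..r} (\<lambda>h. u (p + h *\<^sub>R e))"
    by (rule continuous_on_compose2[OF u]) (use seg V in \<open>auto intro!: continuous_intros\<close>)
  show "continuous_on {l..r} (\<lambda>h. specular_partial u e (p + h *\<^sub>R e))"
    by (rule continuous_on_compose2[OF sp]) (use seg in \<open>auto intro!: continuous_intros\<close>)
  fix x assume x: "l < x" "x < r"
  define w where "w = p + x *\<^sub>R e"
  have wU: "w \<in> U" using seg[of x] x V unfolding w_def by auto
  obtain \<alpha> \<beta> where d: "right_derivative u e w \<alpha>" "left_derivative u e w \<beta>"
    and s: "specular_partial u e w = spec_mean \<alpha> \<beta>"
    using ex[OF wU] specular_partial_eq unfolding has_specular_partial_def by metis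
  have "isCont u w" using u U wU by (simp add: continuous_on_eq_continuous_at)
  moreover have "((\<lambda>h. w + h *\<^sub>R e) \<longlongrightarrow> w) (at 0)" by (auto intro!: tendsto_eq_intros)
  ultimately have "((\<lambda>h. u (w + h *\<^sub>R e)) \<longlongrightarrow> u w) (at 0)"
    by (rule isCont_tendsto_compose)
  then have lim: "((\<lambda>h. u (w + h *\<^sub>R e)) \<longlongrightarrow> u w) (at_right 0)" "((\<lambda>h. u (w + h *\<^sub>R e)) \<longlongrightarrow> u w) (at_left 0)"
    by (auto simp: filterlim_at_split)
  have sh: "u (p + (x + h) *\<^sub>R e) = u (w + h *\<^sub>R e)" for h
    unfolding w_def by (simp add: algebra_simps)
  have "((\<lambda>h. (u (w + h *\<^sub>R e) - u w) / h) \<longlongrightarrow> \<alpha>) (at_right 0)"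
    by (rule right_derivative_tendsto[OF d(1)]) (simp add: right_limit_def lim)
  moreover have "((\<lambda>h. (u (w + h *\<^sub>R e) - u w) / h) \<longlongrightarrow> \<beta>) (at_left 0)"
    by (rule left_derivative_tendsto[OF d(2)]) (simp add: left_limit_def lim)
  ultimately show "\<exists>\<alpha> \<beta>. ((\<lambda>h. (u (p + (x + h) *\<^sub>R e) - u (p + x *\<^sub>R e)) / h) \<longlongrightarrow> \<alpha>) (at_right 0) \<and>
      ((\<lambda>h. (u (p + (x + h) *\<^sub>R e) - u (p + x *\<^sub>R e)) / h) \<longlongrightarrow> \<beta>) (at_left 0) \<and>
      (\<alpha> - specular_partial u e (p + x *\<^sub>R e)) * (\<beta> - specular_partial u e (p + x *\<^sub>R e)) \<le> 0"
    unfolding sh w_def[symmetric] s using spec_mean_between by blast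
qed

text \<open>The graph of a singular line may be only a part of a line. Each graph is enlarged to a
  full line, because cutting by half-planes needs full lines.\<close>

lemma class_S0_continuous_off_lines:
  assumes "class_S0 U u"
  obtains A where "finite A" "\<And>c b. (c, b) \<in> A \<Longrightarrow> c \<noteq> 0"
    "continuous_on {z\<in>U. \<forall>(c, b)\<in>A. c \<bullet> z \<noteq> b} u"
proof -
  obtain H where H: "finite H" "\<And>G. G \<in> H \<Longrightarrow> singular_line U u G" "continuous_on (U - \<Union>H) u"
    using assms unfolding class_S0_def piecewise_continuous_def by auto
  have "\<exists>cb. fst cb \<noteq> 0 \<and> G \<subseteq> {z. fst cb \<bullet> z = snd cb}" if "G \<in> H" for G
    using H(2)[OF that] unfolding singular_line_def by force
  then obtain k where k: "\<And>G. G \<in> H \<Longrightarrow> fst (k G) \<noteq> 0 \<and> G \<subseteq> {z. fst (k G) \<bullet> z = snd (k G)}"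
    by metis
  show ?thesis
  proof (rule that[of "k ` H"])
    show "continuous_on {z\<in>U. \<forall>(c, b)\<in>k ` H. c \<bullet> z \<noteq> b} u"
      by (rule continuous_on_subset[OF H(3)]) (use k in \<open>fastforce simp: split_beta\<close>)
  qed (use H(1) k in \<open>auto simp: image_iff, metis fst_conv\<close>)
qed

text \<open>The lines of both derivatives are cut together, so that both derivatives are continuous
  on the same pieces. At the start no line bounds the region, whence the empty set of bounding
  lines.\<close>

lemma green_class_S1:
  assumes E: "compact E" "xconvex E" "xconvex (prod.swap ` E)" and U: "open U" "E \<subseteq> U"
    and P: "class_S1 U P" and Q: "class_S1 U Q"
    and f: "(\<lambda>z. specular_partial P (1, 0) z - specular_partial Q (0, 1) z) absolutely_integrable_on E"
  shows "\<exists>I J. (xdiff P E has_integral I) UNIV \<and> (ydiff Q E has_integral J) UNIV \<and>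
    ((\<lambda>z. specular_partial P (1, 0) z - specular_partial Q (0, 1) z) has_integral I - J) E"
proof -
  have bas: "(1, 0) \<in> (Basis :: (real \<times> real) set)" "(0, 1) \<in> (Basis :: (real \<times> real) set)"
    by (auto simp: Basis_prod_def)
  have cP: "continuous_on U P" and cQ: "continuous_on U Q"
    using P Q unfolding class_S1_def by auto
  have exP: "\<exists>s. has_specular_partial P (1, 0) p s" and exQ: "\<exists>s. has_specular_partial Q (0, 1) p s"
    if "p \<in> U" for p
    using P Q that bas unfolding class_S1_def by auto
  have "class_S0 U (specular_partial P (1, 0))" using P bas unfolding class_S1_def by auto
  then obtain A1 where A1: "finite A1" "\<And>c b. (c, b) \<in> A1 \<Longrightarrow> c \<noteq> 0"
    "continuous_on {z\<in>U. \<forall>(c, b)\<in>A1. c \<bullet> z \<noteq> b} (specular_partial P (1, 0))"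
    by (rule class_S0_continuous_off_lines) blast
  have "class_S0 U (specular_partial Q (0, 1))" using Q bas unfolding class_S1_def by auto
  then obtain A2 where A2: "finite A2" "\<And>c b. (c, b) \<in> A2 \<Longrightarrow> c \<noteq> 0"
    "continuous_on {z\<in>U. \<forall>(c, b)\<in>A2. c \<bullet> z \<noteq> b} (specular_partial Q (0, 1))"
    by (rule class_S0_continuous_off_lines) blast
  define V where "V = {z\<in>U. \<forall>(c, b)\<in>A1 \<union> A2. c \<bullet> z \<noteq> b}"
  have p: "continuous_on V (specular_partial P (1, 0))"
    by (rule continuous_on_subset[OF A1(3)]) (auto simp: V_def)
  have q: "continuous_on V (specular_partial Q (0, 1))"
    by (rule continuous_on_subset[OF A2(3)]) (auto simp: V_def)
  have VU: "V \<subseteq> U" unfolding V_def by auto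
  show ?thesis
  proof (rule green_off_lines[of "A1 \<union> A2" E P Q "{}" V])
    show "continuous_on E P" "continuous_on E Q" using cP cQ U(2) continuous_on_subset by blast+
    show "z \<in> V" if "z \<in> E" "\<And>c b. (c, b) \<in> A1 \<union> A2 \<union> {} \<Longrightarrow> c \<bullet> z \<noteq> b" for z
      using that U(2) unfolding V_def by auto
    show "((\<lambda>x. specular_partial P (1, 0) (x, y)) has_integral P (r, y) - P (l, y)) {l..r}"
      if "l \<le> r" "\<And>x. l \<le> x \<Longrightarrow> x \<le> r \<Longrightarrow> (x, y) \<in> V" for y l r
      using has_integral_specular_partial[OF U(1) cP exP VU p that(1), of "(0, y)"] that(2) by simp
    show "((\<lambda>y. specular_partial Q (0, 1) (x, y)) has_integral Q (x, r) - Q (x, l)) {l..r}"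
      if "l \<le> r" "\<And>y. l \<le> y \<Longrightarrow> y \<le> r \<Longrightarrow> (x, y) \<in> V" for x l r
      using has_integral_specular_partial[OF U(1) cQ exQ VU q that(1), of "(x, 0)"] that(2) by simp
  qed (use A1 A2 E p q f in auto)
qed

section \<open>The Cauchy transform of a function of the real part\<close>

text \<open>The primitive \<open>2 * sgn (s - x) * sqrt \<bar>s - x\<bar>\<close> is continuous
  through the singularity, and the strong fundamental theorem tolerates the exceptional point
  x.\<close>

lemma has_integral_inverse_sqrt_abs:
  assumes "a \<le> b"
  shows "((\<lambda>s. 1 / sqrt \<bar>x - s\<bar>) has_integral
    2 * sgn (b - x) * sqrt \<bar>b - x\<bar> - 2 * sgn (a - x) * sqrt \<bar>a - x\<bar>) {a..b}"
proof (rule fundamental_theorem_of_calculus_strong[of "{x}" a b "\<lambda>s. 2 * sgn (s - x) * sqrt \<bar>s - x\<bar>"])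
  fix s assume s: "s \<in> {a..b} - {x}"
  have pos: "((\<lambda>s. 2 * sqrt (s - x)) has_real_derivative 1 / sqrt \<bar>x - s\<bar>) (at s)" if "s > x"
    using that by (auto intro!: derivative_eq_intros simp: field_simps)
  have neg: "((\<lambda>s. - 2 * sqrt (x - s)) has_real_derivative 1 / sqrt \<bar>x - s\<bar>) (at s)" if "s < x"
    using that by (auto intro!: derivative_eq_intros simp: field_simps)
  have "((\<lambda>s. 2 * sgn (s - x) * sqrt \<bar>s - x\<bar>) has_real_derivative 1 / sqrt \<bar>x - s\<bar>) (at s)"
  proof (cases "s > x")
    case True
    show ?thesis
      by (rule has_field_derivative_transform_within_open[OF pos[OF True], of "{x<..}"]) (use True in auto)
  next
    case False
    then have "s < x" using s by auto
    show ?thesis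
      by (rule has_field_derivative_transform_within_open[OF neg[OF \<open>s < x\<close>], of "{..<x}"])
         (use \<open>s < x\<close> in auto)
  qed
  then show "((\<lambda>s. 2 * sgn (s - x) * sqrt \<bar>s - x\<bar>) has_vector_derivative 1 / sqrt \<bar>x - s\<bar>) (at s)"
    by (simp add: has_real_derivative_iff_has_vector_derivative)
next
  \<comment> \<open>This form shows the continuity at x, which the discontinuous factor
    \<open>sgn\<close> hides.\<close>
  have "(\<lambda>s. 2 * sgn (s - x) * sqrt \<bar>s - x\<bar>) = (\<lambda>s. 2 * (sqrt (max 0 (s - x)) - sqrt (max 0 (x - s))))"
    by (auto simp: sgn_if max_def)
  then show "continuous_on {a..b} (\<lambda>s. 2 * sgn (s - x) * sqrt \<bar>s - x\<bar>)"
    by (simp only:) (intro continuous_intros)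
qed (use assms in auto)

lemma nn_integral_inverse_sqrt_abs_le:
  assumes "a \<le> x" "x \<le> b"
  shows "(\<integral>\<^sup>+s. ennreal (indicator {a..b} s * (1 / sqrt \<bar>x - s\<bar>)) \<partial>lborel) \<le> ennreal (4 * sqrt (b - a))"
proof -
  define I where "I = 2 * sgn (b - x) * sqrt \<bar>b - x\<bar> - 2 * sgn (a - x) * sqrt \<bar>a - x\<bar>"
  have "((\<lambda>s. 1 / sqrt \<bar>x - s\<bar>) has_integral I) {a..b}"
    unfolding I_def by (rule has_integral_inverse_sqrt_abs) (use assms in simp)
  then have "((\<lambda>s. if s \<in> {a..b} then 1 / sqrt \<bar>x - s\<bar> else 0) has_integral I) UNIV"
    by (simp only: has_integral_restrict_UNIV)
  moreover have "(\<lambda>s. if s \<in> {a..b} then 1 / sqrt \<bar>x - s\<bar> else 0) = (\<lambda>s. indicator {a..b} s * (1 / sqrt \<bar>x - s\<bar>))"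
    by (auto simp: indicator_def)
  ultimately have "((\<lambda>s. indicator {a..b} s * (1 / sqrt \<bar>x - s\<bar>)) has_integral I) UNIV" by simp
  then have "(\<integral>\<^sup>+s. ennreal (indicator {a..b} s * (1 / sqrt \<bar>x - s\<bar>)) \<partial>lborel) = ennreal I"
    by (intro nn_integral_has_integral_lborel) auto
  moreover have "I \<le> 4 * sqrt (b - a)"
  proof -
    have "sqrt (b - x) \<le> sqrt (b - a)" "sqrt (x - a) \<le> sqrt (b - a)" using assms by auto
    moreover have "I \<le> 2 * sqrt (b - x) + 2 * sqrt (x - a)"
      unfolding I_def using assms by (auto simp: sgn_if)
    ultimately show ?thesis by linarith
  qed
  ultimately show ?thesis by (simp add: ennreal_leI)
qed

lemma continuous_plane_to_complex [continuous_intros]: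
  "continuous_on S f \<Longrightarrow> continuous_on S (\<lambda>x. plane_to_complex (f x))"
  unfolding plane_to_complex_def by (auto simp: Complex_eq intro!: continuous_intros)

lemma measurable_plane_to_complex [measurable]: "plane_to_complex \<in> borel_measurable borel"
  by (intro borel_measurable_continuous_onI continuous_intros)

text \<open>The bound depends on the rectangle and not on z, so it can be integrated once more along
  a curve. A product majorant reduces it to two integrals over intervals and avoids polar
  coordinates.\<close>

lemma nn_integral_inverse_cmod_le:
  assumes "a \<le> Re z" "Re z \<le> b" "c \<le> Im z" "Im z \<le> d"
  shows "(\<integral>\<^sup>+w. ennreal (indicator ({a..b} \<times> {c..d}) w * (1 / cmod (z - plane_to_complex w))) \<partial>lborel)
    \<le> ennreal (4 * sqrt (b - a)) * ennreal (4 * sqrt (d - c))"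
proof -
  define p where "p s = indicator {a..b} s * (1 / sqrt \<bar>Re z - s\<bar>)" for s
  define q where "q s = indicator {c..d} s * (1 / sqrt \<bar>Im z - s\<bar>)" for s
  have [measurable]: "p \<in> borel_measurable borel" "q \<in> borel_measurable borel"
    unfolding p_def q_def by measurable
  have pq0: "0 \<le> p s" "0 \<le> q s" for s unfolding p_def q_def by auto
  \<comment> \<open>On the two axis-parallel lines through z the majorant takes the value 0, by the
    convention 1 / 0 = 0, and the estimate may fail; both lines are null sets.\<close>
  have AE1: "AE w in (lborel :: (real \<times> real) measure). fst w \<noteq> Re z"
      "AE w in (lborel :: (real \<times> real) measure). snd w \<noteq> Im z"
  proof -
    have "negligible {w::real \<times> real. (1, 0) \<bullet> w = Re z}" "negligible {w::real \<times> real. (0, 1) \<bullet> w = Im z}"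
      by (rule negligible_hyperplane; simp add: prod_eq_iff)+
    then have "negligible {w::real \<times> real. fst w = Re z}" "negligible {w::real \<times> real. snd w = Im z}"
      by (simp_all add: inner_prod_def)
    moreover have "closed {w::real \<times> real. fst w = Re z}" "closed {w::real \<times> real. snd w = Im z}"
      by (intro closed_Collect_eq continuous_intros)+
    ultimately have "{w::real \<times> real. fst w = Re z} \<in> null_sets lborel"
        "{w::real \<times> real. snd w = Im z} \<in> null_sets lborel"
      by (auto simp: negligible_iff_null_sets null_sets_completion_iff)
    from this[THEN AE_not_in] show "AE w in (lborel :: (real \<times> real) measure). fst w \<noteq> Re z"
      "AE w in (lborel :: (real \<times> real) measure). snd w \<noteq> Im z"
      by simp_all
  qed
  have "(\<integral>\<^sup>+w. ennreal (indicator ({a..b} \<times> {c..d}) w * (1 / cmod (z - plane_to_complex w))) \<partial>lborel)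
    \<le> (\<integral>\<^sup>+w. ennreal (p (fst w) * q (snd w)) \<partial>lborel)"
  proof (rule nn_integral_mono_AE)
    show "AE w in lborel. ennreal (indicator ({a..b} \<times> {c..d}) w * (1 / cmod (z - plane_to_complex w)))
         \<le> ennreal (p (fst w) * q (snd w))"
      using AE1
    proof eventually_elim
      case (elim w)
      define u v where "u = \<bar>Re z - fst w\<bar>" and "v = \<bar>Im z - snd w\<bar>"
      have uv: "u > 0" "v > 0" using elim unfolding u_def v_def by auto
      have n: "cmod (z - plane_to_complex w) = sqrt (u\<^sup>2 + v\<^sup>2)"
        unfolding plane_to_complex_def u_def v_def by (simp add: cmod_def)
      \<comment> \<open>Bounding \<open>1 / sqrt (u\<^sup>2 + v\<^sup>2)\<close> by \<open>1 / (sqrt u * sqrt v)\<close> separates the variables.\<close>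
      have "0 \<le> (u - v)\<^sup>2" by simp
      then have "2 * (u * v) \<le> u\<^sup>2 + v\<^sup>2" by (simp add: power2_diff)
      then have "u * v \<le> u\<^sup>2 + v\<^sup>2" using mult_pos_pos[OF uv] by linarith
      then have "sqrt (u * v) \<le> sqrt (u\<^sup>2 + v\<^sup>2)" by simp
      then have "1 / sqrt (u\<^sup>2 + v\<^sup>2) \<le> 1 / (sqrt u * sqrt v)"
        using uv by (intro divide_left_mono) (auto simp: real_sqrt_mult intro!: mult_pos_pos add_pos_pos)
      then show ?case
        unfolding p_def q_def n u_def[symmetric] v_def[symmetric]
        by (cases w) (auto simp: indicator_def intro!: ennreal_leI)
    qed
  qed
  also have "\<dots> = (\<integral>\<^sup>+s. \<integral>\<^sup>+t. ennreal (p s * q t) \<partial>lborel \<partial>lborel)"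
    unfolding lborel_prod[symmetric] by (subst lborel.nn_integral_fst[symmetric]) auto
  also have "\<dots> = (\<integral>\<^sup>+s. ennreal (p s) \<partial>lborel) * (\<integral>\<^sup>+t. ennreal (q t) \<partial>lborel)"
    by (simp add: ennreal_mult pq0 nn_integral_cmult nn_integral_multc)
  also have "\<dots> \<le> ennreal (4 * sqrt (b - a)) * ennreal (4 * sqrt (d - c))"
    unfolding p_def q_def using assms by (intro mult_mono nn_integral_inverse_sqrt_abs_le) auto
  finally show ?thesis .
qed

text \<open>The branches of the logarithm are chosen to make this holomorphic on the whole strip
  \<open>c < Im z < d\<close>; it is a branch of the integral of \<open>1 / (z - \<i> y)\<close> over \<open>y \<in> {c..d}\<close> only up to the
  jump at the imaginary axis.\<close>

definition strip_log :: "real \<Rightarrow> real \<Rightarrow> complex \<Rightarrow> complex" where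
  "strip_log c d z = \<i> * (Ln (\<i> * (z - \<i> * d)) - Ln (- \<i> * (z - \<i> * c)))"

text \<open>\<open>\<i> * Ln (\<sigma> * (z - \<i> * y))\<close> is a primitive in y, where the sign
  \<sigma> of \<open>Re z\<close> moves the argument into the right half-plane, away from the branch
  cut. Comparing branches with \<open>strip_log\<close> costs a quarter turn at each end, in total
  \<open>pi * \<sigma>\<close>. The resulting jump by 2 pi across the imaginary axis is what
  produces the term \<open>2 * pi * \<Phi>\<close> below.\<close>

lemma has_integral_inverse_vertical:
  assumes cd: "c < Im z" "Im z < d" and nz: "Re z \<noteq> 0"
  shows "((\<lambda>y. 1 / (z - \<i> * of_real y)) has_integral strip_log c d z + of_real (pi * sgn (Re z))) {c..d}"
proof -
  define \<sigma> where "\<sigma> = sgn (Re z)"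
  have \<sigma>: "\<sigma> = 1 \<and> Re z > 0 \<or> \<sigma> = -1 \<and> Re z < 0" using nz unfolding \<sigma>_def by (auto simp: sgn_if)
  define A where "A y = \<i> * Ln (\<sigma> * (z - \<i> * of_real y))" for y :: real
  have "((\<lambda>y. 1 / (z - \<i> * of_real y)) has_integral A d - A c) {c..d}"
  proof (rule fundamental_theorem_of_calculus)
    fix y assume "y \<in> {c..d}"
    have "Re (\<sigma> * (z - \<i> * of_real y)) > 0" using \<sigma> by auto
    then have np: "\<sigma> * (z - \<i> * of_real y) \<notin> \<real>\<^sub>\<le>\<^sub>0" using complex_nonpos_Reals_iff by auto
    then have nz: "z - \<i> * of_real y \<noteq> 0" "\<sigma> \<noteq> 0" by auto
    have "((\<lambda>w. \<i> * Ln (\<sigma> * (z - \<i> * w))) has_field_derivative 1 / (z - \<i> * of_real y)) (at (of_real y))"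
      using np nz by (auto intro!: derivative_eq_intros simp: field_simps)
    then show "(A has_vector_derivative 1 / (z - \<i> * of_real y)) (at y within {c..d})"
      unfolding A_def by (intro has_vector_derivative_real_field) 
  qed (use cd in simp)
  moreover have "A d - A c = strip_log c d z + of_real (pi * \<sigma>)"
  proof -
    define u v where "u = z - \<i> * d" and "v = z - \<i> * c"
    have uv: "Re u = Re z" "Im u < 0" "Re v = Re z" "Im v > 0" using cd unfolding u_def v_def by auto
    have H: "strip_log c d z = \<i> * (Ln (\<i> * u) - Ln (- \<i> * v))"
      unfolding strip_log_def u_def v_def ..
    have A: "A d = \<i> * Ln (\<sigma> * u)" "A c = \<i> * Ln (\<sigma> * v)" unfolding A_def u_def v_def by auto
    have nz: "u \<noteq> 0" "v \<noteq> 0" using uv by auto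
    from \<sigma> show ?thesis
    proof
      assume s: "\<sigma> = 1 \<and> Re z > 0"
      have 1: "Ln (\<i> * u) = Ln u + \<i> * pi / 2" using Ln_times_ii[OF nz(1)] s uv by simp
      have 2: "Ln (\<i> * (- \<i> * v)) = Ln (- \<i> * v) + \<i> * pi / 2"
        using Ln_times_ii[of "- \<i> * v"] nz(2) uv by simp
      then have 2: "Ln (- \<i> * v) = Ln v - \<i> * pi / 2" by simp
      show ?thesis unfolding H A 1 2 using s by (simp add: field_simps)
    next
      assume s: "\<sigma> = -1 \<and> Re z < 0"
      have 1: "Ln (\<i> * (\<i> * u)) = Ln (\<i> * u) + \<i> * pi / 2"
        using Ln_times_ii[of "\<i> * u"] nz(1) uv by simp
      then have 1: "Ln (\<i> * u) = Ln (- u) - \<i> * pi / 2" by (simp add: mult.assoc[symmetric])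
      have 2: "Ln (\<i> * - v) = Ln (- v) + \<i> * pi / 2" using Ln_times_ii[of "- v"] nz(2) s uv by simp
      then have 2: "Ln (- \<i> * v) = Ln (- v) + \<i> * pi / 2" by simp
      show ?thesis unfolding H A 1 2 using s by (simp add: field_simps)
    qed
  qed
  ultimately show ?thesis unfolding \<sigma>_def by simp
qed

lemma strip_log_args:
  assumes "c < Im z" "Im z < d"
  shows "\<i> * (z - \<i> * d) \<notin> \<real>\<^sub>\<le>\<^sub>0" "- \<i> * (z - \<i> * c) \<notin> \<real>\<^sub>\<le>\<^sub>0"
  using assms by (auto simp: complex_nonpos_Reals_iff)

lemma has_field_derivative_strip_log:
  assumes "c < Im z" "Im z < d"
  shows "(strip_log c d has_field_derivative \<i> * (1 / (z - \<i> * d) - 1 / (z - \<i> * c))) (at z)"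
proof -
  have eq: "inverse (\<i> * u) * \<i> = 1 / u" "inverse (- \<i> * u) * (- \<i>) = 1 / u" for u
    by (cases "u = 0"; simp add: field_simps)+
  have "((\<lambda>z. \<i> * (Ln (\<i> * (z - \<i> * d)) - Ln (- \<i> * (z - \<i> * c)))) has_field_derivative
      \<i> * (inverse (\<i> * (z - \<i> * d)) * \<i> - inverse (- \<i> * (z - \<i> * c)) * (- \<i>))) (at z)"
    using strip_log_args[OF assms] by (auto intro!: derivative_eq_intros)
  then show ?thesis unfolding eq strip_log_def[abs_def] .
qed

lemma convex_strip: "convex {z. c < Im z \<and> Im z < d}"
proof -
  have "{z. c < Im z \<and> Im z < d} = {z. c < Im z} \<inter> {z. Im z < d}" by auto
  then show ?thesis by (simp add: convex_Int convex_halfspace_Im_gt convex_halfspace_Im_lt)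
qed

text \<open>Integrating over the vertical variable first leaves \<open>\<phi> s\<close> times the
  sum of \<open>strip_log c d (z - s)\<close> and \<open>pi * sgn (Re z - s)\<close>. The first part
  integrates to a holomorphic function of z; the second gives pi times
  \<open>2 * \<Phi> (Re z) - \<Phi> a - \<Phi> b\<close>, whose constants are absorbed into
  \<open>h\<close>.\<close>

lemma cauchy_transform_rectangle:
  fixes \<phi> \<Phi> :: "real \<Rightarrow> real"
  assumes \<Phi>: "\<And>x. (\<Phi> has_real_derivative \<phi> x) (at x)" and \<phi>: "continuous_on UNIV \<phi>"
  obtains h where "h holomorphic_on {z. c < Im z \<and> Im z < d}"
    and "\<And>z. a < Re z \<Longrightarrow> Re z < b \<Longrightarrow> c < Im z \<Longrightarrow> Im z < d \<Longrightarrow>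
      (\<integral>w. indicator ({a..b} \<times> {c..d}) w *\<^sub>R (of_real (\<phi> (fst w)) / (z - plane_to_complex w)) \<partial>lborel)
        = of_real (2 * pi * \<Phi> (Re z)) + h z"
proof -
  define M where "M z = integral (cbox a b) (\<lambda>s. of_real (\<phi> s) * strip_log c d (z - of_real s))" for z
  have cont: "continuous_on ({z. c < Im z \<and> Im z < d} \<times> cbox a b)
      (\<lambda>(z, s). of_real (\<phi> s) * (\<i> * (1 / (z - of_real s - \<i> * d) - 1 / (z - of_real s - \<i> * c))))"
  proof -
    have "z - of_real s - \<i> * d \<noteq> 0" "z - of_real s - \<i> * c \<noteq> 0" if "c < Im z" "Im z < d" for z and s :: real
      using that by (auto simp: complex_eq_iff)
    moreover have "continuous_on UNIV (\<lambda>x::complex \<times> real. \<phi> (snd x))"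
      by (rule continuous_on_compose2[OF \<phi>]) (auto intro!: continuous_intros)
    ultimately show ?thesis unfolding split_beta
      by (intro continuous_intros) (auto intro: continuous_on_subset)
  qed
  have contH: "continuous_on (cbox a b) (\<lambda>s. of_real (\<phi> s) * strip_log c d (z - of_real s))"
    if "c < Im z" "Im z < d" for z
    using strip_log_args[of c "z - of_real _" d] that unfolding strip_log_def
    by (intro continuous_intros continuous_on_subset[OF \<phi>]) (auto simp: diff_diff_eq)
  have M: "M holomorphic_on {z. c < Im z \<and> Im z < d}"
    unfolding M_def
  proof (rule leibniz_rule_holomorphic[OF _ _ cont convex_strip])
    show "((\<lambda>z. of_real (\<phi> s) * strip_log c d (z - of_real s)) has_field_derivative
        of_real (\<phi> s) * (\<i> * (1 / (z - of_real s - \<i> * d) - 1 / (z - of_real s - \<i> * c))))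
        (at z within {z. c < Im z \<and> Im z < d})"
      if "z \<in> {z. c < Im z \<and> Im z < d}" for z and s :: real
    proof -
      have "((\<lambda>z. strip_log c d (z - of_real s)) has_field_derivative
        (\<i> * (1 / (z - of_real s - \<i> * d) - 1 / (z - of_real s - \<i> * c))) * (1 - 0)) (at z)"
        by (rule DERIV_chain2[OF has_field_derivative_strip_log]) (use that in \<open>auto intro!: derivative_eq_intros\<close>)
      from has_field_derivative_at_within[OF DERIV_cmult[OF this, of "of_real (\<phi> s)"]]
      show ?thesis by (simp only: diff_zero mult_1_right)
    qed
    show "(\<lambda>s. of_real (\<phi> s) * strip_log c d (z - of_real s)) integrable_on cbox a b"
      if "z \<in> {z. c < Im z \<and> Im z < d}" for z
      using that by (intro integrable_continuous contH) auto
  qed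
  show ?thesis
  proof (rule that[of "\<lambda>z. M z - of_real (pi * (\<Phi> a + \<Phi> b))"])
    show "(\<lambda>z. M z - of_real (pi * (\<Phi> a + \<Phi> b))) holomorphic_on {z. c < Im z \<and> Im z < d}"
      by (intro holomorphic_intros M)
    fix z assume z: "a < Re z" "Re z < b" "c < Im z" "Im z < d"
    define F where "F w = indicator ({a..b} \<times> {c..d}) w *\<^sub>R (of_real (\<phi> (fst w)) / (z - plane_to_complex w))" for w
    obtain B where B: "\<And>s. s \<in> {a..b} \<Longrightarrow> \<bar>\<phi> s\<bar> \<le> B" "B \<ge> 0"
    proof -
      have "bounded (\<phi> ` {a..b})"
        by (intro compact_imp_bounded compact_continuous_image continuous_on_subset[OF \<phi>]) auto
      then obtain B where "\<forall>s\<in>{a..b}. \<bar>\<phi> s\<bar> \<le> B" unfolding bounded_iff by auto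
      then show ?thesis using that[of "max B 0"] by force
    qed
    have [measurable]: "\<phi> \<in> borel_measurable borel" by (rule borel_measurable_continuous_onI[OF \<phi>])
    have [measurable]: "{a..b} \<times> {c..d} \<in> sets (borel :: (real \<times> real) measure)"
      by (intro borel_closed closed_Times) auto
    have Fint: "integrable lborel F"
    proof (rule integrableI_bounded)
      have "(\<integral>\<^sup>+w. ennreal (norm (F w)) \<partial>lborel) \<le>
         (\<integral>\<^sup>+w. ennreal B * ennreal (indicator ({a..b} \<times> {c..d}) w * (1 / cmod (z - plane_to_complex w))) \<partial>lborel)"
      proof (rule nn_integral_mono)
        fix w :: "real \<times> real"
        show "ennreal (norm (F w)) \<le> ennreal B * ennreal (indicator ({a..b} \<times> {c..d}) w * (1 / cmod (z - plane_to_complex w)))"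
          using B by (cases w) (auto simp: F_def indicator_def norm_divide ennreal_mult[symmetric] divide_right_mono intro!: ennreal_leI)
      qed
      also have "\<dots> = ennreal B * (\<integral>\<^sup>+w. ennreal (indicator ({a..b} \<times> {c..d}) w * (1 / cmod (z - plane_to_complex w))) \<partial>lborel)"
        by (rule nn_integral_cmult) measurable
      also have "\<dots> \<le> ennreal B * (ennreal (4 * sqrt (b - a)) * ennreal (4 * sqrt (d - c)))"
        by (intro mult_left_mono nn_integral_inverse_cmod_le) (use z in auto)
      also have "\<dots> < \<infinity>" by (simp add: ennreal_mult_less_top)
      finally show "(\<integral>\<^sup>+w. ennreal (norm (F w)) \<partial>lborel) < \<infinity>" .
      have "(\<lambda>w. \<phi> (fst w)) \<in> borel_measurable (borel :: (real \<times> real) measure)"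
        by (intro borel_measurable_continuous_onI continuous_on_compose2[OF \<phi>] continuous_intros) auto
      then show "F \<in> borel_measurable lborel"
        unfolding F_def measurable_lborel1
        by (intro borel_measurable_scaleR borel_measurable_divide borel_measurable_diff
            borel_measurable_indicator borel_measurable_of_real) auto
    qed
    \<comment> \<open>The vertical line through z is left out, since the logarithmic formula
      requires a nonzero real part; a single s does not affect the outer integral.\<close>
    have inner: "(\<integral>y. F (s, y) \<partial>lborel) = indicator {a..b} s *\<^sub>R
        (of_real (\<phi> s) * strip_log c d (z - of_real s) + of_real (pi * (\<phi> s * sgn (Re z - s))))"
      if "s \<noteq> Re z" for s
    proof -
      have "((\<lambda>y. 1 / ((z - of_real s) - \<i> * of_real y)) has_integral
         strip_log c d (z - of_real s) + of_real (pi * sgn (Re (z - of_real s)))) {c..d}"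
        by (rule has_integral_inverse_vertical) (use z that in auto)
      moreover have "integrable lborel (\<lambda>y. indicator {c..d} y *\<^sub>R (1 / ((z - of_real s) - \<i> * of_real y)))"
      proof (rule borel_integrable_compact)
        have "z - of_real s - \<i> * of_real y \<noteq> 0" for y using that by (auto simp: complex_eq_iff)
        then show "continuous_on {c..d} (\<lambda>y. 1 / (z - of_real s - \<i> * of_real y))"
          by (intro continuous_intros) auto
      qed simp
      note int = this
      have "((\<lambda>y. 1 / ((z - of_real s) - \<i> * of_real y)) has_integral
        (\<integral>y. indicator {c..d} y *\<^sub>R (1 / ((z - of_real s) - \<i> * of_real y)) \<partial>lborel)) {c..d}"
      proof -
        have "(\<lambda>y. indicator {c..d} y *\<^sub>R (1 / ((z - of_real s) - \<i> * of_real y))) =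
            (\<lambda>y. if y \<in> {c..d} then 1 / ((z - of_real s) - \<i> * of_real y) else 0)"
          by (auto simp: indicator_def)
        then show ?thesis using has_integral_integral_lborel[OF int] by (simp only: has_integral_restrict_UNIV)
      qed
      ultimately have eq: "(\<integral>y. indicator {c..d} y *\<^sub>R (1 / ((z - of_real s) - \<i> * of_real y)) \<partial>lborel) =
          strip_log c d (z - of_real s) + of_real (pi * sgn (Re (z - of_real s)))"
        using has_integral_unique by blast
      have Fs: "F (s, y) = (indicator {a..b} s * of_real (\<phi> s)) * (indicator {c..d} y *\<^sub>R (1 / ((z - of_real s) - \<i> * of_real y)))" for y
        unfolding F_def plane_to_complex_def by (auto simp: indicator_def Complex_eq diff_diff_eq)
      have "(\<integral>y. F (s, y) \<partial>lborel) = (indicator {a..b} s * of_real (\<phi> s)) *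
         (strip_log c d (z - of_real s) + of_real (pi * sgn (Re (z - of_real s))))"
        unfolding Fs integral_mult_right_zero eq ..
      then show ?thesis by (auto simp: indicator_def algebra_simps)
    qed
    have Fint2: "integrable (lborel \<Otimes>\<^sub>M lborel) F" using Fint by (simp add: lborel_prod)
    have 1: "((\<lambda>s. \<integral>y. F (s, y) \<partial>lborel) has_integral (integral\<^sup>L lborel F)) UNIV"
      using has_integral_integral_lborel[OF lborel_pair.integrable_fst'[OF Fint2]]
        lborel_pair.integral_fst'[OF Fint2] by (simp add: lborel_prod)
    have "((\<lambda>s. of_real (\<phi> s) * strip_log c d (z - of_real s)) has_integral M z) {a..b}"
      unfolding M_def interval_cbox by (intro integrable_integral integrable_continuous contH z)
    moreover have "((\<lambda>s. of_real (pi * (\<phi> s * sgn (Re z - s)))) has_integral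
         (of_real (pi * ((\<Phi> (Re z) - \<Phi> a) - (\<Phi> b - \<Phi> (Re z)))) :: complex)) {a..b}"
    proof -
      have ftc: "(\<phi> has_integral \<Phi> v - \<Phi> u) {u..v}" if "u \<le> v" for u v
        by (rule fundamental_theorem_of_calculus[OF that])
           (use \<Phi> in \<open>simp add: has_real_derivative_iff_has_vector_derivative has_vector_derivative_at_within\<close>)
      have "((\<lambda>s. \<phi> s * sgn (Re z - s)) has_integral \<Phi> (Re z) - \<Phi> a) {a..Re z}"
        by (rule has_integral_spike[OF _ _ ftc, of "{Re z}"]) (use z in auto)
      moreover have "((\<lambda>s. \<phi> s * sgn (Re z - s)) has_integral - (\<Phi> b - \<Phi> (Re z))) {Re z..b}"
        by (rule has_integral_spike[OF _ _ has_integral_neg[OF ftc], of "{Re z}"]) (use z in auto)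
      ultimately have "((\<lambda>s. \<phi> s * sgn (Re z - s)) has_integral (\<Phi> (Re z) - \<Phi> a) + - (\<Phi> b - \<Phi> (Re z))) {a..b}"
        by (rule has_integral_combine[rotated 2]) (use z in auto)
      from has_integral_linear[OF has_integral_mult_right[OF this, of pi] bounded_linear_of_real[where 'a = complex]]
      show ?thesis by (simp add: o_def)
    qed
    ultimately have "((\<lambda>s. of_real (\<phi> s) * strip_log c d (z - of_real s) + of_real (pi * (\<phi> s * sgn (Re z - s)))) has_integral
       M z + of_real (pi * ((\<Phi> (Re z) - \<Phi> a) - (\<Phi> b - \<Phi> (Re z))))) {a..b}"
      by (rule has_integral_add)
    then have "((\<lambda>s. if s \<in> {a..b} then of_real (\<phi> s) * strip_log c d (z - of_real s) + of_real (pi * (\<phi> s * sgn (Re z - s))) else 0) has_integral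
       M z + of_real (pi * ((\<Phi> (Re z) - \<Phi> a) - (\<Phi> b - \<Phi> (Re z))))) UNIV"
      by (simp only: has_integral_restrict_UNIV)
    then have "((\<lambda>s. \<integral>y. F (s, y) \<partial>lborel) has_integral
       M z + of_real (pi * ((\<Phi> (Re z) - \<Phi> a) - (\<Phi> b - \<Phi> (Re z))))) UNIV"
      by (rule has_integral_spike[of "{Re z}", rotated 2]) (auto simp: inner indicator_def)
    from has_integral_unique[OF 1 this]
    show "(\<integral>w. indicator ({a..b} \<times> {c..d}) w *\<^sub>R (of_real (\<phi> (fst w)) / (z - plane_to_complex w)) \<partial>lborel)
        = of_real (2 * pi * \<Phi> (Re z)) + (M z - of_real (pi * (\<Phi> a + \<Phi> b)))"
      unfolding F_def by (simp add: algebra_simps)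
  qed
qed

section \<open>Contour integrals over paths of bounded speed\<close>

text \<open>Composing a path with \<open>clamp01\<close> extends it continuously to the real line.\<close>

definition clamp01 :: "real \<Rightarrow> real" where
  "clamp01 t = max 0 (min 1 t)"

text \<open>The bound on the speed makes every continuous function contour integrable, bounds
  contour integrals by the supremum of the integrand, and makes the Cauchy kernel integrable over
  the product of parameter interval and plane.\<close>

definition bounded_speed :: "(real \<Rightarrow> complex) \<Rightarrow> bool" where
  "bounded_speed \<zeta> \<longleftrightarrow> continuous_on {0..1} \<zeta> \<and> (\<exists>S K. finite S \<and> \<zeta> C1_differentiable_on ({0..1} - S) \<and>
     (\<forall>t\<in>{0..1} - S. norm (vector_derivative \<zeta> (at t)) \<le> K))"

lemma C1_differentiable_on_open_Un:
  assumes "open X" "open Y" "f C1_differentiable_on X" "f C1_differentiable_on Y"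
  shows "f C1_differentiable_on X \<union> Y"
  using assms unfolding C1_differentiable_on_eq by (auto intro: continuous_on_open_Un)

text \<open>Induction on the number of pieces. Differentiability is glued on open intervals, so the
  break points and finally 0 and 1 go into the exceptional set: there only one-sided derivatives are
  given, while \<open>at t\<close> is two-sided.\<close>

lemma piecewise_C1_pathE:
  assumes "piecewise_C1_path g"
  obtains S K where "finite S" "continuous_on {0..1} g" "g C1_differentiable_on ({0..1} - S)"
    "\<And>t. t \<in> {0..1} - S \<Longrightarrow> norm (vector_derivative g (at t)) \<le> K"
proof -
  obtain m s where s: "s 0 = 0" "s m = (1::real)" and
    piece: "\<And>k. k < (m::nat) \<Longrightarrow> s k < s (Suc k) \<and>
       (\<exists>g'. continuous_on {s k..s (Suc k)} g' \<and>
         (\<forall>t\<in>{s k..s (Suc k)}. (g has_vector_derivative g' t) (at t within {s k..s (Suc k)})))"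
    using assms unfolding piecewise_C1_path_def by blast
  have "\<exists>S K. finite S \<and> 0 \<le> s k \<and> continuous_on {0..s k} g \<and> g C1_differentiable_on ({0<..<s k} - S) \<and>
      (\<forall>t\<in>{0<..<s k} - S. norm (vector_derivative g (at t)) \<le> K)" if "k \<le> m" for k
    using that
  proof (induction k)
    case 0
    show ?case using s by (auto simp: C1_differentiable_on_eq)
  next
    case (Suc k)
    obtain S K where IH: "finite S" "0 \<le> s k" "continuous_on {0..s k} g"
      "g C1_differentiable_on ({0<..<s k} - S)" "\<And>t. t \<in> {0<..<s k} - S \<Longrightarrow> norm (vector_derivative g (at t)) \<le> K"
      using Suc.IH[OF Suc_leD[OF Suc.prems]] by blast
    obtain g' where g': "s k < s (Suc k)" "continuous_on {s k..s (Suc k)} g'"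
      "\<And>t. t \<in> {s k..s (Suc k)} \<Longrightarrow> (g has_vector_derivative g' t) (at t within {s k..s (Suc k)})"
      using piece[of k] Suc.prems by auto
    have d: "(g has_vector_derivative g' t) (at t)" if "t \<in> {s k<..<s (Suc k)}" for t
      using g'(3)[of t] that by (simp add: at_within_Icc_at)
    have "bounded (g' ` {s k..s (Suc k)})"
      by (intro compact_imp_bounded compact_continuous_image g'(2)) simp
    then obtain K' where "\<forall>x\<in>g' ` {s k..s (Suc k)}. norm x \<le> K'"
      unfolding bounded_iff by blast
    then have K': "\<And>t. t \<in> {s k..s (Suc k)} \<Longrightarrow> norm (g' t) \<le> K'" by blast
    have c: "continuous_on {s k..s (Suc k)} g"
      using g'(3) has_vector_derivative_continuous continuous_on_eq_continuous_within by blast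
    have Un: "{0<..<s (Suc k)} - insert (s k) S \<subseteq> ({0<..<s k} - S) \<union> {s k<..<s (Suc k)}" by auto
    have C1: "g C1_differentiable_on {s k<..<s (Suc k)}"
      unfolding C1_differentiable_on_def
      by (intro exI[of _ g'] conjI ballI d continuous_on_subset[OF g'(2)]) auto
    show ?case
    proof (intro exI conjI ballI)
      show "finite (insert (s k) S)" using IH(1) by simp
      show "0 \<le> s (Suc k)" using IH(2) g'(1) by simp
      have "{0..s (Suc k)} = {0..s k} \<union> {s k..s (Suc k)}" using IH(2) g'(1) by auto
      then show "continuous_on {0..s (Suc k)} g"
        using continuous_on_closed_Un[OF _ _ IH(3) c] by simp
      show "g C1_differentiable_on ({0<..<s (Suc k)} - insert (s k) S)"
        by (rule C1_differentiable_on_subset[OF C1_differentiable_on_open_Un[OF _ _ IH(4) C1] Un])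
           (auto intro!: open_Diff finite_imp_closed IH(1))
      fix t assume "t \<in> {0<..<s (Suc k)} - insert (s k) S"
      then consider "t \<in> {0<..<s k} - S" | "t \<in> {s k<..<s (Suc k)}" using Un by blast
      then show "norm (vector_derivative g (at t)) \<le> max K K'"
      proof cases
        case 1
        then show ?thesis using IH(5)[of t] by simp
      next
        case 2
        then show ?thesis using K'[of t] vector_derivative_at[OF d[OF 2]] by simp
      qed
    qed
  qed
  from this[of m, OF order_refl, unfolded s] obtain S K where SK: "finite S" "continuous_on {0..1} g"
    "g C1_differentiable_on ({0<..<1} - S)" "\<And>t. t \<in> {0<..<1} - S \<Longrightarrow> norm (vector_derivative g (at t)) \<le> K"
    by blast
  have "{0..1} - (S \<union> {0, 1}) = {0<..<1} - (S \<union> {0, 1::real})" by auto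
  then show ?thesis using SK C1_differentiable_on_subset
    by (intro that[of "S \<union> {0, 1}" K]) auto
qed

lemma bounded_linear_plane_to_complex: "bounded_linear plane_to_complex"
  unfolding plane_to_complex_def
  by (rule bounded_linear_intro[where K = 1]) (auto simp: complex_eq_iff cmod_def norm_prod_def)

lemma norm_plane_to_complex [simp]: "norm (plane_to_complex p) = norm p"
  by (simp add: plane_to_complex_def cmod_def norm_prod_def)

lemma vector_derivative_plane_to_complex:
  assumes "g differentiable at t"
  shows "((plane_to_complex \<circ> g) has_vector_derivative plane_to_complex (vector_derivative g (at t))) (at t)"
proof -
  have "(g has_vector_derivative vector_derivative g (at t)) (at t)"
    using assms vector_derivative_works by blast
  from bounded_linear.has_vector_derivative[OF bounded_linear_plane_to_complex this]
  show ?thesis unfolding o_def .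
qed

lemma bounded_speed_plane_to_complex:
  assumes "piecewise_C1_path g"
  shows "bounded_speed (plane_to_complex \<circ> g)"
proof -
  obtain S K where SK: "finite S" "continuous_on {0..1} g" "g C1_differentiable_on ({0..1} - S)"
    "\<And>t. t \<in> {0..1} - S \<Longrightarrow> norm (vector_derivative g (at t)) \<le> K"
    using piecewise_C1_pathE[OF assms] by metis
  have d: "((plane_to_complex \<circ> g) has_vector_derivative plane_to_complex (vector_derivative g (at t))) (at t)"
    if "t \<in> {0..1} - S" for t
    by (rule vector_derivative_plane_to_complex) (use SK(3) that in \<open>auto simp: C1_differentiable_on_eq\<close>)
  have "(plane_to_complex \<circ> g) C1_differentiable_on ({0..1} - S)"
    unfolding C1_differentiable_on_def
    using d SK(3) unfolding C1_differentiable_on_eq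
    by (intro exI[of _ "\<lambda>t. plane_to_complex (vector_derivative g (at t))"] conjI ballI continuous_intros) auto
  moreover have "continuous_on {0..1} (plane_to_complex \<circ> g)"
    unfolding o_def by (intro continuous_intros SK)
  moreover have "norm (vector_derivative (plane_to_complex \<circ> g) (at t)) \<le> K" if "t \<in> {0..1} - S" for t
    using vector_derivative_at[OF d[OF that]] SK(4)[OF that] by simp
  ultimately show ?thesis unfolding bounded_speed_def using SK(1) by blast
qed

lemma bounded_speed_valid_path: "bounded_speed \<zeta> \<Longrightarrow> valid_path \<zeta>"
  unfolding bounded_speed_def valid_path_def piecewise_C1_differentiable_on_def by blast

text \<open>\<open>D\<close> is the velocity, set to 0 off the parameter interval and at the
  exceptional points. It turns contour integrals into integrals over the whole line with a Borel
  density, the form to which Fubini's theorem applies.\<close>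

lemma bounded_speedE:
  assumes "bounded_speed \<zeta>"
  obtains D K where "D \<in> borel_measurable borel" "0 \<le> K" "\<And>t. norm (D t) \<le> K * indicator {0..1} t"
    "\<And>f i. ((\<lambda>t. f (\<zeta> (clamp01 t)) * D t) has_integral i) UNIV \<longleftrightarrow> (f has_contour_integral i) \<zeta>"
proof -
  obtain S K where SK: "finite S" "\<zeta> C1_differentiable_on ({0..1} - S)"
    "\<And>t. t \<in> {0..1} - S \<Longrightarrow> norm (vector_derivative \<zeta> (at t)) \<le> K"
    using assms unfolding bounded_speed_def by blast
  define D where "D t = indicator ({0..1} - S) t *\<^sub>R vector_derivative \<zeta> (at t)" for t
  show ?thesis
  proof (rule that[of D "max K 0"])
    have "{0..1} - S \<in> sets borel"
      using borel_closed[OF finite_imp_closed[OF SK(1)]] by (intro sets.Diff) auto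
    then show "D \<in> borel_measurable borel"
      unfolding D_def
      by (rule borel_measurable_continuous_on_indicator)
         (use SK in \<open>auto simp: C1_differentiable_on_eq\<close>)
    show "norm (D t) \<le> max K 0 * indicator {0..1} t" for t
      using SK(3)[of t] by (auto simp: D_def indicator_def)
    fix f i
    have "((\<lambda>t. f (\<zeta> (clamp01 t)) * D t) has_integral i) UNIV \<longleftrightarrow>
        ((\<lambda>t. if t \<in> {0..1} then f (\<zeta> t) * vector_derivative \<zeta> (at t) else 0) has_integral i) UNIV"
      by (rule has_integral_spike_eq[of S]) (use SK(1) in \<open>auto simp: D_def indicator_def clamp01_def\<close>)
    also have "\<dots> \<longleftrightarrow> (f has_contour_integral i) \<zeta>"
      by (simp only: has_contour_integral has_integral_restrict_UNIV)
    finally show "((\<lambda>t. f (\<zeta> (clamp01 t)) * D t) has_integral i) UNIV \<longleftrightarrow> (f has_contour_integral i) \<zeta>" .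
  qed simp
qed

lemma continuous_on_clamp01 [continuous_intros]: "continuous_on S clamp01"
  unfolding clamp01_def[abs_def] by (intro continuous_intros)

lemma clamp01_in_path_image: "\<zeta> (clamp01 t) \<in> path_image \<zeta>"
  by (auto simp: clamp01_def path_image_def)

lemma bounded_speed_integrable:
  assumes \<zeta>: "bounded_speed \<zeta>" and f: "continuous_on (path_image \<zeta>) f"
    and D: "D \<in> borel_measurable borel" "\<And>t. norm (D t) \<le> K * indicator {0..1} t"
  shows "integrable lborel (\<lambda>t. f (\<zeta> (clamp01 t)) * D t :: complex)"
proof -
  have c: "continuous_on UNIV (\<lambda>t. f (\<zeta> (clamp01 t)))"
  proof (rule continuous_on_compose2[OF f])
    show "continuous_on UNIV (\<lambda>t. \<zeta> (clamp01 t))"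
      by (rule continuous_on_compose2[of "{0..1}" \<zeta>])
         (use \<zeta> in \<open>auto simp: bounded_speed_def clamp01_def intro!: continuous_intros\<close>)
  qed (auto simp: clamp01_in_path_image)
  have [measurable]: "(\<lambda>t. f (\<zeta> (clamp01 t))) \<in> borel_measurable borel"
    by (rule borel_measurable_continuous_onI[OF c])
  note [measurable] = D(1)
  have "compact (path_image \<zeta>)"
    using \<zeta> by (intro compact_path_image) (simp add: bounded_speed_def path_def)
  then obtain B where B: "\<And>z. z \<in> path_image \<zeta> \<Longrightarrow> norm (f z) \<le> B"
    using compact_imp_bounded[OF compact_continuous_image[OF f]] unfolding bounded_iff by auto
  have B0: "0 \<le> B" using B[OF clamp01_in_path_image[of \<zeta> 0]] norm_ge_zero order_trans by blast
  show ?thesis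
  proof (rule Bochner_Integration.integrable_bound)
    show "integrable lborel (\<lambda>t::real. indicator {0..1} t *\<^sub>R (B * K))"
      by (rule borel_integrable_compact) auto
    show "AE t in lborel. norm (f (\<zeta> (clamp01 t)) * D t) \<le> norm (indicator {0..1} t *\<^sub>R (B * K))"
    proof (rule AE_I2)
      fix t
      have "norm (f (\<zeta> (clamp01 t)) * D t) \<le> B * (K * indicator {0..1} t)"
        unfolding norm_mult by (intro mult_mono B clamp01_in_path_image D(2) B0) auto
      also have "\<dots> \<le> norm (indicator {0..1} t *\<^sub>R (B * K))" by (auto simp: indicator_def)
      finally show "norm (f (\<zeta> (clamp01 t)) * D t) \<le> norm (indicator {0..1} t *\<^sub>R (B * K))" .
    qed
  qed measurable
qed

lemma bounded_speed_contour_integral: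
  assumes \<zeta>: "bounded_speed \<zeta>" and f: "continuous_on (path_image \<zeta>) f"
    and D: "D \<in> borel_measurable borel" "\<And>t. norm (D t) \<le> K * indicator {0..1} t"
    and repr: "\<And>f i. ((\<lambda>t. f (\<zeta> (clamp01 t)) * D t) has_integral i) UNIV \<longleftrightarrow> (f has_contour_integral i) \<zeta>"
  shows "(f has_contour_integral (\<integral>t. f (\<zeta> (clamp01 t)) * D t \<partial>lborel)) \<zeta>"
  unfolding repr[symmetric]
  by (rule has_integral_integral_lborel[OF bounded_speed_integrable[OF \<zeta> f D]])

lemma bounded_speed_contour_integrable:
  assumes "bounded_speed \<zeta>" "continuous_on (path_image \<zeta>) f"
  shows "f contour_integrable_on \<zeta>"
proof -
  obtain D K where "D \<in> borel_measurable borel" "0 \<le> K" "\<And>t. norm (D t) \<le> K * indicator {0..1} t"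
    "\<And>f i. ((\<lambda>t. f (\<zeta> (clamp01 t)) * D t) has_integral i) UNIV \<longleftrightarrow> (f has_contour_integral i) \<zeta>"
    using bounded_speedE[OF assms(1)] by blast
  from bounded_speed_contour_integral[OF assms this(1,3,4)] show ?thesis
    by (rule has_contour_integral_integrable)
qed

text \<open>The bound on the speed serves as \<open>K\<close>, the parameter interval having length
  1. As \<open>K\<close> depends on the path alone, contour integrals are continuous under uniform
  convergence.\<close>

lemma bounded_speed_contour_integral_bound:
  assumes \<zeta>: "bounded_speed \<zeta>"
  obtains K where "0 \<le> K" "\<And>(f :: complex \<Rightarrow> complex) B. continuous_on (path_image \<zeta>) f \<Longrightarrow>
     (\<And>z. z \<in> path_image \<zeta> \<Longrightarrow> norm (f z) \<le> B) \<Longrightarrow> norm (contour_integral \<zeta> f) \<le> B * K"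
proof -
  obtain D K where D: "D \<in> borel_measurable borel" "0 \<le> K" "\<And>t. norm (D t) \<le> K * indicator {0..1} t"
    and repr: "\<And>f i. ((\<lambda>t. f (\<zeta> (clamp01 t)) * D t) has_integral i) UNIV \<longleftrightarrow> (f has_contour_integral i) \<zeta>"
    using bounded_speedE[OF \<zeta>] by blast
  show ?thesis
  proof (rule that[OF D(2)])
    fix f :: "complex \<Rightarrow> complex" and B assume f: "continuous_on (path_image \<zeta>) f" and B: "\<And>z. z \<in> path_image \<zeta> \<Longrightarrow> norm (f z) \<le> B"
    have B0: "0 \<le> B" using B[OF clamp01_in_path_image[of \<zeta> 0]] norm_ge_zero order_trans by blast
    have "norm (\<integral>t. f (\<zeta> (clamp01 t)) * D t \<partial>lborel) \<le> (\<integral>t. norm (f (\<zeta> (clamp01 t)) * D t) \<partial>lborel)"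
      by (rule integral_norm_bound)
    also have "\<dots> \<le> (\<integral>t. indicator {0..1::real} t *\<^sub>R (B * K) \<partial>lborel)"
    proof (rule integral_mono)
      show "integrable lborel (\<lambda>t. norm (f (\<zeta> (clamp01 t)) * D t))"
        by (intro integrable_norm bounded_speed_integrable[OF \<zeta> f D(1,3)])
      show "integrable lborel (\<lambda>t::real. indicator {0..1} t *\<^sub>R (B * K))"
        by (rule borel_integrable_compact) auto
      fix t
      have "norm (f (\<zeta> (clamp01 t)) * D t) \<le> B * (K * indicator {0..1} t)"
        unfolding norm_mult by (intro mult_mono B clamp01_in_path_image D(3) B0) auto
      then show "norm (f (\<zeta> (clamp01 t)) * D t) \<le> indicator {0..1} t *\<^sub>R (B * K)" by (simp add: mult_ac)
    qed
    also have "\<dots> = B * K" by simp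
    finally show "norm (contour_integral \<zeta> f) \<le> B * K"
      using contour_integral_unique[OF bounded_speed_contour_integral[OF \<zeta> f D(1,3) repr]] by simp
  qed
qed

text \<open>The kernel \<open>k t w\<close> is integrated in both orders. Over w first it gives the
  Cauchy transform, whose holomorphic part drops out by Cauchy's theorem in the convex strip; over t
  first it gives the winding number by Cauchy's integral formula. The factors 2 pi and 2 pi i
  combine to i. \<open>H\<close> is described only off the path, where that formula applies.\<close>

lemma contour_integral_eq_plane_integral:
  fixes \<phi> \<Phi> :: "real \<Rightarrow> real"
  assumes \<zeta>: "bounded_speed \<zeta>" and closed: "pathfinish \<zeta> = pathstart \<zeta>"
    and box: "\<And>z. z \<in> path_image \<zeta> \<Longrightarrow> a < Re z \<and> Re z < b \<and> c < Im z \<and> Im z < d"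
    and \<Phi>: "\<And>x. (\<Phi> has_real_derivative \<phi> x) (at x)" and \<phi>: "continuous_on UNIV \<phi>"
    and f: "f holomorphic_on UNIV"
  obtains H where "integrable lborel H"
    "\<And>w. plane_to_complex w \<notin> path_image \<zeta> \<Longrightarrow> H w = indicator ({a..b} \<times> {c..d}) w *\<^sub>R
      (of_real (\<phi> (fst w)) * f (plane_to_complex w) * winding_number \<zeta> (plane_to_complex w))"
    "contour_integral \<zeta> (\<lambda>z. of_real (\<Phi> (Re z)) * f z) = \<i> * (\<integral>w. H w \<partial>lborel)"
proof -
  obtain D K where D: "D \<in> borel_measurable borel" "0 \<le> K" "\<And>t. norm (D t) \<le> K * indicator {0..1} t"
    and repr: "\<And>f i. ((\<lambda>t. f (\<zeta> (clamp01 t)) * D t) has_integral i) UNIV \<longleftrightarrow> (f has_contour_integral i) \<zeta>"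
    using bounded_speedE[OF \<zeta>] by blast
  obtain h where h: "h holomorphic_on {z. c < Im z \<and> Im z < d}"
    "\<And>z. a < Re z \<Longrightarrow> Re z < b \<Longrightarrow> c < Im z \<Longrightarrow> Im z < d \<Longrightarrow>
      (\<integral>w. indicator ({a..b} \<times> {c..d}) w *\<^sub>R (of_real (\<phi> (fst w)) / (z - plane_to_complex w)) \<partial>lborel)
        = of_real (2 * pi * \<Phi> (Re z)) + h z"
    using cauchy_transform_rectangle[OF \<Phi> \<phi>, of c d a b] by blast
  define R where "R = {a..b} \<times> {c..d}"
  have [measurable]: "R \<in> sets (borel :: (real \<times> real) measure)"
    unfolding R_def by (intro borel_closed closed_Times) auto
  define z where "z t = \<zeta> (clamp01 t)" for t
  have zim: "z t \<in> path_image \<zeta>" for t unfolding z_def by (rule clamp01_in_path_image)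
  have zbox: "a < Re (z t)" "Re (z t) < b" "c < Im (z t)" "Im (z t) < d" for t
    using box[OF zim] by auto
  have valid: "valid_path \<zeta>" by (rule bounded_speed_valid_path[OF \<zeta>])
  have fcont: "continuous_on S f" for S
    using holomorphic_on_imp_continuous_on[OF f] continuous_on_subset by blast
  have zcont: "continuous_on UNIV z" unfolding z_def[abs_def]
    by (rule continuous_on_compose2[of "{0..1}" \<zeta>])
       (use \<zeta> in \<open>auto simp: bounded_speed_def clamp01_def intro!: continuous_intros\<close>)
  have [measurable]: "z \<in> borel_measurable borel" by (rule borel_measurable_continuous_onI[OF zcont])
  have [measurable]: "(\<lambda>t. f (z t)) \<in> borel_measurable borel"
    by (intro borel_measurable_continuous_onI continuous_on_compose2[OF fcont zcont]) auto
  note [measurable] = D(1)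
  have \<phi>fst: "(\<lambda>w. \<phi> (fst w)) \<in> borel_measurable (borel :: (real \<times> real) measure)"
    by (intro borel_measurable_continuous_onI continuous_on_compose2[OF \<phi>] continuous_intros) auto
  define g where "g w = indicator R w *\<^sub>R complex_of_real (\<phi> (fst w))" for w
  have [measurable]: "g \<in> borel_measurable (borel :: (real \<times> real) measure)"
    unfolding g_def using \<phi>fst
    by (intro borel_measurable_scaleR borel_measurable_indicator borel_measurable_of_real) auto
  have gdiv: "g w / q = indicator R w *\<^sub>R (of_real (\<phi> (fst w)) / q)" for w q
    by (simp add: g_def indicator_def)
  define k where "k t w = g w / (z t - plane_to_complex w) * (f (z t) * D t)" for t w
  obtain B where B: "0 \<le> B" "\<And>w. norm (g w) \<le> B * indicator R w"
  proof -
    have "bounded (\<phi> ` {a..b})"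
      by (intro compact_imp_bounded compact_continuous_image continuous_on_subset[OF \<phi>]) auto
    then obtain B where "\<forall>s\<in>{a..b}. \<bar>\<phi> s\<bar> \<le> B" unfolding bounded_iff by auto
    then have "norm (g w) \<le> max B 0 * indicator R w" for w
      by (cases "w \<in> R") (auto simp: g_def R_def le_max_iff_disj)
    then show ?thesis by (intro that[of "max B 0"]) auto
  qed
  obtain M where M: "0 \<le> M" "\<And>t. norm (f (z t)) \<le> M"
  proof -
    have "compact (path_image \<zeta>)" using valid compact_valid_path_image by blast
    then obtain M where "\<And>z. z \<in> path_image \<zeta> \<Longrightarrow> norm (f z) \<le> M"
      using compact_imp_bounded[OF compact_continuous_image[OF fcont]] unfolding bounded_iff by force
    then show ?thesis using zim norm_ge_zero order_trans by (intro that[of M]) blast+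
  qed
  have kmeas: "(\<lambda>(t, w). k t w) \<in> borel_measurable (lborel \<Otimes>\<^sub>M (lborel :: (real \<times> real) measure))"
    unfolding k_def by measurable
  \<comment> \<open>The inner integral over w is bounded uniformly in t by the estimate for the
    kernel, and the outer one runs over a bounded interval with bounded speed.\<close>
  have kint: "integrable (lborel \<Otimes>\<^sub>M (lborel :: (real \<times> real) measure)) (\<lambda>(t, w). k t w)"
  proof (rule integrableI_bounded[OF kmeas])
    define C where "C = ennreal (4 * sqrt (b - a)) * ennreal (4 * sqrt (d - c))"
    have "(\<integral>\<^sup>+x. ennreal (norm (case x of (t, w) \<Rightarrow> k t w)) \<partial>(lborel \<Otimes>\<^sub>M lborel)) =
        (\<integral>\<^sup>+t. \<integral>\<^sup>+w. ennreal (norm (k t w)) \<partial>lborel \<partial>lborel)"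
      using kmeas by (subst lborel.nn_integral_fst[symmetric]) auto
    also have "\<dots> \<le> (\<integral>\<^sup>+t. ennreal (B * (M * K)) * C * indicator {0..1::real} t \<partial>lborel)"
    proof (rule nn_integral_mono)
      fix t :: real
      have "(\<integral>\<^sup>+w. ennreal (norm (k t w)) \<partial>lborel) \<le>
        (\<integral>\<^sup>+w. ennreal (B * (M * K) * indicator {0..1} t) * ennreal (indicator R w * (1 / cmod (z t - plane_to_complex w))) \<partial>lborel)"
      proof (rule nn_integral_mono)
        fix w :: "real \<times> real"
        have le: "norm (k t w) \<le> (B * indicator R w) / cmod (z t - plane_to_complex w) * (M * (K * indicator {0..1} t))"
          unfolding k_def norm_mult norm_divide
          by (intro mult_mono divide_right_mono B M D(3)) (auto intro!: mult_nonneg_nonneg divide_nonneg_nonneg B M D)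
        have nn: "0 \<le> B * (M * K) * indicator {0..1} t" "0 \<le> indicator R w * (1 / cmod (z t - plane_to_complex w))"
          using B(1) M(1) D(2) by simp_all
        note le
        also have "B * indicator R w / cmod (z t - plane_to_complex w) * (M * (K * indicator {0..1} t)) =
           (B * (M * K) * indicator {0..1} t) * (indicator R w * (1 / cmod (z t - plane_to_complex w)))"
          by simp
        finally show "ennreal (norm (k t w)) \<le> ennreal (B * (M * K) * indicator {0..1} t) *
             ennreal (indicator R w * (1 / cmod (z t - plane_to_complex w)))"
          unfolding ennreal_mult[OF nn, symmetric] by (rule ennreal_leI)
      qed
      also have "\<dots> = ennreal (B * (M * K) * indicator {0..1} t) *
          (\<integral>\<^sup>+w. ennreal (indicator R w * (1 / cmod (z t - plane_to_complex w))) \<partial>lborel)"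
        by (rule nn_integral_cmult) measurable
      also have "\<dots> \<le> ennreal (B * (M * K) * indicator {0..1} t) * C"
        unfolding C_def R_def using zbox[of t] by (intro mult_left_mono nn_integral_inverse_cmod_le) auto
      also have "\<dots> = ennreal (B * (M * K)) * C * indicator {0..1} t"
        by (auto simp: indicator_def)
      finally show "(\<integral>\<^sup>+w. ennreal (norm (k t w)) \<partial>lborel) \<le> ennreal (B * (M * K)) * C * indicator {0..1} t" .
    qed
    also have "\<dots> = ennreal (B * (M * K)) * C"
      by (subst nn_integral_cmult_indicator) auto
    also have "\<dots> < \<infinity>" unfolding C_def by (simp add: ennreal_mult_less_top)
    finally show "(\<integral>\<^sup>+x. ennreal (norm (case x of (t, w) \<Rightarrow> k t w)) \<partial>(lborel \<Otimes>\<^sub>M lborel)) < \<infinity>" .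
  qed
  define H where "H w = (\<integral>t. k t w \<partial>lborel) / (2 * pi * \<i>)" for w
  show ?thesis
  proof (rule that[of H])
    show "integrable lborel H" unfolding H_def
      by (intro integrable_divide lborel_pair.integrable_snd kint)
    show "H w = indicator ({a..b} \<times> {c..d}) w *\<^sub>R
      (of_real (\<phi> (fst w)) * f (plane_to_complex w) * winding_number \<zeta> (plane_to_complex w))"
      if w: "plane_to_complex w \<notin> path_image \<zeta>" for w
    proof -
      define p where "p = plane_to_complex w"
      have "((\<lambda>z. f z / (z - p)) has_contour_integral (2 * pi * \<i> * winding_number \<zeta> p * f p)) \<zeta>"
        by (rule Cauchy_integral_formula_convex_simple[of UNIV])
           (use f valid w closed in \<open>auto simp: p_def\<close>)
      moreover have "((\<lambda>z. f z / (z - p)) has_contour_integral (\<integral>t. f (z t) / (z t - p) * D t \<partial>lborel)) \<zeta>"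
        unfolding z_def
        by (rule bounded_speed_contour_integral[OF \<zeta> _ D(1,3) repr])
           (use w in \<open>auto simp: p_def intro!: continuous_intros fcont\<close>)
      ultimately have int: "(\<integral>t. f (z t) / (z t - p) * D t \<partial>lborel) = 2 * pi * \<i> * winding_number \<zeta> p * f p"
        using has_contour_integral_unique by blast
      have kw: "k t w = g w * (f (z t) / (z t - p) * D t)" for t
        unfolding k_def p_def by simp
      have kint_w: "(\<integral>t. k t w \<partial>lborel) = g w * (2 * pi * \<i> * winding_number \<zeta> p * f p)"
        unfolding kw integral_mult_right_zero int ..
      have aux: "x * (2 * pi * \<i> * N * F) / (2 * pi * \<i>) = x * (F * N)" for x N F :: complex
        by (simp add: field_simps)
      have "H w = g w * (f p * winding_number \<zeta> p)" unfolding H_def kint_w aux ..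
      then show ?thesis by (simp add: g_def R_def p_def mult.assoc)
    qed
    have "(\<integral>w. (\<integral>t. k t w \<partial>lborel) \<partial>lborel) = (\<integral>t. (\<integral>w. k t w \<partial>lborel) \<partial>lborel)"
      by (rule lborel_pair.Fubini_integral[OF kint])
    also have "\<dots> = (\<integral>t. (f (z t) * (of_real (2 * pi * \<Phi> (Re (z t))) + h (z t))) * D t \<partial>lborel)"
    proof (rule Bochner_Integration.integral_cong[OF refl])
      fix t
      have "(\<integral>w. k t w \<partial>lborel) = (\<integral>w. g w / (z t - plane_to_complex w) \<partial>lborel) * (f (z t) * D t)"
        unfolding k_def integral_mult_left_zero ..
      also have "(\<integral>w. g w / (z t - plane_to_complex w) \<partial>lborel) = of_real (2 * pi * \<Phi> (Re (z t))) + h (z t)"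
        using h(2)[OF zbox, of t] unfolding gdiv R_def .
      finally show "(\<integral>w. k t w \<partial>lborel) = (f (z t) * (of_real (2 * pi * \<Phi> (Re (z t))) + h (z t))) * D t"
        by simp
    qed
    also have "\<dots> = 2 * pi * contour_integral \<zeta> (\<lambda>z. of_real (\<Phi> (Re z)) * f z)"
    proof -
      have sub: "path_image \<zeta> \<subseteq> {z. c < Im z \<and> Im z < d}" using box by auto
      have hc: "continuous_on (path_image \<zeta>) h"
        using holomorphic_on_imp_continuous_on[OF h(1)] sub continuous_on_subset by blast
      have \<Phi>c: "continuous_on S (\<lambda>z. \<Phi> (Re z))" for S
        by (rule continuous_on_compose2[OF DERIV_continuous_on[of UNIV \<Phi> \<phi>]])
           (use \<Phi> in \<open>auto intro!: continuous_intros\<close>)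
      have "((\<lambda>z. f z * (of_real (2 * pi * \<Phi> (Re z)) + h z)) has_contour_integral
         (\<integral>t. (f (z t) * (of_real (2 * pi * \<Phi> (Re (z t))) + h (z t))) * D t \<partial>lborel)) \<zeta>"
        unfolding z_def
        by (rule bounded_speed_contour_integral[OF \<zeta> _ D(1,3) repr])
           (intro continuous_intros fcont hc \<Phi>c)
      moreover have "((\<lambda>z. f z * (of_real (2 * pi * \<Phi> (Re z)) + h z)) has_contour_integral
         2 * pi * contour_integral \<zeta> (\<lambda>z. of_real (\<Phi> (Re z)) * f z) + 0) \<zeta>"
      proof -
        have "(\<lambda>z. of_real (\<Phi> (Re z)) * f z) contour_integrable_on \<zeta>"
          by (intro bounded_speed_contour_integrable[OF \<zeta>] continuous_intros fcont \<Phi>c)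
        from has_contour_integral_lmul[OF has_contour_integral_integral[OF this], of "2 * pi"]
        have 1: "((\<lambda>z. (2 * pi) * (of_real (\<Phi> (Re z)) * f z)) has_contour_integral
            (2 * pi) * contour_integral \<zeta> (\<lambda>z. of_real (\<Phi> (Re z)) * f z)) \<zeta>" .
        have "((\<lambda>z. f z * h z) has_contour_integral 0) \<zeta>"
          by (rule Cauchy_theorem_convex_simple[OF _ convex_strip[of c d] valid sub closed])
             (intro holomorphic_intros h(1) holomorphic_on_subset[OF f], auto)
        from has_contour_integral_add[OF 1 this]
        show ?thesis by (simp add: algebra_simps)
      qed
      ultimately show ?thesis using has_contour_integral_unique by fastforce
    qed
    finally show "contour_integral \<zeta> (\<lambda>z. of_real (\<Phi> (Re z)) * f z) = \<i> * (\<integral>w. H w \<partial>lborel)"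
      unfolding H_def by (simp add: field_simps)
  qed
qed

section \<open>Contour integrals of polynomials\<close>

definition on_plane :: "(real \<times> real \<Rightarrow> real) \<Rightarrow> complex \<Rightarrow> complex" where
  "on_plane P z = of_real (P (Re z, Im z))"

lemma on_plane_plane_to_complex [simp]: "on_plane P (plane_to_complex w) = of_real (P w)"
  by (simp add: on_plane_def plane_to_complex_def)

text \<open>The second argument is \<open>\<partial>g/\<partial>x + \<i> \<partial>g/\<partial>y\<close>, to which entire functions do not contribute.\<close>

inductive separable_sum :: "(complex \<Rightarrow> complex) \<Rightarrow> (complex \<Rightarrow> complex) \<Rightarrow> bool" where
  base: "(\<And>x. (\<Phi> has_real_derivative \<phi> x) (at x)) \<Longrightarrow> continuous_on UNIV \<phi> \<Longrightarrow> f holomorphic_on UNIV \<Longrightarrow>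
    separable_sum (\<lambda>z. of_real (\<Phi> (Re z)) * f z) (\<lambda>z. of_real (\<phi> (Re z)) * f z)"
| add: "separable_sum g d \<Longrightarrow> separable_sum g' d' \<Longrightarrow> separable_sum (\<lambda>z. g z + g' z) (\<lambda>z. d z + d' z)"

text \<open>A product of two generators is again a generator, as real factors multiply with real
  factors and entire ones with entire ones. The second arguments follow the product rule; sums are
  handled by distributivity.\<close>

lemma separable_sum_mult:
  assumes "separable_sum g d" "separable_sum g' d'"
  shows "separable_sum (\<lambda>z. g z * g' z) (\<lambda>z. d z * g' z + g z * d' z)"
  using assms(1)
proof induction
  case (base \<Phi> \<phi> f)
  note base1 = base
  show ?case using assms(2)
  proof induction
    case (base \<Phi>' \<phi>' f')
    have "separable_sum (\<lambda>z. of_real (\<Phi> (Re z) * \<Phi>' (Re z)) * (f z * f' z))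
        (\<lambda>z. of_real (\<phi> (Re z) * \<Phi>' (Re z) + \<phi>' (Re z) * \<Phi> (Re z)) * (f z * f' z))"
    proof (rule separable_sum.base[of "\<lambda>x. \<Phi> x * \<Phi>' x" "\<lambda>x. \<phi> x * \<Phi>' x + \<phi>' x * \<Phi> x"])
      show "((\<lambda>x. \<Phi> x * \<Phi>' x) has_real_derivative \<phi> x * \<Phi>' x + \<phi>' x * \<Phi> x) (at x)" for x
        by (rule DERIV_mult[OF base1(1) base(1)])
      show "continuous_on UNIV (\<lambda>x. \<phi> x * \<Phi>' x + \<phi>' x * \<Phi> x)"
        using DERIV_continuous_on[of UNIV \<Phi> \<phi>] DERIV_continuous_on[of UNIV \<Phi>' \<phi>'] base1 base
        by (intro continuous_intros) auto
    qed (intro holomorphic_intros base1 base)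
    then show ?case
      by (rule back_subst[of "\<lambda>(g, d). separable_sum g d" "(_, _)" "(_, _)", simplified])
         (auto simp: algebra_simps fun_eq_iff)
  next
    case (add g d g' d')
    from separable_sum.add[OF add.IH] show ?case
      by (simp add: algebra_simps)
  qed
next
  case (add g d g2 d2)
  from separable_sum.add[OF add.IH] show ?case
    by (simp add: algebra_simps)
qed

lemma separable_sum_real_polynomial:
  assumes "real_polynomial_function p"
  shows "\<exists>d. separable_sum (on_plane p) d"
  using assms
proof induction
  case (linear p)
  define \<alpha> \<beta> where "\<alpha> = p (1, 0)" and "\<beta> = p (0, 1)"
  have p: "p (x, y) = \<alpha> * x + \<beta> * y" for x y
  proof -
    interpret bounded_linear p by fact
    have "p (x, y) = p (x *\<^sub>R (1, 0) + y *\<^sub>R (0, 1))" by simp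
    also have "\<dots> = \<alpha> * x + \<beta> * y" unfolding add scaleR \<alpha>_def \<beta>_def by simp
    finally show ?thesis .
  qed
  \<comment> \<open>Since y = i x - i z, the linear function \<alpha> x + \<beta> y equals (\<alpha>
    + i \<beta>) x - i \<beta> z: a real part times a constant, plus an entire function.\<close>
  have 1: "separable_sum (\<lambda>z. of_real (Re z) * (of_real \<alpha> + \<i> * of_real \<beta>)) (\<lambda>z. of_real 1 * (of_real \<alpha> + \<i> * of_real \<beta>))"
    by (rule separable_sum.base[of "\<lambda>x. x" "\<lambda>x. 1"]) (auto intro!: holomorphic_intros derivative_eq_intros)
  have 2: "separable_sum (\<lambda>z. of_real 1 * (- \<i> * of_real \<beta> * z)) (\<lambda>z. of_real 0 * (- \<i> * of_real \<beta> * z))"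
    by (rule separable_sum.base[of "\<lambda>x. 1" "\<lambda>x. 0"]) (auto intro!: holomorphic_intros derivative_eq_intros)
  have "(\<lambda>z. of_real (Re z) * (of_real \<alpha> + \<i> * of_real \<beta>) + of_real 1 * (- \<i> * of_real \<beta> * z)) = on_plane p"
    by (auto simp: on_plane_def p complex_eq_iff algebra_simps)
  with separable_sum.add[OF 1 2] show ?case by auto
next
  case (const c)
  have "separable_sum (\<lambda>z. of_real c * 1) (\<lambda>z. of_real 0 * 1)"
    by (rule separable_sum.base[of "\<lambda>x. c" "\<lambda>x. 0"]) (auto intro!: holomorphic_intros derivative_eq_intros)
  then show ?case by (auto simp: on_plane_def[abs_def])
next
  case (add p q)
  then obtain d d' where "separable_sum (on_plane p) d" "separable_sum (on_plane q) d'" by blast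
  from separable_sum.add[OF this] show ?case by (auto simp: on_plane_def[abs_def])
next
  case (mult p q)
  then obtain d d' where "separable_sum (on_plane p) d" "separable_sum (on_plane q) d'" by blast
  from separable_sum_mult[OF this] show ?case by (auto simp: on_plane_def[abs_def])
qed

text \<open>For an entire f the partial derivative in y is i times that in x, so the terms
  containing \<open>deriv f\<close> cancel in \<open>gx z + \<i> * gy z\<close>. This recovers the
  partial derivatives from \<open>d\<close> when g is real.\<close>

lemma separable_sum_partials:
  assumes "separable_sum g d"
  shows "\<exists>gx gy. continuous_on UNIV g \<and> continuous_on UNIV gx \<and> continuous_on UNIV gy \<and>
    (\<forall>x y. ((\<lambda>x. g (Complex x y)) has_vector_derivative gx (Complex x y)) (at x)) \<and>
    (\<forall>x y. ((\<lambda>y. g (Complex x y)) has_vector_derivative gy (Complex x y)) (at y)) \<and>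
    (\<forall>z. d z = gx z + \<i> * gy z)"
  using assms
proof induction
  case (base \<Phi> \<phi> f)
  have f: "(f has_field_derivative deriv f z) (at z)" for z
    using base(3) by (simp add: holomorphic_derivI)
  have f': "continuous_on UNIV (deriv f)"
    by (intro holomorphic_on_imp_continuous_on holomorphic_deriv base(3)) auto
  have fc: "continuous_on UNIV f" by (intro holomorphic_on_imp_continuous_on base(3))
  have cRe: "continuous_on UNIV (\<lambda>z. k (Re z))" if "continuous_on UNIV k" for k :: "real \<Rightarrow> real"
    by (rule continuous_on_compose2[OF that]) (auto intro!: continuous_intros)
  have \<Phi>c: "continuous_on UNIV \<Phi>" using DERIV_continuous_on[of UNIV \<Phi> \<phi>] base(1) by auto
  have Cx: "((\<lambda>x. Complex x y) has_vector_derivative 1) (at x)" for x y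
    unfolding Complex_eq by (auto intro!: derivative_eq_intros)
  have Cy: "((\<lambda>y. Complex x y) has_vector_derivative \<i>) (at y)" for x y
    unfolding Complex_eq by (auto intro!: derivative_eq_intros)
  have \<Phi>v: "((\<lambda>x. complex_of_real (\<Phi> x)) has_vector_derivative of_real (\<phi> x)) (at x)" for x
    using base(1)[of x] by (simp add: has_vector_derivative_of_real has_real_derivative_iff_has_vector_derivative)
  have fx: "((\<lambda>x. f (Complex x y)) has_vector_derivative 1 * deriv f (Complex x y)) (at x)" for x y
    using field_vector_diff_chain_at[OF Cx f] by (simp add: o_def)
  have fy: "((\<lambda>y. f (Complex x y)) has_vector_derivative \<i> * deriv f (Complex x y)) (at y)" for x y
    using field_vector_diff_chain_at[OF Cy f] by (simp add: o_def)
  have ii: "\<i> * (u * (\<i> * v)) = - (u * v)" for u v :: complex by (simp add: complex_eq_iff)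
  show ?case
  proof (intro exI conjI allI)
    show "continuous_on UNIV (\<lambda>z. of_real (\<Phi> (Re z)) * f z)"
      by (intro continuous_intros cRe \<Phi>c fc)
    show "continuous_on UNIV (\<lambda>z. of_real (\<phi> (Re z)) * f z + of_real (\<Phi> (Re z)) * deriv f z)"
      by (intro continuous_intros cRe \<Phi>c fc f' base(2))
    show "continuous_on UNIV (\<lambda>z. of_real (\<Phi> (Re z)) * (\<i> * deriv f z))"
      by (intro continuous_intros cRe \<Phi>c f')
    show "((\<lambda>x. of_real (\<Phi> (Re (Complex x y))) * f (Complex x y)) has_vector_derivative
       of_real (\<phi> (Re (Complex x y))) * f (Complex x y) + of_real (\<Phi> (Re (Complex x y))) * deriv f (Complex x y)) (at x)" for x y
      using has_vector_derivative_mult[OF \<Phi>v fx] by (simp add: algebra_simps)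
    show "((\<lambda>y. of_real (\<Phi> (Re (Complex x y))) * f (Complex x y)) has_vector_derivative
       of_real (\<Phi> (Re (Complex x y))) * (\<i> * deriv f (Complex x y))) (at y)" for x y
      using has_vector_derivative_mult_right[OF fy] by simp
    show "of_real (\<phi> (Re z)) * f z = of_real (\<phi> (Re z)) * f z + of_real (\<Phi> (Re z)) * deriv f z +
        \<i> * (of_real (\<Phi> (Re z)) * (\<i> * deriv f z))" for z
      by (simp add: ii)
  qed
next
  case (add g d g' d')
  then obtain gx gy gx' gy' where
    "continuous_on UNIV g" "continuous_on UNIV gx" "continuous_on UNIV gy"
    "\<And>x y. ((\<lambda>x. g (Complex x y)) has_vector_derivative gx (Complex x y)) (at x)"
    "\<And>x y. ((\<lambda>y. g (Complex x y)) has_vector_derivative gy (Complex x y)) (at y)"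
    "\<And>z. d z = gx z + \<i> * gy z"
    "continuous_on UNIV g'" "continuous_on UNIV gx'" "continuous_on UNIV gy'"
    "\<And>x y. ((\<lambda>x. g' (Complex x y)) has_vector_derivative gx' (Complex x y)) (at x)"
    "\<And>x y. ((\<lambda>y. g' (Complex x y)) has_vector_derivative gy' (Complex x y)) (at y)"
    "\<And>z. d' z = gx' z + \<i> * gy' z"
    by metis
  then show ?case
    by (intro exI[of _ "\<lambda>z. gx z + gx' z"] exI[of _ "\<lambda>z. gy z + gy' z"] conjI allI
          continuous_on_add has_vector_derivative_add) (auto simp: algebra_simps)
qed

text \<open>The condition on winding numbers encodes orientation and multiplicity of all curves
  together. It is imposed almost everywhere because winding numbers enter only through plane
  integrals.\<close>

locale contour_cycle =
  fixes E :: "(real \<times> real) set" and n :: nat and \<zeta> :: "nat \<Rightarrow> real \<Rightarrow> complex"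
  assumes E: "compact E" "xconvex E" "xconvex (prod.swap ` E)"
    and speed: "\<And>i. i < n \<Longrightarrow> bounded_speed (\<zeta> i)"
    and closed: "\<And>i. i < n \<Longrightarrow> pathfinish (\<zeta> i) = pathstart (\<zeta> i)"
    and image: "\<And>i. i < n \<Longrightarrow> path_image (\<zeta> i) \<subseteq> plane_to_complex ` E"
    and winding: "AE w in lborel. (\<forall>i<n. plane_to_complex w \<notin> path_image (\<zeta> i)) \<and>
      (\<Sum>i<n. winding_number (\<zeta> i) (plane_to_complex w)) = indicator E w"
begin

text \<open>Each curve contributes a plane integral weighted by its winding number, taken over a
  common square around \<open>E\<close>; almost everywhere the weights add up to the indicator of
  \<open>E\<close>.\<close>

lemma sum_contour_integral_base:
  fixes \<phi> \<Phi> :: "real \<Rightarrow> real"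
  assumes \<Phi>: "\<And>x. (\<Phi> has_real_derivative \<phi> x) (at x)" and \<phi>: "continuous_on UNIV \<phi>"
    and f: "f holomorphic_on UNIV"
  shows "(\<Sum>i<n. contour_integral (\<zeta> i) (\<lambda>z. of_real (\<Phi> (Re z)) * f z)) =
    \<i> * (\<integral>w. indicator E w *\<^sub>R (of_real (\<phi> (Re (plane_to_complex w))) * f (plane_to_complex w)) \<partial>lborel)"
proof -
  obtain B where B: "\<And>w. w \<in> E \<Longrightarrow> norm w < B"
    using compact_imp_bounded[OF E(1)] bounded_pos_less by blast
  have Ebox: "-B < x \<and> x < B \<and> -B < y \<and> y < B" if "(x, y) \<in> E" for x y
  proof -
    have "\<bar>x\<bar> < B" "\<bar>y\<bar> < B"
      using B[OF that] norm_fst_le[of x y] norm_snd_le[of y x] by auto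
    then show ?thesis by auto
  qed
  define F where "F w = of_real (\<phi> (fst w)) * f (plane_to_complex w)" for w
  have "\<forall>i\<in>{..<n}. \<exists>H. integrable lborel H \<and>
     (\<forall>w. plane_to_complex w \<notin> path_image (\<zeta> i) \<longrightarrow> H w = indicator ({-B..B} \<times> {-B..B}) w *\<^sub>R
      (of_real (\<phi> (fst w)) * f (plane_to_complex w) * winding_number (\<zeta> i) (plane_to_complex w))) \<and>
     contour_integral (\<zeta> i) (\<lambda>z. of_real (\<Phi> (Re z)) * f z) = \<i> * (\<integral>w. H w \<partial>lborel)"
  proof
    fix i assume "i \<in> {..<n}"
    then have i: "i < n" by simp
    have "-B < Re z \<and> Re z < B \<and> -B < Im z \<and> Im z < B" if "z \<in> path_image (\<zeta> i)" for z
      using image[OF i] that Ebox by (auto simp: plane_to_complex_def)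
    note box = this
    show "\<exists>H. integrable lborel H \<and>
     (\<forall>w. plane_to_complex w \<notin> path_image (\<zeta> i) \<longrightarrow> H w = indicator ({-B..B} \<times> {-B..B}) w *\<^sub>R
      (of_real (\<phi> (fst w)) * f (plane_to_complex w) * winding_number (\<zeta> i) (plane_to_complex w))) \<and>
     contour_integral (\<zeta> i) (\<lambda>z. of_real (\<Phi> (Re z)) * f z) = \<i> * (\<integral>w. H w \<partial>lborel)"
    proof (rule contour_integral_eq_plane_integral[where a = "-B" and b = B and c = "-B" and d = B,
        OF speed[OF i] closed[OF i] box \<Phi> \<phi> f])
      fix H assume "integrable lborel H" "\<And>w. plane_to_complex w \<notin> path_image (\<zeta> i) \<Longrightarrow> H w =
      indicator ({-B..B} \<times> {-B..B}) w *\<^sub>R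
      (of_real (\<phi> (fst w)) * f (plane_to_complex w) * winding_number (\<zeta> i) (plane_to_complex w))"
     "contour_integral (\<zeta> i) (\<lambda>z. of_real (\<Phi> (Re z)) * f z) = \<i> * (\<integral>w. H w \<partial>lborel)"
      then show ?thesis by (intro exI[of _ H] conjI allI impI)
    qed
  qed
  from bchoice[OF this] obtain H where HH: "\<forall>i\<in>{..<n}. integrable lborel (H i) \<and>
     (\<forall>w. plane_to_complex w \<notin> path_image (\<zeta> i) \<longrightarrow> H i w = indicator ({-B..B} \<times> {-B..B}) w *\<^sub>R
      (of_real (\<phi> (fst w)) * f (plane_to_complex w) * winding_number (\<zeta> i) (plane_to_complex w))) \<and>
     contour_integral (\<zeta> i) (\<lambda>z. of_real (\<Phi> (Re z)) * f z) = \<i> * (\<integral>w. H i w \<partial>lborel)"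
    by (rule exE)
  have H: "integrable lborel (H i)"
    "plane_to_complex w \<notin> path_image (\<zeta> i) \<Longrightarrow> H i w = indicator ({-B..B} \<times> {-B..B}) w *\<^sub>R
      (F w * winding_number (\<zeta> i) (plane_to_complex w))"
    "contour_integral (\<zeta> i) (\<lambda>z. of_real (\<Phi> (Re z)) * f z) = \<i> * (\<integral>w. H i w \<partial>lborel)"
    if "i < n" for i w
    using bspec[OF HH, of i] that unfolding F_def by blast+
  have "(\<Sum>i<n. contour_integral (\<zeta> i) (\<lambda>z. of_real (\<Phi> (Re z)) * f z)) = \<i> * (\<integral>w. (\<Sum>i<n. H i w) \<partial>lborel)"
    using H(1,3) by (simp add: sum_distrib_left)
  also have "(\<integral>w. (\<Sum>i<n. H i w) \<partial>lborel) = (\<integral>w. indicator E w *\<^sub>R F w \<partial>lborel)"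
  proof (rule integral_cong_AE)
    show "(\<lambda>w. \<Sum>i<n. H i w) \<in> borel_measurable lborel"
      by (intro borel_measurable_sum borel_measurable_integrable H(1)) simp
    have "continuous_on UNIV (\<lambda>w :: real \<times> real. \<phi> (fst w))"
      by (rule continuous_on_compose2[OF \<phi>]) (auto intro!: continuous_intros)
    moreover have "continuous_on UNIV (\<lambda>w. f (plane_to_complex w))"
      by (rule continuous_on_compose2[OF holomorphic_on_imp_continuous_on[OF f]]) (auto intro!: continuous_intros)
    ultimately have "continuous_on UNIV F" unfolding F_def by (intro continuous_intros)
    then have "continuous_on E F" by (rule continuous_on_subset) simp
    then show "(\<lambda>w. indicator E w *\<^sub>R F w) \<in> borel_measurable lborel"
      using borel_measurable_continuous_on_indicator[of E F] borel_compact[OF E(1)] by simp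
    show "AE w in lborel. (\<Sum>i<n. H i w) = indicator E w *\<^sub>R F w"
      using winding
    proof eventually_elim
      case (elim w)
      have "(\<Sum>i<n. H i w) = (\<Sum>i<n. indicator ({-B..B} \<times> {-B..B}) w *\<^sub>R F w * winding_number (\<zeta> i) (plane_to_complex w))"
        using elim H(2) by (intro sum.cong) auto
      also have "\<dots> = indicator ({-B..B} \<times> {-B..B}) w *\<^sub>R F w * indicator E w"
        by (simp only: sum_distrib_left[symmetric] conjunct2[OF elim])
      also have "\<dots> = indicator E w *\<^sub>R F w"
        using Ebox[of "fst w" "snd w"] by (cases w) (auto simp: indicator_def)
      finally show ?case .
    qed
  qed
  finally show ?thesis by (simp add: F_def plane_to_complex_def)
qed

lemma sum_contour_integral_separable:
  assumes "separable_sum g d"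
  shows "(\<Sum>i<n. contour_integral (\<zeta> i) g) = \<i> * (\<integral>w. indicator E w *\<^sub>R d (plane_to_complex w) \<partial>lborel)"
  using assms
proof induction
  case (base \<Phi> \<phi> f)
  then show ?case by (rule sum_contour_integral_base)
next
  case (add g d g' d')
  have cont: "continuous_on S g" "continuous_on S g'" for S
    using separable_sum_partials[OF add.hyps(1)] separable_sum_partials[OF add.hyps(2)] continuous_on_subset
    by (meson subset_UNIV)+
  have contd: "continuous_on UNIV d" if sep: "separable_sum g d" for g d
  proof -
    obtain gx gy where "continuous_on UNIV gx" "continuous_on UNIV gy" "\<And>z. d z = gx z + \<i> * gy z"
      using separable_sum_partials[OF sep] by blast
    then show ?thesis by (simp add: continuous_intros)
  qed
  have int: "integrable lborel (\<lambda>w. indicator E w *\<^sub>R d (plane_to_complex w))" if "separable_sum g d" for g d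
    by (intro borel_integrable_compact E continuous_on_compose2[OF contd[OF that]] continuous_intros) auto
  have "(\<Sum>i<n. contour_integral (\<zeta> i) (\<lambda>z. g z + g' z)) = (\<Sum>i<n. contour_integral (\<zeta> i) g) + (\<Sum>i<n. contour_integral (\<zeta> i) g')"
    unfolding sum.distrib[symmetric]
    by (intro sum.cong refl contour_integral_add bounded_speed_contour_integrable speed cont) auto
  also have "\<dots> = \<i> * (\<integral>w. indicator E w *\<^sub>R (d (plane_to_complex w) + d' (plane_to_complex w)) \<partial>lborel)"
    unfolding add.IH scaleR_add_right distrib_left[symmetric]
    by (subst Bochner_Integration.integral_add[OF int[OF add.hyps(1)] int[OF add.hyps(2)]]) simp
  finally show ?case .
qed

text \<open>For real p the real and imaginary parts of \<open>d\<close> are the two partial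
  derivatives of p. Hence i times the integral of \<open>d\<close> is \<open>\<i> * I - J\<close>,
  and Fubini's theorem turns both area integrals into boundary terms.\<close>

lemma sum_contour_integral_polynomial:
  assumes "real_polynomial_function p"
  obtains I J where "(xdiff p E has_integral I) UNIV" "(ydiff p E has_integral J) UNIV"
    "(\<Sum>i<n. contour_integral (\<zeta> i) (on_plane p)) = \<i> * I - J"
proof -
  obtain d where d: "separable_sum (on_plane p) d" using separable_sum_real_polynomial[OF assms] by blast
  obtain gx gy where g: "continuous_on UNIV gx" "continuous_on UNIV gy"
    "\<And>x y. ((\<lambda>x. on_plane p (Complex x y)) has_vector_derivative gx (Complex x y)) (at x)"
    "\<And>x y. ((\<lambda>y. on_plane p (Complex x y)) has_vector_derivative gy (Complex x y)) (at y)"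
    "\<And>z. d z = gx z + \<i> * gy z"
    using separable_sum_partials[OF d] by blast
  define px where "px w = Re (gx (plane_to_complex w))" for w
  define py where "py w = Re (gy (plane_to_complex w))" for w
  have op: "on_plane p (Complex x y) = of_real (p (x, y))" for x y by (simp add: on_plane_def)
  have px: "((\<lambda>x. p (x, y)) has_vector_derivative px (x, y)) (at x)"
    and px0: "Im (gx (Complex x y)) = 0" for x y
  proof -
    show "((\<lambda>x. p (x, y)) has_vector_derivative px (x, y)) (at x)"
      using bounded_linear.has_vector_derivative[OF bounded_linear_Re g(3)[of y x]]
      by (simp add: op px_def plane_to_complex_def)
    have "((\<lambda>x. 0) has_vector_derivative Im (gx (Complex x y))) (at x)"
      using bounded_linear.has_vector_derivative[OF bounded_linear_Im g(3)[of y x]] by (simp add: op)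
    then show "Im (gx (Complex x y)) = 0"
      using vector_derivative_unique_at has_vector_derivative_const by blast
  qed
  have py: "((\<lambda>y. p (x, y)) has_vector_derivative py (x, y)) (at y)"
    and py0: "Im (gy (Complex x y)) = 0" for x y
  proof -
    show "((\<lambda>y. p (x, y)) has_vector_derivative py (x, y)) (at y)"
      using bounded_linear.has_vector_derivative[OF bounded_linear_Re g(4)[of x y]]
      by (simp add: op py_def plane_to_complex_def)
    have "((\<lambda>y. 0) has_vector_derivative Im (gy (Complex x y))) (at y)"
      using bounded_linear.has_vector_derivative[OF bounded_linear_Im g(4)[of x y]] by (simp add: op)
    then show "Im (gy (Complex x y)) = 0"
      using vector_derivative_unique_at has_vector_derivative_const by blast
  qed
  have dp: "d (plane_to_complex w) = of_real (px w) + \<i> * of_real (py w)" for w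
    using px0[of "fst w" "snd w"] py0[of "fst w" "snd w"]
    by (simp add: g(5) px_def py_def plane_to_complex_def complex_eq_iff)
  have cx: "continuous_on E px" and cy: "continuous_on E py"
    unfolding px_def py_def
    by (intro continuous_intros continuous_on_compose2[OF g(1)] continuous_on_compose2[OF g(2)]; simp)+
  define I where "I = (\<integral>w. indicator E w *\<^sub>R px w \<partial>lborel)"
  define J where "J = (\<integral>w. indicator E w *\<^sub>R py w \<partial>lborel)"
  have ix: "integrable lborel (\<lambda>w. indicator E w *\<^sub>R px w)" and iy: "integrable lborel (\<lambda>w. indicator E w *\<^sub>R py w)"
    by (intro borel_integrable_compact E cx cy)+
  show ?thesis
  proof (rule that[of I J])
    show "(xdiff p E has_integral I) UNIV"
      unfolding I_def
    proof (rule has_integral_xdiff[OF E(1,2) cx])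
      show "((\<lambda>x. px (x, y)) has_integral p (r, y) - p (l, y)) {l..r}" if "l \<le> r" for y l r
        by (rule fundamental_theorem_of_calculus[OF that]) (use px in \<open>auto intro: has_vector_derivative_at_within\<close>)
    qed
    show "(ydiff p E has_integral J) UNIV"
      unfolding J_def
    proof (rule has_integral_ydiff[OF E(1,3) cy])
      show "((\<lambda>y. py (x, y)) has_integral p (x, r) - p (x, l)) {l..r}" if "l \<le> r" for x l r
        by (rule fundamental_theorem_of_calculus[OF that]) (use py in \<open>auto intro: has_vector_derivative_at_within\<close>)
    qed
    have "(\<integral>w. indicator E w *\<^sub>R d (plane_to_complex w) \<partial>lborel) =
       (\<integral>w. of_real (indicator E w *\<^sub>R px w) + \<i> * of_real (indicator E w *\<^sub>R py w) \<partial>lborel)"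
      by (rule Bochner_Integration.integral_cong) (auto simp: dp indicator_def)
    also have "\<dots> = of_real I + \<i> * of_real J"
    proof -
      have "(\<integral>w. complex_of_real (indicator E w *\<^sub>R px w) + \<i> * of_real (indicator E w *\<^sub>R py w) \<partial>lborel) =
        (\<integral>w. complex_of_real (indicator E w *\<^sub>R px w) \<partial>lborel) + (\<integral>w. \<i> * of_real (indicator E w *\<^sub>R py w) \<partial>lborel)"
        by (intro Bochner_Integration.integral_add integrable_mult_right integrable_of_real ix iy)
      then show ?thesis unfolding I_def J_def integral_mult_right_zero integral_complex_of_real .
    qed
    finally show "(\<Sum>i<n. contour_integral (\<zeta> i) (on_plane p)) = \<i> * I - J"
      unfolding sum_contour_integral_separable[OF d] by (simp add: algebra_simps)
  qed
qed

end

section \<open>Green's theorem\<close>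

lemma has_integral_xdiff_bound:
  assumes E: "compact E" "xconvex E" and I: "(xdiff P E has_integral I) UNIV"
    and M: "\<And>z. z \<in> E \<Longrightarrow> \<bar>P z\<bar> \<le> M"
  shows "\<bar>I\<bar> \<le> 2 * M * integral UNIV (\<lambda>y. if {x. (x, y) \<in> E} = {} then 0 else 1)"
proof -
  have "norm (integral UNIV (xdiff P E)) \<le> integral UNIV (\<lambda>y. 2 * M * (if {x. (x, y) \<in> E} = {} then 0 else 1))"
  proof (rule integral_norm_bound_integral)
    show "xdiff P E integrable_on UNIV" using I by blast
    show "(\<lambda>y. 2 * M * (if {x. (x, y) \<in> E} = {} then 0 else 1)) integrable_on UNIV"
      by (intro integrable_on_mult_right integrable_bound_compact E(1))
    show "norm (xdiff P E y) \<le> 2 * M * (if {x. (x, y) \<in> E} = {} then 0 else 1)" for y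
      using xdiff_bound[of E P M y, OF E M] by (auto split: if_splits)
  qed
  then show ?thesis using integral_unique[OF I] by simp
qed

lemma has_integral_xdiff_diff:
  assumes "(xdiff P E has_integral I) UNIV" "(xdiff Q E has_integral J) UNIV"
  shows "(xdiff (\<lambda>z. P z - Q z) E has_integral I - J) UNIV"
proof -
  have "xdiff (\<lambda>z. P z - Q z) E = (\<lambda>y. xdiff P E y - xdiff Q E y)"
    by (auto simp: xdiff_def)
  with has_integral_diff[OF assms] show ?thesis by simp
qed

lemma eq_if_le_all_epsilon:
  fixes a b :: real
  assumes "\<And>e. e > 0 \<Longrightarrow> \<bar>a - b\<bar> \<le> e * C"
  shows "a = b"
proof (rule ccontr)
  assume "a \<noteq> b"
  \<comment> \<open>With this value of e the right-hand side is at most half of the distance,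
    whatever the sign of C.\<close>
  then have "\<bar>a - b\<bar> / (2 * (\<bar>C\<bar> + 1)) > 0" by simp
  from assms[OF this] have "\<bar>a - b\<bar> \<le> \<bar>a - b\<bar> * (C / (2 * (\<bar>C\<bar> + 1)))" by simp
  also have "\<dots> \<le> \<bar>a - b\<bar> * (1 / 2)"
    by (intro mult_left_mono) (auto simp: field_simps)
  finally show False using \<open>a \<noteq> b\<close> by simp
qed

context contour_cycle
begin

lemma continuous_on_plane:
  assumes "i < n" "continuous_on E P"
  shows "continuous_on (path_image (\<zeta> i)) (on_plane P)"
  unfolding on_plane_def
  by (intro continuous_intros continuous_on_compose2[OF assms(2)])
     (use image[OF assms(1)] in \<open>auto simp: plane_to_complex_def\<close>)

lemma sum_contour_integral_bound:
  obtains K where "0 \<le> K" "\<And>P e. continuous_on E P \<Longrightarrow> (\<And>z. z \<in> E \<Longrightarrow> \<bar>P z\<bar> \<le> e) \<Longrightarrow>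
    norm (\<Sum>i<n. contour_integral (\<zeta> i) (on_plane P)) \<le> e * K"
proof -
  have "\<forall>i\<in>{..<n}. \<exists>K\<ge>0. \<forall>(f :: complex \<Rightarrow> complex) B. continuous_on (path_image (\<zeta> i)) f \<longrightarrow>
     (\<forall>z\<in>path_image (\<zeta> i). norm (f z) \<le> B) \<longrightarrow> norm (contour_integral (\<zeta> i) f) \<le> B * K"
  proof
    fix i assume "i \<in> {..<n}"
    then have i: "i < n" by simp
    show "\<exists>K\<ge>0. \<forall>(f :: complex \<Rightarrow> complex) B. continuous_on (path_image (\<zeta> i)) f \<longrightarrow>
     (\<forall>z\<in>path_image (\<zeta> i). norm (f z) \<le> B) \<longrightarrow> norm (contour_integral (\<zeta> i) f) \<le> B * K"
    proof (rule bounded_speed_contour_integral_bound[OF speed[OF i]])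
      fix K :: real assume "0 \<le> K" and K: "\<And>f B. continuous_on (path_image (\<zeta> i)) f \<Longrightarrow>
        (\<And>z. z \<in> path_image (\<zeta> i) \<Longrightarrow> norm (f z) \<le> B) \<Longrightarrow> norm (contour_integral (\<zeta> i) f) \<le> B * K"
      then show ?thesis by (intro exI[of _ K] conjI allI impI K) auto
    qed
  qed
  from bchoice[OF this] obtain K where "\<forall>i\<in>{..<n}. 0 \<le> K i \<and> (\<forall>(f :: complex \<Rightarrow> complex) B.
      continuous_on (path_image (\<zeta> i)) f \<longrightarrow> (\<forall>z\<in>path_image (\<zeta> i). norm (f z) \<le> B) \<longrightarrow>
      norm (contour_integral (\<zeta> i) f) \<le> B * K i)"
    by (rule exE)
  from bspec[OF this] have K: "0 \<le> K i"
    "continuous_on (path_image (\<zeta> i)) f \<Longrightarrow> (\<And>z. z \<in> path_image (\<zeta> i) \<Longrightarrow> norm (f z) \<le> B) \<Longrightarrow>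
     norm (contour_integral (\<zeta> i) f) \<le> B * K i" if "i < n" for i f B
    using that by simp_all
  show ?thesis
  proof (rule that[of "\<Sum>i<n. K i"])
    show "0 \<le> (\<Sum>i<n. K i)" using K(1) by (intro sum_nonneg) auto
    fix P :: "real \<times> real \<Rightarrow> real" and e assume P: "continuous_on E P" "\<And>z. z \<in> E \<Longrightarrow> \<bar>P z\<bar> \<le> e"
    have "norm (\<Sum>i<n. contour_integral (\<zeta> i) (on_plane P)) \<le> (\<Sum>i<n. e * K i)"
    proof (rule sum_norm_le)
      fix i assume "i \<in> {..<n}"
      then have i: "i < n" by simp
      show "norm (contour_integral (\<zeta> i) (on_plane P)) \<le> e * K i"
        by (rule K(2)[OF i continuous_on_plane[OF i P(1)]]) (use image[OF i] P(2) in auto)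
    qed
    then show "norm (\<Sum>i<n. contour_integral (\<zeta> i) (on_plane P)) \<le> e * (\<Sum>i<n. K i)"
      by (simp add: sum_distrib_left)
  qed
qed

lemma sum_contour_integral_diff:
  assumes "continuous_on E P" "continuous_on E Q"
  shows "(\<Sum>i<n. contour_integral (\<zeta> i) (on_plane (\<lambda>z. P z - Q z))) =
    (\<Sum>i<n. contour_integral (\<zeta> i) (on_plane P)) - (\<Sum>i<n. contour_integral (\<zeta> i) (on_plane Q))"
proof -
  have "on_plane (\<lambda>z. P z - Q z) = (\<lambda>z. on_plane P z - on_plane Q z)"
    by (simp add: on_plane_def[abs_def])
  then show ?thesis
    by (simp add: sum_subtractf[symmetric])
       (intro sum.cong refl contour_integral_diff bounded_speed_contour_integrable speed continuous_on_plane assms; simp)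
qed

lemma polynomial_approximation:
  assumes P: "continuous_on E P" and e: "0 < e"
  obtains p where "real_polynomial_function p" "continuous_on E p" "\<And>z. z \<in> E \<Longrightarrow> \<bar>P z - p z\<bar> \<le> e"
proof -
  obtain p where p: "real_polynomial_function p" "\<And>z. z \<in> E \<Longrightarrow> \<bar>P z - p z\<bar> < e"
    by (rule Stone_Weierstrass_real_polynomial_function[OF E(1) P e]) blast
  moreover have "continuous_on E p"
    using p(1) continuous_on_polymonial_function real_polynomial_function_eq by blast
  ultimately show ?thesis using that less_imp_le by blast
qed

text \<open>Both sides are linear in \<open>P\<close> and bounded by a multiple of its supremum on
  \<open>E\<close>, and they agree on polynomials. The integral of the boundary term is assumed to
  exist; the area side provides it.\<close>

lemma Im_sum_contour_integral:
  assumes P: "continuous_on E P" and I: "(xdiff P E has_integral I) UNIV"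
  shows "Im (\<Sum>i<n. contour_integral (\<zeta> i) (on_plane P)) = I"
proof -
  obtain K where K: "0 \<le> K" "\<And>P e. continuous_on E P \<Longrightarrow> (\<And>z. z \<in> E \<Longrightarrow> \<bar>P z\<bar> \<le> e) \<Longrightarrow>
    norm (\<Sum>i<n. contour_integral (\<zeta> i) (on_plane P)) \<le> e * K"
    using sum_contour_integral_bound by blast
  define L where "L = integral UNIV (\<lambda>y. if {x. (x, y) \<in> E} = {} then 0 else 1 :: real)"
  show ?thesis
  proof (rule eq_if_le_all_epsilon)
    fix e :: real assume "e > 0"
    obtain p where p: "real_polynomial_function p" "continuous_on E p" "\<And>z. z \<in> E \<Longrightarrow> \<bar>P z - p z\<bar> \<le> e"
      using polynomial_approximation[OF P \<open>e > 0\<close>] by blast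
    obtain Ip Jp where pI: "(xdiff p E has_integral Ip) UNIV"
      and pS: "(\<Sum>i<n. contour_integral (\<zeta> i) (on_plane p)) = \<i> * of_real Ip - of_real Jp"
      using sum_contour_integral_polynomial[OF p(1)] by metis
    have c: "continuous_on E (\<lambda>z. P z - p z)" by (intro continuous_intros P p)
    have "norm ((\<Sum>i<n. contour_integral (\<zeta> i) (on_plane P)) - (\<Sum>i<n. contour_integral (\<zeta> i) (on_plane p))) \<le> e * K"
      using K(2)[OF c p(3)] unfolding sum_contour_integral_diff[OF P p(2)] .
    from order_trans[OF abs_Im_le_cmod this]
    have "\<bar>Im (\<Sum>i<n. contour_integral (\<zeta> i) (on_plane P)) - Ip\<bar> \<le> e * K"
      unfolding pS by simp
    moreover have "\<bar>I - Ip\<bar> \<le> 2 * e * L"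
      unfolding L_def by (rule has_integral_xdiff_bound[OF E(1,2) has_integral_xdiff_diff[OF I pI] p(3)])
    ultimately show "\<bar>Im (\<Sum>i<n. contour_integral (\<zeta> i) (on_plane P)) - I\<bar> \<le> e * (K + 2 * L)"
      by (simp add: algebra_simps)
  qed
qed

lemma Re_sum_contour_integral:
  assumes Q: "continuous_on E Q" and J: "(ydiff Q E has_integral J) UNIV"
  shows "Re (\<Sum>i<n. contour_integral (\<zeta> i) (on_plane Q)) = - J"
proof -
  obtain K where K: "0 \<le> K" "\<And>P e. continuous_on E P \<Longrightarrow> (\<And>z. z \<in> E \<Longrightarrow> \<bar>P z\<bar> \<le> e) \<Longrightarrow>
    norm (\<Sum>i<n. contour_integral (\<zeta> i) (on_plane P)) \<le> e * K"
    using sum_contour_integral_bound by blast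
  define L where "L = integral UNIV (\<lambda>y. if {x. (x, y) \<in> prod.swap ` E} = {} then 0 else 1 :: real)"
  show ?thesis
  proof (rule eq_if_le_all_epsilon)
    fix e :: real assume "e > 0"
    obtain p where p: "real_polynomial_function p" "continuous_on E p" "\<And>z. z \<in> E \<Longrightarrow> \<bar>Q z - p z\<bar> \<le> e"
      using polynomial_approximation[OF Q \<open>e > 0\<close>] by blast
    obtain Ip Jp where pJ: "(ydiff p E has_integral Jp) UNIV"
      and pS: "(\<Sum>i<n. contour_integral (\<zeta> i) (on_plane p)) = \<i> * of_real Ip - of_real Jp"
      using sum_contour_integral_polynomial[OF p(1)] by metis
    have c: "continuous_on E (\<lambda>z. Q z - p z)" by (intro continuous_intros Q p)
    have "norm ((\<Sum>i<n. contour_integral (\<zeta> i) (on_plane Q)) - (\<Sum>i<n. contour_integral (\<zeta> i) (on_plane p))) \<le> e * K"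
      using K(2)[OF c p(3)] unfolding sum_contour_integral_diff[OF Q p(2)] .
    from order_trans[OF abs_Re_le_cmod this]
    have "\<bar>Re (\<Sum>i<n. contour_integral (\<zeta> i) (on_plane Q)) + Jp\<bar> \<le> e * K"
      unfolding pS by simp
    moreover have "\<bar>J - Jp\<bar> \<le> 2 * e * L"
      unfolding L_def
      by (rule has_integral_xdiff_bound[OF compact_swap[OF E(1)] E(3)
            has_integral_xdiff_diff[OF J[unfolded ydiff_def] pJ[unfolded ydiff_def]]]) (use p(3) in auto)
    ultimately show "\<bar>Re (\<Sum>i<n. contour_integral (\<zeta> i) (on_plane Q)) - - J\<bar> \<le> e * (K + 2 * L)"
      by (simp add: algebra_simps)
  qed
qed

end

text \<open>For real P and Q and dz = dx + i dy, the imaginary part of P dz is P dy and the real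
  part of Q dz is Q dx.\<close>

lemma line_integral_eq_contour_integral:
  assumes g: "piecewise_C1_path g" and P: "continuous_on (path_image g) P" and Q: "continuous_on (path_image g) Q"
  shows "line_integral_dy_dx P Q g =
    Im (contour_integral (plane_to_complex \<circ> g) (on_plane P)) + Re (contour_integral (plane_to_complex \<circ> g) (on_plane Q))"
proof -
  define \<zeta> where "\<zeta> = plane_to_complex \<circ> g"
  obtain S K where S: "finite S" "g C1_differentiable_on ({0..1} - S)"
    using piecewise_C1_pathE[OF g] by metis
  have sp: "bounded_speed \<zeta>" unfolding \<zeta>_def by (rule bounded_speed_plane_to_complex[OF g])
  have d: "vector_derivative \<zeta> (at t) = plane_to_complex (vector_derivative g (at t))" if "t \<in> {0..1} - S" for t
    unfolding \<zeta>_def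
    by (rule vector_derivative_at[OF vector_derivative_plane_to_complex])
       (use S(2) that in \<open>auto simp: C1_differentiable_on_eq\<close>)
  have op: "on_plane u (\<zeta> t) = of_real (u (g t))" for u t by (simp add: \<zeta>_def)
  have int: "((\<lambda>t. of_real (u (g t)) * vector_derivative \<zeta> (at t)) has_integral contour_integral \<zeta> (on_plane u)) {0..1}"
    if u: "continuous_on (path_image g) u" for u
  proof -
    have "continuous_on (path_image \<zeta>) (on_plane u)"
      unfolding on_plane_def
      by (intro continuous_intros continuous_on_compose2[OF u])
         (auto simp: \<zeta>_def path_image_def plane_to_complex_def)
    from has_contour_integral_integral[OF bounded_speed_contour_integrable[OF sp this]]
    show ?thesis unfolding has_contour_integral op .
  qed
  have "((\<lambda>t. Im (of_real (P (g t)) * vector_derivative \<zeta> (at t)) + Re (of_real (Q (g t)) * vector_derivative \<zeta> (at t)))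
     has_integral Im (contour_integral \<zeta> (on_plane P)) + Re (contour_integral \<zeta> (on_plane Q))) {0..1}"
    using has_integral_linear[OF int[OF P] bounded_linear_Im] has_integral_linear[OF int[OF Q] bounded_linear_Re]
    by (intro has_integral_add) (auto simp: o_def)
  then have "((\<lambda>t. P (g t) * snd (vector_derivative g (at t)) + Q (g t) * fst (vector_derivative g (at t)))
     has_integral Im (contour_integral \<zeta> (on_plane P)) + Re (contour_integral \<zeta> (on_plane Q))) {0..1}"
    by (rule has_integral_spike[OF negligible_finite[OF S(1)], rotated]) (simp add: d plane_to_complex_def)
  then show ?thesis
    unfolding line_integral_dy_dx_def \<zeta>_def by (rule integral_unique)
qed

section \<open>Winding numbers of the boundary curves\<close>

lemma inj_plane_to_complex: "plane_to_complex p = plane_to_complex q \<longleftrightarrow> p = q"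
  by (auto simp: plane_to_complex_def prod_eq_iff)

lemma outside_plane_to_complex:
  assumes "p \<in> outside S"
  shows "plane_to_complex p \<in> outside (plane_to_complex ` S)"
proof -
  define X where "X = connected_component_set (- S) p"
  have p: "p \<in> - S" "\<not> bounded X" using assms unfolding outside_def X_def by auto
  have X: "connected X" "X \<subseteq> - S" "p \<in> X"
    unfolding X_def using p(1) by (auto simp: connected_component_subset connected_component_refl)
  have "connected (plane_to_complex ` X)"
    by (intro connected_continuous_image X(1) continuous_intros)
  moreover have "plane_to_complex ` X \<subseteq> - plane_to_complex ` S"
    using X(2) by (auto simp: inj_plane_to_complex)
  ultimately have sub: "plane_to_complex ` X \<subseteq> connected_component_set (- plane_to_complex ` S) (plane_to_complex p)"
    using X(3) by (intro connected_component_maximal) auto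
  have "\<not> bounded (plane_to_complex ` X)"
    using p(2) unfolding bounded_iff by auto
  then show ?thesis
    unfolding outside using sub bounded_subset by blast
qed

text \<open>The horizontal half-line starting at p and pointing away from the convex slice misses
  \<open>E\<close> and is unbounded. So a point off the closed region is not enclosed by any
  boundary curve.\<close>

lemma xconvex_Compl_subset_outside:
  assumes "xconvex E" "p \<notin> E"
  shows "p \<in> outside E"
proof -
  obtain x y where p: "p = (x, y)" by (cases p)
  define D where "D = {x. (x, y) \<in> E}"
  have "convex D" "x \<notin> D" using assms unfolding D_def xconvex_def p by auto
  then have D: "(\<forall>u\<in>D. x < u) \<or> (\<forall>u\<in>D. u < x)"
    using mem_is_interval_1_I[of D _ _ x] is_interval_convex_1 by (metis linorder_not_less nle_le)
  \<comment> \<open>If the slice is empty, the condition holds vacuously and the left half-line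
    serves.\<close>
  define r where "r = (if \<forall>u\<in>D. x < u then {..x} else {x..})"
  define A where "A = r \<times> {y}"
  have "u \<notin> D" if "u \<in> r" for u using D that unfolding r_def by (auto split: if_splits)
  then have "A \<subseteq> - E" unfolding A_def D_def by auto
  moreover have "connected A"
    unfolding A_def r_def by (auto intro!: convex_connected convex_Times)
  moreover have "p \<in> A" unfolding A_def r_def p by auto
  ultimately have "A \<subseteq> connected_component_set (- E) p"
    by (intro connected_component_maximal)
  moreover have "\<not> bounded A"
  proof
    assume "bounded A"
    then have "bounded (fst ` A)" by (rule bounded_fst)
    moreover have "fst ` A = r" unfolding A_def by force
    ultimately have "bounded r" by simp
    then obtain B where B: "\<And>u. u \<in> r \<Longrightarrow> \<bar>u\<bar> \<le> B" unfolding bounded_iff by auto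
    have "x - \<bar>x\<bar> - \<bar>B\<bar> - 1 \<in> r \<or> x + \<bar>x\<bar> + \<bar>B\<bar> + 1 \<in> r" unfolding r_def by auto
    then show False using B[of "x - \<bar>x\<bar> - \<bar>B\<bar> - 1"] B[of "x + \<bar>x\<bar> + \<bar>B\<bar> + 1"] by linarith
  qed
  ultimately show ?thesis unfolding outside using bounded_subset by blast
qed

lemma negligible_path_image_piecewise_C1:
  assumes "piecewise_C1_path g"
  shows "negligible (path_image g)"
proof -
  obtain S where S: "finite S" "g C1_differentiable_on ({0..1} - S)"
    using piecewise_C1_pathE[OF assms] by metis
  have "negligible (g ` ({0..1} - S))"
    by (rule negligible_differentiable_image_lowdim) (use S(2) C1_diff_imp_diff in auto)
  moreover have "negligible (g ` S)" using S(1) by (simp add: negligible_finite)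
  ultimately have "negligible (g ` ({0..1} - S) \<union> g ` S)" by (rule negligible_Un)
  then show ?thesis by (rule negligible_subset) (auto simp: path_image_def)
qed

lemma type_III_region_xconvex:
  assumes "type_III_region E"
  shows "xconvex E" "xconvex (prod.swap ` E)"
proof -
  obtain c d \<omega>3 \<omega>4 where II: "E = {(x, y). \<omega>3 y \<le> x \<and> x \<le> \<omega>4 y \<and> c \<le> y \<and> y \<le> d}"
    using assms unfolding type_III_region_def type_II_region_def by blast
  have "{x. (x, y) \<in> E} = (if c \<le> y \<and> y \<le> d then {\<omega>3 y..\<omega>4 y} else {})" for y
    unfolding II by auto
  then show "xconvex E" unfolding xconvex_def by simp
  obtain a b \<omega>1 \<omega>2 where I: "E = {(x, y). \<omega>1 x \<le> y \<and> y \<le> \<omega>2 x \<and> a \<le> x \<and> x \<le> b}"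
    using assms unfolding type_III_region_def type_I_region_def by blast
  have "{y. (y, x) \<in> prod.swap ` E} = (if a \<le> x \<and> x \<le> b then {\<omega>1 x..\<omega>2 x} else {})" for x
    unfolding I by (auto simp: image_iff)
  then show "xconvex (prod.swap ` E)" unfolding xconvex_def by simp
qed

text \<open>The frontier is a null set. Off it, a point of the closure lies in \<Omega>, hence
  inside exactly one curve and outside all others; a point off the closure is outside all curves,
  since convex slices leave no holes.\<close>

lemma contour_cycle_boundary:
  assumes op: "open \<Omega>" and bd: "bounded \<Omega>" and \<gamma>: "counterclockwise_boundary \<Omega> n \<gamma>"
    and III: "type_III_region (closure \<Omega>)"
  shows "contour_cycle (closure \<Omega>) n (\<lambda>i. plane_to_complex \<circ> \<gamma> i)"
proof -
  have curve: "simple_path (\<gamma> i)" "pathfinish (\<gamma> i) = pathstart (\<gamma> i)" "piecewise_C1_path (\<gamma> i)"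
    "counterclockwise (\<gamma> i)" if "i < n" for i
    using \<gamma> that unfolding counterclockwise_boundary_def simple_closed_piecewise_C1_def by auto
  have fr: "frontier \<Omega> = (\<Union>i<n. path_image (\<gamma> i))"
    and in1: "\<And>p. p \<in> \<Omega> \<Longrightarrow> \<exists>!i. i < n \<and> p \<in> inside (path_image (\<gamma> i))"
    using \<gamma> unfolding counterclockwise_boundary_def by auto
  have im: "path_image (plane_to_complex \<circ> \<gamma> i) = plane_to_complex ` path_image (\<gamma> i)" for i
    by (auto simp: path_image_def)
  have "negligible (frontier \<Omega>)"
    unfolding fr by (intro negligible_Union) (auto intro: negligible_path_image_piecewise_C1 curve)
  then have "frontier \<Omega> \<in> null_sets lborel"
    by (auto simp: negligible_iff_null_sets null_sets_completion_iff)
  then have "AE w in lborel. w \<notin> frontier \<Omega>" by (rule AE_not_in)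
  then have "AE w in lborel. (\<forall>i<n. plane_to_complex w \<notin> path_image (plane_to_complex \<circ> \<gamma> i)) \<and>
    (\<Sum>i<n. winding_number (plane_to_complex \<circ> \<gamma> i) (plane_to_complex w)) = indicator (closure \<Omega>) w"
  proof eventually_elim
    case (elim w)
    have nim: "w \<notin> path_image (\<gamma> i)" if "i < n" for i using elim that fr by auto
    have W0: "winding_number (plane_to_complex \<circ> \<gamma> i) (plane_to_complex w) = 0"
      if "i < n" "w \<in> outside (path_image (\<gamma> i))" for i
    proof (rule winding_number_zero_in_outside)
      show "path (plane_to_complex \<circ> \<gamma> i)"
        using bounded_speed_plane_to_complex[OF curve(3)[OF that(1)]] bounded_speed_valid_path valid_path_imp_path by blast
      show "pathfinish (plane_to_complex \<circ> \<gamma> i) = pathstart (plane_to_complex \<circ> \<gamma> i)"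
        using curve(2)[OF that(1)] by (simp add: pathfinish_def pathstart_def)
      show "plane_to_complex w \<in> outside (path_image (plane_to_complex \<circ> \<gamma> i))"
        unfolding im by (rule outside_plane_to_complex[OF that(2)])
    qed
    have "(\<Sum>i<n. winding_number (plane_to_complex \<circ> \<gamma> i) (plane_to_complex w)) = indicator (closure \<Omega>) w"
    proof (cases "w \<in> closure \<Omega>")
      case True
      then have "w \<in> \<Omega>" using elim op by (auto simp: frontier_def interior_open)
      then obtain j where j: "j < n" "w \<in> inside (path_image (\<gamma> j))"
        "\<And>i. i < n \<Longrightarrow> w \<in> inside (path_image (\<gamma> i)) \<Longrightarrow> i = j"
        using in1 by blast
      have "winding_number (plane_to_complex \<circ> \<gamma> i) (plane_to_complex w) = (if i = j then 1 else 0)" if "i < n" for i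
      proof (cases "i = j")
        case True
        then show ?thesis using curve(4)[OF j(1)] j(2) unfolding counterclockwise_def by simp
      next
        case False
        then have "w \<notin> inside (path_image (\<gamma> i))" using j(3)[OF that] by blast
        then have "w \<in> outside (path_image (\<gamma> i))" using nim[OF that] inside_Un_outside by blast
        then show ?thesis using W0[OF that] False by simp
      qed
      then have "(\<Sum>i<n. winding_number (plane_to_complex \<circ> \<gamma> i) (plane_to_complex w)) = (\<Sum>i<n. if i = j then 1 else 0)"
        by (intro sum.cong) auto
      also have "\<dots> = 1" using j(1) by simp
      finally show ?thesis using True by simp
    next
      case False
      have "w \<in> outside (path_image (\<gamma> i))" if "i < n" for i
      proof -
        have "path_image (\<gamma> i) \<subseteq> closure \<Omega>" using fr that by (auto simp: frontier_def)
        then show ?thesis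
          using xconvex_Compl_subset_outside[OF type_III_region_xconvex(1)[OF III] False] outside_mono by blast
      qed
      then show ?thesis using W0 False by simp
    qed
    moreover have "plane_to_complex w \<notin> path_image (plane_to_complex \<circ> \<gamma> i)" if "i < n" for i
      unfolding im using nim[OF that] by (auto simp: inj_plane_to_complex)
    ultimately show ?case by blast
  qed
  then show ?thesis
  proof unfold_locales
    show "compact (closure \<Omega>)" using bd by (simp add: compact_closure)
    show "xconvex (closure \<Omega>)" "xconvex (prod.swap ` closure \<Omega>)"
      using type_III_region_xconvex[OF III] by auto
    fix i assume i: "i < n"
    show "bounded_speed (plane_to_complex \<circ> \<gamma> i)"
      by (rule bounded_speed_plane_to_complex[OF curve(3)[OF i]])
    show "pathfinish (plane_to_complex \<circ> \<gamma> i) = pathstart (plane_to_complex \<circ> \<gamma> i)"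
      using curve(2)[OF i] by (simp add: pathfinish_def pathstart_def)
    show "path_image (plane_to_complex \<circ> \<gamma> i) \<subseteq> plane_to_complex ` closure \<Omega>"
      unfolding im using fr i by (auto simp: frontier_def)
  qed
qed

theorem theorem4p7:
  fixes \<Omega> U :: "(real \<times> real) set"
    and P Q :: "real \<times> real \<Rightarrow> real"
    and n :: nat
    and \<gamma> :: "nat \<Rightarrow> real \<Rightarrow> real \<times> real"
  assumes "open \<Omega>" and "bounded \<Omega>"
    and "counterclockwise_boundary \<Omega> n \<gamma>"
    and "type_III_region (closure \<Omega>)"
    and "open U" and "closure \<Omega> \<subseteq> U"
    and "class_S1 U P" and "class_S1 U Q"
    and "(\<lambda>p. specular_partial P (1, 0) p - specular_partial Q (0, 1) p)
           absolutely_integrable_on closure \<Omega>"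
  shows "integral (closure \<Omega>) (\<lambda>p. specular_partial P (1, 0) p - specular_partial Q (0, 1) p)
       = (\<Sum>i<n. line_integral_dy_dx P Q (\<gamma> i))"
proof -
  interpret contour_cycle "closure \<Omega>" n "\<lambda>i. plane_to_complex \<circ> \<gamma> i"
    by (rule contour_cycle_boundary) fact+
  \<comment> \<open>The integrals \<open>I\<close> and \<open>J\<close> of the boundary terms link
    the two sides: their existence comes from the area side, and the curve side then evaluates the
    line integrals to the same numbers.\<close>
  obtain I J where I: "(xdiff P (closure \<Omega>) has_integral I) UNIV" and J: "(ydiff Q (closure \<Omega>) has_integral J) UNIV"
    and f: "((\<lambda>p. specular_partial P (1, 0) p - specular_partial Q (0, 1) p) has_integral I - J) (closure \<Omega>)"
    using green_class_S1[OF E assms(5-9)] by blast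
  have P: "continuous_on (closure \<Omega>) P" and Q: "continuous_on (closure \<Omega>) Q"
    using assms(6-8) continuous_on_subset unfolding class_S1_def by blast+
  have "line_integral_dy_dx P Q (\<gamma> i) = Im (contour_integral (plane_to_complex \<circ> \<gamma> i) (on_plane P)) +
     Re (contour_integral (plane_to_complex \<circ> \<gamma> i) (on_plane Q))" if "i < n" for i
  proof (rule line_integral_eq_contour_integral)
    show "piecewise_C1_path (\<gamma> i)"
      using assms(3) that unfolding counterclockwise_boundary_def simple_closed_piecewise_C1_def by blast
    have "path_image (\<gamma> i) \<subseteq> closure \<Omega>"
      using assms(3) that unfolding counterclockwise_boundary_def by (auto simp: frontier_def)
    then show "continuous_on (path_image (\<gamma> i)) P" "continuous_on (path_image (\<gamma> i)) Q"
      using P Q continuous_on_subset by blast+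
  qed
  then have "(\<Sum>i<n. line_integral_dy_dx P Q (\<gamma> i)) =
      Im (\<Sum>i<n. contour_integral (plane_to_complex \<circ> \<gamma> i) (on_plane P)) +
      Re (\<Sum>i<n. contour_integral (plane_to_complex \<circ> \<gamma> i) (on_plane Q))"
    by (simp add: sum.distrib)
  also have "\<dots> = I - J"
    using Im_sum_contour_integral[OF P I] Re_sum_contour_integral[OF Q J] by simp
  finally show ?thesis using integral_unique[OF f] by simp
qed

end
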